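(* $(\mathbb P\otimes\tilde{\mathbb P}\otimes\mathbb P)$-almost surely (for $(X,Y,X')$ distributed according to $\mathbb P\otimes\tilde{\mathbb P}\otimes\mathbb P$), $$\lim_{\delta\to 0}\lim_{n\to\infty}\frac{1}{n\delta}\log\frac{W_n^{\delta}(X|Y)}{W_n^{\delta}(X|X')}=\mathbf s(\mathbb P|\tilde{\mathbb P}).$$
   Context: Let $A$ be a finite set, $p(x,y)$ the transition matrix of an irreducible discrete-time Markov chain on $A$ with $p(x,x)=0$ for all $x$, and $c,\tilde c:A\to(0,\infty)$. Consider the continuous-time Markov chains on $A$ with generators $$Lf(x)=\sum_{y\in A}c(x)p(x,y)(f(y)-f(x)),\qquad \tilde Lf(x)=\sum_{y\in A}\tilde c(x)p(x,y)(f(y)-f(x)),$$ with unique stationary distributions $\mu$ and $\tilde\mu$ respectively. $\mathbb P$ (resp. $\tilde{\mathbb P}$) is the path-space law of the chain with generator $L$ (resp. $\tilde L$) started from $\mu$ (resp. $\tilde\mu$). $X$ and its independent copy $X'$ have law $\mathbb P$, and $Y$, independent of them, has law $\tilde{\mathbb P}$. Waiting times: for $\delta>0$ and $n\ge 1$, $$W_n^\delta(X|Y)=\inf\{k\ge 1:(X_{\delta},X_{2\delta},\dots,X_{n\delta})=(Y_{(k+1)\delta},\dots,Y_{(k+n)\delta})\}$$ (with $\inf\emptyset=\infty$), and $W_n^\delta(X|X')$ is defined in the same way with $Y$ replaced by $X'$. Relative entropy per unit time: $$\mathbf s(\mathbb P|\tilde{\mathbb P})=\lim_{t\to\infty}\frac1t\int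 d\mathbb P\,\log\frac{d\mathbb P^{[0,t]}}{d\tilde{\mathbb P}^{[0,t]}}=\sum_{x\in A}\mu(x)c(x)\log\frac{c(x)}{\tilde c(x)}-\sum_{x\in A}\mu(x)(c(x)-\tilde c(x)),$$ where $\mathbb P^{[0,t]}$, $\tilde{\mathbb P}^{[0,t]}$ are the restrictions of $\mathbb P,\tilde{\mathbb P}$ to the sigma-field generated by the path up to time $t$. *)

theory Defs
  imports "HOL-Probability.Probability"
begin

definition stochastic_matrix :: "('a::finite \<Rightarrow> 'a \<Rightarrow> real) \<Rightarrow> bool" where
  "stochastic_matrix p \<longleftrightarrow> (\<forall>x y. 0 \<le> p x y) \<and> (\<forall>x. (\<Sum>y\<in>UNIV. p x y) = 1)"

primrec step_prob :: "('a::finite \<Rightarrow> 'a \<Rightarrow> real) \<Rightarrow> nat \<Rightarrow> 'a \<Rightarrow> 'a \<Rightarrow> real" where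
  "step_prob p 0 x y = (if x = y then 1 else 0)"
| "step_prob p (Suc n) x y = (\<Sum>z\<in>UNIV. p x z * step_prob p n z y)"

definition irreducible_matrix :: "('a::finite \<Rightarrow> 'a \<Rightarrow> real) \<Rightarrow> bool" where
  "irreducible_matrix p \<longleftrightarrow> (\<forall>x y. \<exists>n. 0 < step_prob p n x y)"

definition generator :: "('a::finite \<Rightarrow> real) \<Rightarrow> ('a \<Rightarrow> 'a \<Rightarrow> real) \<Rightarrow> ('a \<Rightarrow> real) \<Rightarrow> 'a \<Rightarrow> real" where
  "generator c p f x = (\<Sum>y\<in>UNIV. c x * p x y * (f y - f x))"

text \<open>The semigroup \<open>e\<^sup>t\<^sup>L\<close>, as a power series. It converges because the generator is a
  linear operator on a finite-dimensional space.\<close>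

definition semigroup :: "(('a::finite \<Rightarrow> real) \<Rightarrow> 'a \<Rightarrow> real) \<Rightarrow> real \<Rightarrow> ('a \<Rightarrow> real) \<Rightarrow> 'a \<Rightarrow> real" where
  "semigroup L t f x = (\<Sum>n. t ^ n / fact n * (L ^^ n) f x)"

definition trans_prob :: "(('a::finite \<Rightarrow> real) \<Rightarrow> 'a \<Rightarrow> real) \<Rightarrow> real \<Rightarrow> 'a \<Rightarrow> 'a \<Rightarrow> real" where
  "trans_prob L t x y = semigroup L t (indicator {y}) x"

definition stationary :: "(('a::finite \<Rightarrow> real) \<Rightarrow> 'a \<Rightarrow> real) \<Rightarrow> 'a pmf \<Rightarrow> bool" where
  "stationary L \<mu> \<longleftrightarrow> (\<forall>t\<ge>0. \<forall>f.
     measure_pmf.expectation \<mu> (semigroup L t f) = measure_pmf.expectation \<mu> f)"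

text \<open>Right-continuity and left limits for the discrete topology on the state space, where
  convergence means being eventually constant.\<close>

definition cadlag :: "(real \<Rightarrow> 'a) \<Rightarrow> bool" where
  "cadlag \<omega> \<longleftrightarrow> (\<forall>t\<ge>0. \<forall>\<^sub>F s in at_right t. \<omega> s = \<omega> t) \<and>
               (\<forall>t>0. \<exists>a. \<forall>\<^sub>F s in at_left t. \<omega> s = a)"

definition path_space :: "(real \<Rightarrow> 'a) measure" where
  "path_space = restrict_space (\<Pi>\<^sub>M t\<in>{0..}. count_space UNIV) {\<omega>. cadlag \<omega>}"

definition path_filtration :: "real \<Rightarrow> (real \<Rightarrow> 'a) measure" where
  "path_filtration t = sigma (space path_space)
     {{\<omega> \<in> space path_space. \<omega> s \<in> B} | s B. 0 \<le> s \<and> s \<le> t}"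

text \<open>Path-space law of the chain with generator \<open>L\<close> and initial distribution \<open>\<nu>\<close>, determined
  by its finite-dimensional distributions.\<close>

definition ctmc_law :: "(('a::finite \<Rightarrow> real) \<Rightarrow> 'a \<Rightarrow> real) \<Rightarrow> 'a pmf \<Rightarrow> (real \<Rightarrow> 'a) measure \<Rightarrow> bool" where
  "ctmc_law L \<nu> P \<longleftrightarrow> prob_space P \<and> sets P = sets path_space \<and>
     (\<forall>(n::nat) (t::nat \<Rightarrow> real) (x::nat \<Rightarrow> 'a). t 0 = 0 \<longrightarrow> (\<forall>i<n. t i < t (Suc i)) \<longrightarrow>
        measure P {\<omega> \<in> space P. \<forall>i\<le>n. \<omega> (t i) = x i} =
          pmf \<nu> (x 0) * (\<Prod>i<n. trans_prob L (t (Suc i) - t i) (x i) (x (Suc i))))"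

text \<open>The argument order of \<^const>\<open>KL_divergence\<close> is reversed: \<open>KL_divergence b M N\<close> integrates
  \<open>log b (dN/dM)\<close> against \<open>N\<close>.\<close>

definition relative_entropy_rate :: "(real \<Rightarrow> 'a) measure \<Rightarrow> (real \<Rightarrow> 'a) measure \<Rightarrow> real" where
  "relative_entropy_rate P P' = Lim at_top (\<lambda>t::real. 1 / t *
     KL_divergence (exp 1) (restr_to_subalg P' (path_filtration t))
                           (restr_to_subalg P (path_filtration t)))"

text \<open>On \<^typ>\<open>enat\<close>, the infimum of the empty set is \<open>\<infinity>\<close>.\<close>

definition waiting_time :: "real \<Rightarrow> nat \<Rightarrow> (real \<Rightarrow> 'a) \<Rightarrow> (real \<Rightarrow> 'a) \<Rightarrow> enat" where
  "waiting_time \<delta> n X Y =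
     Inf (enat ` {k. 1 \<le> k \<and> (\<forall>i\<in>{1..n}. X (real i * \<delta>) = Y (real (k + i) * \<delta>))})"

text \<open>Extended logarithm. Since \<open>a / \<infinity> = 0\<close> in \<^typ>\<open>ereal\<close>, including \<open>\<infinity> / \<infinity> = 0\<close>, the logarithm
  of a ratio of waiting times is finite only if both waiting times are.\<close>

definition ln_ereal :: "ereal \<Rightarrow> ereal" where
  "ln_ereal x = (if x \<le> 0 then -\<infinity> else if x = \<infinity> then \<infinity> else ereal (ln (real_of_ereal x)))"

definition log_waiting_ratio :: "real \<Rightarrow> nat \<Rightarrow> (real \<Rightarrow> 'a) \<Rightarrow> (real \<Rightarrow> 'a) \<Rightarrow> (real \<Rightarrow> 'a) \<Rightarrow> ereal" where
  "log_waiting_ratio \<delta> n X Y X' =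
     ln_ereal (ereal_of_enat (waiting_time \<delta> n X Y) / ereal_of_enat (waiting_time \<delta> n X X'))"

end

theory Submission
  imports Defs
begin

text \<open>For a step \<open>\<delta>\<close> let \<open>p\<^sub>\<delta>\<close> and \<open>p'\<^sub>\<delta>\<close> be the transition matrices of the two sampled chains. The waiting
  time for the word \<open>w = (X \<delta>, \<dots>, X (n \<delta>))\<close> in \<open>Y\<close> is about the inverse of its weight, the product of the
  \<open>p'\<^sub>\<delta> (w i) (w (i + 1))\<close>, so by the ergodic theorem \<open>(ln W\<^sub>n) / n\<close> tends to the cross entropy
  \<open>- (\<Sum>x y. \<mu> x * p\<^sub>\<delta> x y * ln (p'\<^sub>\<delta> x y))\<close>. Subtracting the same limit for \<open>X'\<close> leaves the relative
  entropy of one step, whose quotient by \<open>\<delta>\<close> converges as \<open>\<delta>\<close> tends to 0. The relative entropy of the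
  path laws on \<open>{0..t}\<close> is the limit of that of dyadic skeletons, so it is affine in \<open>t\<close> with
  the same slope.

  The exceptional null set must not depend on \<open>\<delta>\<close>. The idea is to replace sampling times by short windows
  in which a path is unlikely to jump. For the ergodic theorem, polynomially many cells of \<open>\<delta>\<close> suffice
  against exponentially small probabilities. For the upper bound, exponentially many cells are needed, but
  the failure of all trials is superexponentially unlikely. For the lower bound, the number of pairs of
  cells of \<open>(k \<delta>, \<delta>)\<close> is only polynomially larger than the number of trials.\<close>

section \<open>The transition semigroup\<close>

text \<open>The two bounds on waiting times need cells of different size because a match in
  \<open>Y\<close> starts at time \<open>k \<delta>\<close> with \<open>k\<close> of exponential
  order. Moving \<open>\<delta>\<close> by \<open>d\<close> moves the match by about
  \<open>k d\<close>, so a match that has to be produced is stable only on cells of exponentially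
  small width. To exclude early matches, the starting time \<open>k \<delta>\<close> can instead be
  treated as a second free parameter beside \<open>\<delta>\<close>; then only the shifts
  \<open>i \<delta>\<close> with \<open>i \<le> n\<close> have to be controlled, and cells of width
  of order \<open>1 / n\<close> suffice. No closed formula for the entropy rate or for the path
  density enters: both sides of the theorem are expressed by one number \<open>s\<close>, the slope
  at 0 of the one-step relative entropy \<open>skel_KL\<close>. Its existence is delicate at
  distinct states with \<open>p x y = 0\<close>, where both transition probabilities vanish faster
  than linearly. They do so with the same power of the time, the graph distance, which keeps their
  ratio bounded.\<close>

lemma sum_binomial_Suc:
  fixes g :: "nat \<Rightarrow> nat \<Rightarrow> real"
  shows "(\<Sum>k\<le>Suc n. real (Suc n choose k) * g k (Suc n - k)) =
    (\<Sum>k\<le>n. real (n choose k) * (g (Suc k) (n - k) + g k (Suc (n - k))))"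
proof -
  have "(\<Sum>k\<le>Suc n. real (Suc n choose k) * g k (Suc n - k)) =
     g 0 (Suc n) + (\<Sum>k\<le>n. real (n choose k) * g (Suc k) (n - k))
       + (\<Sum>k\<le>n. real (n choose Suc k) * g (Suc k) (n - k))"
    by (subst sum.atMost_Suc_shift) (simp add: sum.distrib algebra_simps)
  moreover have "g 0 (Suc n) + (\<Sum>k\<le>n. real (n choose Suc k) * g (Suc k) (n - k)) =
      (\<Sum>k\<le>Suc n. real (n choose k) * g k (Suc n - k))"
    by (subst sum.atMost_Suc_shift) simp
  moreover have "(\<Sum>k\<le>Suc n. real (n choose k) * g k (Suc n - k)) =
      (\<Sum>k\<le>n. real (n choose k) * g k (Suc (n - k)))"
    by (simp add: Suc_diff_le)
  ultimately show ?thesis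
    by (simp add: sum.distrib distrib_left)
qed

lemma step_prob_nonneg: "(\<And>x y. 0 \<le> m x y) \<Longrightarrow> 0 \<le> step_prob m n x y"
  by (induction n arbitrary: x) (auto intro!: sum_nonneg)

lemma step_prob_row_sum:
  assumes "\<And>x. (\<Sum>y\<in>UNIV. m x y) = (r::real)"
  shows "(\<Sum>y\<in>UNIV. step_prob m n x y) = r ^ n"
proof (induction n arbitrary: x)
  case (Suc n)
  have "(\<Sum>y\<in>UNIV. step_prob m (Suc n) x y) = (\<Sum>z\<in>UNIV. m x z * (\<Sum>y\<in>UNIV. step_prob m n z y))"
    by (simp add: sum_distrib_left) (rule sum.swap)
  then show ?case
    using Suc assms[of x] by (simp flip: sum_distrib_right)
qed simp

text \<open>Positivity of an entry of a power depends only on the support of the matrix: a positive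
  sum of nonnegative terms has a positive term, and the path found in this way is also allowed for
  \<open>m'\<close>. This is applied to \<open>p\<close> and \<open>unif\<close>, and to the
  \<open>unif\<close> of two rate functions.\<close>

lemma step_prob_pos_mono:
  assumes "\<And>x y. 0 \<le> m x y" "\<And>x y. 0 \<le> m' x y" "\<And>x y. 0 < m x y \<Longrightarrow> 0 < m' x y"
    and "0 < step_prob m n x y"
  shows "0 < step_prob m' n x y"
  using assms(4)
proof (induction n arbitrary: x)
  case (Suc n)
  then obtain z where "0 < m x z * step_prob m n z y"
    by (auto simp: sum_nonneg_eq_0_iff step_prob_nonneg assms(1) less_le sum_nonneg)
  then have "0 < m x z" "0 < step_prob m n z y"
    using assms(1)[of x z] step_prob_nonneg[of m n z y] assms(1) by (auto simp: zero_less_mult_iff)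
  with Suc.IH assms(3) have "0 < m' x z * step_prob m' n z y"
    by auto
  then show ?case
    using assms(2) by (auto intro!: sum_pos2[where i=z] mult_nonneg_nonneg step_prob_nonneg)
qed (auto split: if_splits)

section \<open>Uniformization, positivity and short-time bounds of the transition
  probabilities\<close>

locale rates =
  fixes p :: "'a::finite \<Rightarrow> 'a \<Rightarrow> real" and c :: "'a \<Rightarrow> real"
  assumes stoch: "stochastic_matrix p" and irr: "irreducible_matrix p"
    and p_diag: "\<And>x. p x x = 0" and c_pos: "\<And>x. 0 < c x"
begin

abbreviation tp :: "real \<Rightarrow> 'a \<Rightarrow> 'a \<Rightarrow> real" where
  "tp \<equiv> trans_prob (generator c p)"

text \<open>Uniformization: with a constant \<open>Lam\<close> above all jump rates, the generator is
  \<open>unif - Lam\<close> for a matrix \<open>unif\<close> with nonnegative entries.\<close>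

definition Lam :: real where "Lam = 1 + (\<Sum>x\<in>UNIV. c x)"

definition unif :: "'a \<Rightarrow> 'a \<Rightarrow> real" where
  "unif x y = c x * p x y + (if x = y then Lam - c x else 0)"

lemma p_nonneg: "0 \<le> p x y" and p_sum: "(\<Sum>y\<in>UNIV. p x y) = 1"
  using stoch by (auto simp: stochastic_matrix_def)

lemma c_less_Lam: "c x < Lam"
proof -
  have "c x \<le> (\<Sum>x\<in>UNIV. c x)"
    using c_pos by (intro member_le_sum) (auto intro: less_imp_le)
  then show ?thesis by (simp add: Lam_def)
qed

lemma Lam_ge_1: "1 \<le> Lam"
  using sum_nonneg[of UNIV c] c_pos by (simp add: Lam_def less_imp_le)

lemma unif_nonneg: "0 \<le> unif x y"
  using c_pos[of x] c_less_Lam[of x] p_nonneg[of x y] by (auto simp: unif_def)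

lemma unif_row_sum: "(\<Sum>y\<in>UNIV. unif x y) = Lam"
  by (simp add: unif_def sum.distrib p_sum flip: sum_distrib_left)

text \<open>\<open>Lam\<close> exceeds every rate strictly, so the diagonal is positive; off the
  diagonal the support is that of \<open>p\<close>, whatever the rates are. This is what chains with
  different rates have in common.\<close>

lemma unif_pos_iff: "0 < unif x y \<longleftrightarrow> x = y \<or> 0 < p x y"
  using c_pos[of x] c_less_Lam[of x] p_nonneg[of x y] by (auto simp: unif_def zero_less_mult_iff p_diag)

lemma generator_unif: "generator c p f x = (\<Sum>y\<in>UNIV. unif x y * f y) - Lam * f x"
proof -
  have "(\<Sum>y\<in>UNIV. unif x y * f y) = (\<Sum>y\<in>UNIV. c x * p x y * f y) + (Lam - c x) * f x"
    by (simp add: unif_def sum.distrib distrib_right if_distrib[of "\<lambda>z. z * _"] sum.delta cong: if_cong)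
  moreover have "(\<Sum>y\<in>UNIV. c x * p x y * f x) = c x * f x"
    by (simp add: p_sum flip: sum_distrib_right sum_distrib_left)
  ultimately show ?thesis
    by (simp add: generator_def right_diff_distrib sum_subtractf algebra_simps)
qed

text \<open>The binomial theorem for \<open>unif - Lam\<close>: the scalar \<open>- Lam\<close>
  commutes with the matrix \<open>unif\<close>.\<close>

lemma generator_power:
  "(generator c p ^^ n) (indicator {y}) x = 
    (\<Sum>k\<le>n. real (n choose k) * ((- Lam) ^ k * step_prob unif (n - k) x y))"
proof (induction n arbitrary: x)
  case (Suc n)
  let ?g = "\<lambda>x k j. (- Lam) ^ k * step_prob unif j x y"
  have "(generator c p ^^ Suc n) (indicator {y}) x =
     (\<Sum>z\<in>UNIV. \<Sum>k\<le>n. unif x z * (real (n choose k) * ?g z k (n - k))) -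
       Lam * (\<Sum>k\<le>n. real (n choose k) * ?g x k (n - k))"
    by (simp only: funpow.simps comp_def generator_unif Suc sum_distrib_left)
  also have "(\<Sum>z\<in>UNIV. \<Sum>k\<le>n. unif x z * (real (n choose k) * ?g z k (n - k))) =
      (\<Sum>k\<le>n. real (n choose k) * ?g x k (Suc (n - k)))"
    by (subst sum.swap) (simp add: sum_distrib_left mult_ac)
  also have "\<dots> - Lam * (\<Sum>k\<le>n. real (n choose k) * ?g x k (n - k)) =
     (\<Sum>k\<le>n. real (n choose k) * (?g x (Suc k) (n - k) + ?g x k (Suc (n - k))))"
    by (simp add: sum_distrib_left distrib_left sum.distrib sum_negf right_diff_distrib sum_subtractf mult_ac del: step_prob.simps)
  \<comment> \<open>Pascal's rule: the next factor is either \<open>- Lam\<close>, which raises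
    \<open>k\<close>, or \<open>unif\<close>, which raises the other exponent.\<close>
  also have "\<dots> = (\<Sum>k\<le>Suc n. real (Suc n choose k) * ?g x k (Suc n - k))"
    by (rule sum_binomial_Suc[symmetric])
  finally show ?case .
qed (simp add: indicator_def)

text \<open>The Taylor coefficients of the exponential of \<open>t * unif\<close>. They are
  nonnegative, so a single term already gives a lower bound for \<open>t \<ge> 0\<close>.\<close>

definition coef :: "'a \<Rightarrow> 'a \<Rightarrow> nat \<Rightarrow> real" where
  "coef x y n = step_prob unif n x y / fact n"

lemma coef_nonneg: "0 \<le> coef x y n"
  by (simp add: coef_def step_prob_nonneg unif_nonneg)

lemma coef_le: "coef x y n \<le> Lam ^ n / fact n"
proof -
  have "step_prob unif n x y \<le> (\<Sum>y\<in>UNIV. step_prob unif n x y)"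
    by (intro member_le_sum) (auto intro: step_prob_nonneg unif_nonneg)
  then show ?thesis
    by (simp add: coef_def divide_right_mono step_prob_row_sum[OF unif_row_sum])
qed

lemma summable_coef_norm: "summable (\<lambda>n. norm (coef x y n * t ^ n))"
proof (rule summable_comparison_test)
  show "\<exists>N. \<forall>n\<ge>N. norm (norm (coef x y n * t ^ n)) \<le> (Lam * \<bar>t\<bar>) ^ n /\<^sub>R fact n"
  proof (intro exI allI impI)
    fix n :: nat
    have "coef x y n * \<bar>t\<bar> ^ n \<le> Lam ^ n / fact n * \<bar>t\<bar> ^ n"
      by (intro mult_right_mono coef_le) auto
    moreover have "norm (norm (coef x y n * t ^ n)) = coef x y n * \<bar>t\<bar> ^ n"
      by (simp only: norm_mult norm_power real_norm_def abs_of_nonneg[OF coef_nonneg] abs_mult power_abs abs_abs)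
    moreover have "(Lam * \<bar>t\<bar>) ^ n /\<^sub>R fact n = Lam ^ n / fact n * \<bar>t\<bar> ^ n"
      unfolding power_mult_distrib real_scaleR_def by (simp add: field_simps)
    ultimately show "norm (norm (coef x y n * t ^ n)) \<le> (Lam * \<bar>t\<bar>) ^ n /\<^sub>R fact n"
      by linarith
  qed
qed (rule sums_summable[OF exp_converges])

lemma summable_coef: "summable (\<lambda>n. coef x y n * t ^ n)"
  by (rule summable_norm_cancel[OF summable_coef_norm])

text \<open>The exponential of \<open>t * (unif - Lam)\<close> factors into
  \<open>exp (- Lam * t)\<close> and the exponential of \<open>t * unif\<close>. By
  \<open>generator_power\<close> the Cauchy product of the two absolutely convergent series is the
  series that defines \<open>semigroup\<close>.\<close>

lemma tp_eq: "tp t x y = exp (- Lam * t) * (\<Sum>n. coef x y n * t ^ n)"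
proof -
  have s: "(\<lambda>n. (- Lam * t) ^ n /\<^sub>R fact n) sums exp (- Lam * t)"
    by (rule exp_converges)
  have n: "summable (\<lambda>n. norm ((- Lam * t) ^ n /\<^sub>R fact n))"
    by (rule summable_norm_exp)
  have "(\<lambda>n. \<Sum>k\<le>n. (- Lam * t) ^ k /\<^sub>R fact k * (coef x y (n - k) * t ^ (n - k))) sums
      (exp (- Lam * t) * (\<Sum>n. coef x y n * t ^ n))"
    using Cauchy_product_sums[OF n summable_coef_norm] sums_unique[OF s] by simp
  moreover have "(\<Sum>k\<le>n. (- Lam * t) ^ k /\<^sub>R fact k * (coef x y (n - k) * t ^ (n - k))) =
      t ^ n / fact n * (generator c p ^^ n) (indicator {y}) x" for n
    unfolding generator_power sum_distrib_left
  proof (rule sum.cong)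
    fix k assume "k \<in> {..n}"
    then have k: "k \<le> n" and t: "t ^ n = t ^ k * t ^ (n - k)" by (auto simp flip: power_add)
    show "(- Lam * t) ^ k /\<^sub>R fact k * (coef x y (n - k) * t ^ (n - k)) =
      t ^ n / fact n * (real (n choose k) * ((- Lam) ^ k * step_prob unif (n - k) x y))"
      unfolding binomial_fact[OF k] t coef_def power_mult_distrib by (simp add: field_simps)
  qed simp
  ultimately show ?thesis
    by (simp add: trans_prob_def semigroup_def sums_iff)
qed

lemma tp_0: "tp 0 x y = (if x = y then 1 else 0)"
  using powser_zero[of "coef x y"] by (simp add: tp_eq coef_def)

lemma continuous_tp: "isCont (\<lambda>t. tp t x y) t"
  unfolding tp_eq by (intro continuous_intros isCont_powser_converges_everywhere summable_coef)

lemma DERIV_tp_0: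
  "((\<lambda>t. tp t x y) has_real_derivative (if x = y then - c x else c x * p x y)) (at 0)"
proof -
  have "((\<lambda>t. \<Sum>n. coef x y n * t ^ n) has_real_derivative (\<Sum>n. diffs (coef x y) n * 0 ^ n)) (at 0)"
    by (intro termdiffs_strong_converges_everywhere summable_coef)
  moreover have "(\<Sum>n. diffs (coef x y) n * 0 ^ n) = unif x y"
    by (subst powser_zero) (simp add: diffs_def coef_def if_distrib[of "\<lambda>z. _ * z"] cong: if_cong)
  moreover have "((\<lambda>t. exp (- Lam * t)) has_real_derivative - Lam) (at 0)"
    by (auto intro!: derivative_eq_intros)
  ultimately have "((\<lambda>t. exp (- Lam * t) * (\<Sum>n. coef x y n * t ^ n)) has_real_derivative
     - Lam * (\<Sum>n. coef x y n * 0 ^ n) + unif x y * exp (- Lam * 0)) (at 0)"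
    by (intro DERIV_mult) auto
  moreover have "- Lam * (\<Sum>n. coef x y n * 0 ^ n) + unif x y * exp (- Lam * 0) =
      (if x = y then - c x else c x * p x y)"
    by (subst powser_zero) (simp add: unif_def p_diag coef_def)
  ultimately show ?thesis
    by (simp only: tp_eq)
qed

lemma tp_lower: "0 \<le> t \<Longrightarrow> exp (- Lam * t) * (coef x y n * t ^ n) \<le> tp t x y"
proof -
  assume t: "0 \<le> t"
  have "(\<Sum>k\<in>{n}. coef x y k * t ^ k) \<le> (\<Sum>k. coef x y k * t ^ k)"
    by (rule sum_le_suminf[OF summable_coef]) (use t in \<open>auto intro!: mult_nonneg_nonneg coef_nonneg\<close>)
  then show ?thesis by (simp add: tp_eq)
qed

lemma tp_nonneg: "0 \<le> t \<Longrightarrow> 0 \<le> tp t x y"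
  using tp_lower[of t x y 0] coef_nonneg[of x y 0] by (smt (verit) exp_ge_zero mult_nonneg_nonneg power_0)

lemma tp_diag: "0 \<le> t \<Longrightarrow> 1 - Lam * t \<le> tp t x x"
  using tp_lower[of t x x 0] exp_ge_add_one_self[of "- Lam * t"] by (simp add: coef_def)

lemma tp_row_sum: "0 \<le> t \<Longrightarrow> (\<Sum>y\<in>UNIV. tp t x y) = 1"
proof -
  have "(\<Sum>y\<in>UNIV. \<Sum>n. coef x y n * t ^ n) = (\<Sum>n. \<Sum>y\<in>UNIV. coef x y n * t ^ n)"
    by (intro suminf_sum[symmetric] summable_coef)
  also have "\<dots> = (\<Sum>n. (Lam * t) ^ n /\<^sub>R fact n)"
    by (simp add: coef_def step_prob_row_sum[OF unif_row_sum] power_mult_distrib divide_inverse mult_ac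
        flip: sum_distrib_right sum_divide_distrib sum_distrib_left)
  also have "\<dots> = exp (Lam * t)"
    by (simp add: exp_def)
  finally show ?thesis
    by (simp add: tp_eq flip: sum_distrib_left exp_add)
qed

lemma tp_le_1: "0 \<le> t \<Longrightarrow> tp t x y \<le> 1"
proof -
  assume "0 \<le> t"
  then have "tp t x y \<le> (\<Sum>y\<in>UNIV. tp t x y)"
    by (intro member_le_sum) (auto intro: tp_nonneg)
  then show ?thesis using \<open>0 \<le> t\<close> by (simp add: tp_row_sum)
qed

lemma tp_offdiag:
  assumes t: "0 \<le> t" and xy: "x \<noteq> y"
  shows "tp t x y \<le> Lam * t"
proof -
  have "tp t x x + tp t x y = (\<Sum>z\<in>{x, y}. tp t x z)" using xy by simp
  also have "\<dots> \<le> (\<Sum>z\<in>UNIV. tp t x z)"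
    by (intro sum_mono2) (auto intro: tp_nonneg t)
  finally show ?thesis using tp_diag[OF t, of x] tp_row_sum[OF t, of x] by simp
qed

lemma ex_unif_step: "\<exists>n. 0 < step_prob unif n x y"
proof -
  obtain n where "0 < step_prob p n x y" using irr by (auto simp: irreducible_matrix_def)
  then have "0 < step_prob unif n x y"
    by (rule step_prob_pos_mono[rotated 3]) (auto simp: p_nonneg unif_nonneg unif_pos_iff)
  then show ?thesis ..
qed

lemma tp_pos: "0 < t \<Longrightarrow> 0 < tp t x y"
proof -
  assume "0 < t"
  obtain n where "0 < step_prob unif n x y" using ex_unif_step by blast
  then have "0 < exp (- Lam * t) * (coef x y n * t ^ n)"
    using \<open>0 < t\<close> by (auto simp: coef_def)
  then show ?thesis using tp_lower[of t x y n] \<open>0 < t\<close> by linarith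
qed

text \<open>The distance from \<open>x\<close> to \<open>y\<close> in the graph of possible jumps,
  since loops never shorten a path. It is the order of vanishing of \<open>tp t x y\<close> at
  \<open>t = 0\<close>.\<close>

definition dst :: "'a \<Rightarrow> 'a \<Rightarrow> nat" where
  "dst x y = (LEAST n. 0 < step_prob unif n x y)"

text \<open>The term of index \<open>dst x y\<close> alone gives the lower bound. The earlier
  coefficients vanish, and \<open>t ^ n \<le> t ^ dst x y\<close> for the later ones when
  \<open>t \<le> 1\<close>; this gives the upper bound with the sum of all coefficients.\<close>

lemma tp_two_sided:
  "\<exists>l u. 0 < l \<and> 0 < u \<and> (\<forall>t. 0 \<le> t \<and> t \<le> 1 \<longrightarrow> l * t ^ dst x y \<le> tp t x y \<and> tp t x y \<le> u * t ^ dst x y)"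
proof (intro exI conjI allI impI)
  let ?k = "dst x y"
  have k: "0 < step_prob unif ?k x y"
    unfolding dst_def using ex_unif_step by (rule LeastI_ex)
  then have k': "0 < coef x y ?k" by (simp add: coef_def)
  then show "0 < exp (- Lam) * coef x y ?k" by simp
  have s: "summable (coef x y)" using summable_coef[of x y 1] by simp
  have "coef x y ?k \<le> (\<Sum>n. coef x y n)"
    using sum_le_suminf[OF s, of "{?k}"] by (auto simp: coef_nonneg)
  with k' show "0 < (\<Sum>n. coef x y n)" by linarith
  fix t :: real assume t: "0 \<le> t \<and> t \<le> 1"
  have "exp (- Lam) * coef x y ?k * t ^ ?k \<le> exp (- Lam * t) * (coef x y ?k * t ^ ?k)"
  proof -
    have "exp (- Lam) \<le> exp (- Lam * t)" using t Lam_ge_1 by (simp add: mult_left_le)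
    then show ?thesis using t k' by (simp add: mult_right_mono)
  qed
  then show "exp (- Lam) * coef x y ?k * t ^ ?k \<le> tp t x y"
    using tp_lower[of t x y ?k] t by linarith
  have "(\<Sum>n. coef x y n * t ^ n) \<le> (\<Sum>n. coef x y n * t ^ ?k)"
  proof (rule suminf_le)
    fix n show "coef x y n * t ^ n \<le> coef x y n * t ^ ?k"
    proof (cases "n < ?k")
      case True
      then have "coef x y n = 0"
        using not_less_Least[of n "\<lambda>n. 0 < step_prob unif n x y"] step_prob_nonneg[of unif n x y] unif_nonneg
        by (auto simp: dst_def coef_def)
      then show ?thesis by simp
    next
      case False
      then have "t ^ n \<le> t ^ ?k" using t by (intro power_decreasing) auto
      then show ?thesis by (intro mult_left_mono) (auto simp: coef_nonneg)
    qed
  qed (auto intro: summable_coef s summable_mult2)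
  also have "\<dots> = (\<Sum>n. coef x y n) * t ^ ?k" by (rule suminf_mult2[OF s, symmetric])
  finally have "tp t x y \<le> exp (- Lam * t) * ((\<Sum>n. coef x y n) * t ^ ?k)"
    by (simp add: tp_eq)
  also have "\<dots> \<le> 1 * ((\<Sum>n. coef x y n) * t ^ ?k)"
    using t Lam_ge_1 by (intro mult_right_mono) (auto intro!: mult_nonneg_nonneg suminf_nonneg s coef_nonneg)
  finally show "tp t x y \<le> (\<Sum>n. coef x y n) * t ^ ?k" by simp
qed

lemma tp_lower_uniform:
  assumes "0 < a" "a \<le> b"
  shows "\<exists>\<kappa>>0. \<forall>t\<in>{a..b}. \<forall>x y. \<kappa> \<le> tp t x y"
proof -
  have "\<exists>\<kappa>>0. \<forall>t\<in>{a..b}. \<kappa> \<le> tp t x y" for x y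
  proof -
    have "\<exists>t\<in>{a..b}. \<forall>s\<in>{a..b}. tp t x y \<le> tp s x y"
      using assms continuous_tp
      by (intro continuous_attains_inf) (auto simp: continuous_on_eq_continuous_at continuous_at_imp_continuous_on)
    then show ?thesis using tp_pos assms by (metis atLeastAtMost_iff less_le_trans)
  qed
  then obtain \<kappa> where k: "\<And>x y. \<kappa> x y > 0" "\<And>x y t. t \<in> {a..b} \<Longrightarrow> \<kappa> x y \<le> tp t x y" by metis
  show ?thesis
  proof (intro exI[of _ "Min (range (\<lambda>(x, y). \<kappa> x y))"] conjI ballI allI)
    fix t x y assume t: "t \<in> {a..b}"
    have "Min (range (\<lambda>(x, y). \<kappa> x y)) \<le> \<kappa> x y"
      by (intro Min_le) (auto intro: image_eqI[where x="(x, y)"])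
    with k(2)[OF t, of x y] show "Min (range (\<lambda>(x, y). \<kappa> x y)) \<le> tp t x y" by linarith
  qed (use k(1) in auto)
qed

end

section \<open>Comparison of two chains with the same graph of jumps\<close>

locale two_rates = R1: rates p c + R2: rates p c' for p :: "'a::finite \<Rightarrow> 'a \<Rightarrow> real" and c c'
begin

lemma dst_eq: "R1.dst = R2.dst"
proof -
  have "0 < step_prob R1.unif n x y \<longleftrightarrow> 0 < step_prob R2.unif n x y" for n x y
    by (rule iffI; rule step_prob_pos_mono[rotated 3])
      (auto simp: R1.unif_nonneg R2.unif_nonneg R1.unif_pos_iff R2.unif_pos_iff)
  then show ?thesis by (simp add: R1.dst_def R2.dst_def fun_eq_iff)
qed

text \<open>Both transition probabilities are of the exact order \<open>t ^ dst x y\<close>, and by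
  \<open>dst_eq\<close> the exponent is the same for both chains, so no ratio degenerates as
  \<open>t\<close> tends to 0.\<close>

lemma tp_ratio_bounded:
  "\<exists>K>0. \<forall>t x y. 0 < t \<and> t \<le> 1 \<longrightarrow> R1.tp t x y \<le> K * R2.tp t x y"
proof -
  have "\<exists>K>0. \<forall>t. 0 < t \<and> t \<le> 1 \<longrightarrow> R1.tp t x y \<le> K * R2.tp t x y" for x y
  proof -
    obtain u where u: "u > 0" "\<And>t. 0 \<le> t \<and> t \<le> 1 \<Longrightarrow> R1.tp t x y \<le> u * t ^ R1.dst x y"
      using R1.tp_two_sided[of x y] by blast
    obtain l where l: "l > 0" "\<And>t. 0 \<le> t \<and> t \<le> 1 \<Longrightarrow> l * t ^ R1.dst x y \<le> R2.tp t x y"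
      using R2.tp_two_sided[of x y] unfolding dst_eq by blast
    have "R1.tp t x y \<le> (u / l) * R2.tp t x y" if "0 < t \<and> t \<le> 1" for t
    proof -
      have "R1.tp t x y \<le> (u / l) * (l * t ^ R1.dst x y)" using u(2)[of t] l(1) that by simp
      also have "\<dots> \<le> (u / l) * R2.tp t x y"
        using l(2)[of t] that u(1) l(1) by (intro mult_left_mono) auto
      finally show ?thesis .
    qed
    with u(1) l(1) show ?thesis by (intro exI[of _ "u / l"]) auto
  qed
  then obtain K where K: "\<And>x y. K x y > 0" "\<And>x y (t::real). 0 < t \<and> t \<le> 1 \<Longrightarrow> R1.tp t x y \<le> K x y * R2.tp t x y"
    by metis
  show ?thesis
  proof (intro exI[of _ "Max (range (\<lambda>(x, y). K x y))"] conjI allI impI)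
    have "K x y \<le> Max (range (\<lambda>(x, y). K x y))" for x y
      by (intro Max_ge) (auto intro: image_eqI[where x="(x, y)"])
    note M = this
    show "0 < Max (range (\<lambda>(x, y). K x y))"
      using M[of undefined undefined] K(1)[of undefined undefined] by linarith
    fix t :: real and x y assume t: "0 < t \<and> t \<le> 1"
    have "K x y * R2.tp t x y \<le> Max (range (\<lambda>(x, y). K x y)) * R2.tp t x y"
      using t by (intro mult_right_mono M R2.tp_nonneg) auto
    with K(2)[OF t, of x y] show "R1.tp t x y \<le> Max (range (\<lambda>(x, y). K x y)) * R2.tp t x y" by linarith
  qed
qed

text \<open>The conditional relative entropy of the two transition kernels over a step of length
  \<open>h\<close>; a contribution of the initial laws is not included.\<close>

definition skel_KL :: "('a \<Rightarrow> real) \<Rightarrow> real \<Rightarrow> real" where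
  "skel_KL m h = (\<Sum>x\<in>UNIV. \<Sum>y\<in>UNIV. m x * R1.tp h x y * ln (R1.tp h x y / R2.tp h x y))"

end

lemma two_rates_sym: "two_rates p c c' \<Longrightarrow> two_rates p c' c"
  by (simp add: two_rates_def)

context two_rates
begin

text \<open>Term by term. On the diagonal the logarithm is itself of order \<open>h\<close>. For a
  possible jump both probabilities divided by \<open>h\<close> have positive limits. For the
  remaining pairs the probability divided by \<open>h\<close> tends to 0 while the logarithm stays
  bounded, by \<open>tp_ratio_bounded\<close> in both directions.\<close>

lemma skel_KL_rate: "\<exists>s. ((\<lambda>h. skel_KL m h / h) \<longlongrightarrow> s) (at_right 0)"
proof -
  have slope: "((\<lambda>h. f h / h) \<longlongrightarrow> d) (at_right 0)"
    if "(f has_real_derivative d) (at 0)" "f 0 = 0" for f d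
    using that has_field_derivative_at_within[of f d 0 "{0<..}"] by (simp add: has_field_derivative_iff)
  obtain K where K: "K > 0" "\<And>(t::real) x y. 0 < t \<Longrightarrow> t \<le> 1 \<Longrightarrow> R1.tp t x y \<le> K * R2.tp t x y"
    using tp_ratio_bounded by blast
  obtain K' where K': "K' > 0" "\<And>(t::real) x y. 0 < t \<Longrightarrow> t \<le> 1 \<Longrightarrow> R2.tp t x y \<le> K' * R1.tp t x y"
    using two_rates.tp_ratio_bounded[OF two_rates_sym[OF two_rates_axioms]] by blast
  have near: "\<forall>\<^sub>F t in at_right 0. 0 < t \<and> t \<le> (1::real)"
    by (auto simp: eventually_at_right_field intro!: exI[of _ 1])
  have "\<exists>s. ((\<lambda>h. R1.tp h x y * ln (R1.tp h x y / R2.tp h x y) / h) \<longlongrightarrow> s) (at_right 0)" for x y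
  proof (cases "x = y")
    case True
    have lnd: "((\<lambda>t. ln (R1.tp t x x)) has_real_derivative - c x) (at 0)"
      "((\<lambda>t. ln (R2.tp t x x)) has_real_derivative - c' x) (at 0)"
      using R1.DERIV_tp_0[of x x] R2.DERIV_tp_0[of x x]
      by (auto intro!: derivative_eq_intros simp: R1.tp_0 R2.tp_0)
    have "((\<lambda>h. (ln (R1.tp h x x) - ln (R2.tp h x x)) / h) \<longlongrightarrow> - c x - (- c' x)) (at_right 0)"
      using lnd by (intro slope DERIV_diff) (auto simp: R1.tp_0 R2.tp_0)
    moreover have "((\<lambda>h. R1.tp h x x) \<longlongrightarrow> 1) (at_right 0)"
      using R1.continuous_tp[of 0 x x] by (auto simp: isCont_def R1.tp_0 intro: tendsto_within_subset)
    ultimately have "((\<lambda>h. R1.tp h x x * ((ln (R1.tp h x x) - ln (R2.tp h x x)) / h)) \<longlongrightarrow> 1 * (- c x - (- c' x))) (at_right 0)"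
      by (intro tendsto_mult)
    moreover have "\<forall>\<^sub>F h in at_right 0. R1.tp h x x * ((ln (R1.tp h x x) - ln (R2.tp h x x)) / h) =
        R1.tp h x y * ln (R1.tp h x y / R2.tp h x y) / h"
      using near
    proof eventually_elim
      case (elim h)
      then show ?case using R1.tp_pos[of h x x] R2.tp_pos[of h x x] by (simp add: True ln_div)
    qed
    ultimately show ?thesis by (intro exI, rule Lim_transform_eventually)
  next
    case False
    have q: "((\<lambda>h. R1.tp h x y / h) \<longlongrightarrow> c x * p x y) (at_right 0)"
      by (rule slope) (use R1.DERIV_tp_0[of x y] False in \<open>simp_all add: R1.tp_0\<close>)
    have q': "((\<lambda>h. R2.tp h x y / h) \<longlongrightarrow> c' x * p x y) (at_right 0)"
      by (rule slope) (use R2.DERIV_tp_0[of x y] False in \<open>simp_all add: R2.tp_0\<close>)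
    show ?thesis
    proof (cases "p x y = 0")
      case True
      have "((\<lambda>h. R1.tp h x y / h * ln (R1.tp h x y / R2.tp h x y)) \<longlongrightarrow> 0) (at_right 0)"
      proof (rule Lim_null_comparison)
        show "\<forall>\<^sub>F h in at_right 0. norm (R1.tp h x y / h * ln (R1.tp h x y / R2.tp h x y)) \<le>
            R1.tp h x y / h * (\<bar>ln K\<bar> + \<bar>ln K'\<bar>)"
          using near
        proof eventually_elim
          case (elim t)
          have pos: "0 < R1.tp t x y" "0 < R2.tp t x y" using elim R1.tp_pos R2.tp_pos by auto
          have "R1.tp t x y / R2.tp t x y \<le> K" "R2.tp t x y / R1.tp t x y \<le> K'"
            using K(2)[of t x y] K'(2)[of t x y] elim pos by (auto simp: field_simps)
          then have "ln (R1.tp t x y / R2.tp t x y) \<le> ln K" "ln (R2.tp t x y / R1.tp t x y) \<le> ln K'"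
            using pos K(1) K'(1) by (simp_all add: ln_le_cancel_iff)
          then have "\<bar>ln (R1.tp t x y / R2.tp t x y)\<bar> \<le> \<bar>ln K\<bar> + \<bar>ln K'\<bar>"
            using pos by (auto simp: ln_div)
          then show ?case using pos elim
            by (auto simp: abs_mult intro!: mult_left_mono divide_right_mono)
        qed
        show "((\<lambda>h. R1.tp h x y / h * (\<bar>ln K\<bar> + \<bar>ln K'\<bar>)) \<longlongrightarrow> 0) (at_right 0)"
          using tendsto_mult_right[OF q, of "\<bar>ln K\<bar> + \<bar>ln K'\<bar>"] True by simp
      qed
      then show ?thesis by (auto simp: mult_ac)
    next
      case F: False
      then have pos: "0 < c x * p x y" "0 < c' x * p x y"
        using R1.p_nonneg[of x y] R1.c_pos[of x] R2.c_pos[of x] by auto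
      have "((\<lambda>h. R1.tp h x y / h * ln ((R1.tp h x y / h) / (R2.tp h x y / h))) \<longlongrightarrow>
          c x * p x y * ln (c x * p x y / (c' x * p x y))) (at_right 0)"
        using pos by (intro tendsto_mult q tendsto_ln tendsto_divide q') auto
      moreover have "\<forall>\<^sub>F h in at_right 0. R1.tp h x y / h * ln ((R1.tp h x y / h) / (R2.tp h x y / h)) =
        R1.tp h x y * ln (R1.tp h x y / R2.tp h x y) / h"
        using near by eventually_elim simp
      ultimately show ?thesis by (intro exI, rule Lim_transform_eventually)
    qed
  qed
  then have "\<forall>x y. \<exists>s. ((\<lambda>h. R1.tp h x y * ln (R1.tp h x y / R2.tp h x y) / h) \<longlongrightarrow> s) (at_right 0)"
    by (intro allI)
  then obtain s where s: "\<And>x y. ((\<lambda>h. R1.tp h x y * ln (R1.tp h x y / R2.tp h x y) / h) \<longlongrightarrow> s x y) (at_right 0)"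
    unfolding choice_iff by (elim exE) (rule that, elim allE)
  have "((\<lambda>h. \<Sum>x\<in>UNIV. \<Sum>y\<in>UNIV. m x * (R1.tp h x y * ln (R1.tp h x y / R2.tp h x y) / h)) \<longlongrightarrow>
      (\<Sum>x\<in>UNIV. \<Sum>y\<in>UNIV. m x * s x y)) (at_right 0)"
    by (intro tendsto_sum tendsto_mult tendsto_const s)
  moreover have "(\<Sum>x\<in>UNIV. \<Sum>y\<in>UNIV. m x * (R1.tp h x y * ln (R1.tp h x y / R2.tp h x y) / h)) = skel_KL m h / h" for h
    unfolding skel_KL_def sum_divide_distrib by (simp only: mult.assoc times_divide_eq_right)
  ultimately show ?thesis
    by (intro exI) (simp only:)
qed

end

section \<open>Path space and the Markov property\<close>

lemma space_path_space: "space path_space = {\<omega> \<in> extensional {0..}. cadlag \<omega>}"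
  by (auto simp: path_space_def space_restrict_space space_PiM PiE_def)

lemma measurable_eval_path_space [measurable]:
  "0 \<le> t \<Longrightarrow> (\<lambda>\<omega>. \<omega> t) \<in> path_space \<rightarrow>\<^sub>M count_space UNIV"
  unfolding path_space_def by (intro measurable_restrict_space1 measurable_component_singleton) simp

lemma space_path_filtration [simp]: "space (path_filtration t) = space path_space"
  by (auto simp: path_filtration_def intro!: space_measure_of)

lemma sets_path_filtration:
  "sets (path_filtration t) = sigma_sets (space path_space) {{\<omega> \<in> space path_space. \<omega> s \<in> B} | s B. 0 \<le> s \<and> s \<le> t}"
  by (auto simp: path_filtration_def intro!: sets_measure_of)

lemma measurable_eval_filtration:
  assumes "0 \<le> s" "s \<le> t"
  shows "(\<lambda>\<omega>. \<omega> s) \<in> path_filtration t \<rightarrow>\<^sub>M count_space UNIV"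
proof (rule measurableI)
  fix A :: "'a set"
  have "{\<omega> \<in> space path_space. \<omega> s \<in> A} \<in> sets (path_filtration t)"
    unfolding sets_path_filtration using assms by (intro sigma_sets.Basic) auto
  moreover have "(\<lambda>\<omega>. \<omega> s) -` A \<inter> space (path_filtration t) = {\<omega> \<in> space path_space. \<omega> s \<in> A}"
    by auto
  ultimately show "(\<lambda>\<omega>. \<omega> s) -` A \<inter> space (path_filtration t) \<in> sets (path_filtration t)"
    by simp
qed auto

lemma subalgebra_path_filtration: "subalgebra path_space (path_filtration t)"
  unfolding subalgebra_def sets_path_filtration
proof (intro conjI sets.sigma_sets_subset subsetI)
  fix A :: "(real \<Rightarrow> 'a) set"
  assume "A \<in> {{\<omega> \<in> space path_space. \<omega> s \<in> B} | s B. 0 \<le> s \<and> s \<le> t}"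
  then obtain s B where A: "A = {\<omega> \<in> space path_space. \<omega> s \<in> B}" "0 \<le> s" by auto
  show "A \<in> sets path_space"
    unfolding A(1) using measurable_sets[OF measurable_eval_path_space[OF A(2)], of B]
    by (simp add: vimage_def Int_def conj_commute)
qed simp

lemma path_filtration_mono: "s \<le> t \<Longrightarrow> sets (path_filtration s) \<subseteq> sets (path_filtration t)"
  unfolding sets_path_filtration by (intro sigma_sets_subseteq) auto

lemma path_filtration_sub: "A \<in> sets (path_filtration t) \<Longrightarrow> A \<in> sets path_space"
  using subalgebra_path_filtration by (auto simp: subalgebra_def)

lemma eval_eq_in_filtration:
  assumes "0 \<le> s" "s \<le> t"
  shows "{\<omega> \<in> space path_space. \<omega> s = x} \<in> sets (path_filtration t)"
  unfolding sets_path_filtration using assms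
  by (intro sigma_sets.Basic) (auto intro!: exI[of _ s] exI[of _ "{x}"])

section \<open>Cylinders as generators of the filtration\<close>

definition cyl :: "real set \<Rightarrow> (real \<Rightarrow> 'a) \<Rightarrow> (real \<Rightarrow> 'a) set" where
  "cyl I a = {\<omega> \<in> space path_space. \<forall>s\<in>I. \<omega> s = a s}"

text \<open>The set of times always contains 0, where the finite-dimensional distributions start,
  and \<open>t\<close>, so that the present state is known when the Markov property is applied at
  time \<open>t\<close>. The empty set is added because two cylinders may prescribe different values
  at the same time.\<close>

definition cyls :: "real \<Rightarrow> (real \<Rightarrow> 'a) set set" where
  "cyls t = insert {} {cyl I a | I a. finite I \<and> I \<subseteq> {0..t} \<and> 0 \<in> I \<and> t \<in> I}"

lemma cyl_in_filtration:
  assumes "finite I" "I \<subseteq> {0..t}"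
  shows "cyl I a \<in> sets (path_filtration t)"
proof -
  have "cyl I a = (\<Inter>s\<in>I. {\<omega> \<in> space path_space. \<omega> s = a s}) \<inter> space (path_filtration t)"
    by (auto simp: cyl_def)
  also have "\<dots> \<in> sets (path_filtration t)"
  proof (cases "I = {}")
    case True
    then show ?thesis using sets.top[of "path_filtration t"] by simp
  next
    case False
    then show ?thesis
      using assms by (intro sets.Int sets.top sets.finite_INT) (auto intro!: eval_eq_in_filtration)
  qed
  finally show ?thesis .
qed

lemma cyls_subset: "cyls t \<subseteq> sets (path_filtration t)"
  by (auto simp: cyls_def intro: cyl_in_filtration)

lemma Int_stable_cyls: "Int_stable (cyls t)"
proof (rule Int_stableI)
  fix A B :: "(real \<Rightarrow> 'a) set" assume A: "A \<in> cyls t" and B: "B \<in> cyls t"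
  show "A \<inter> B \<in> cyls t"
  proof (cases "A \<inter> B = {}")
    case False
    then obtain I a where I: "A = cyl I a" "finite I" "I \<subseteq> {0..t}" "0 \<in> I" "t \<in> I"
      using A by (auto simp: cyls_def)
    obtain J b where J: "B = cyl J b" "finite J" "J \<subseteq> {0..t}" "0 \<in> J" "t \<in> J"
      using B False by (auto simp: cyls_def)
    \<comment> \<open>A common element prescribes the values on both sets of times at once.\<close>
    obtain \<omega> where w: "\<omega> \<in> A" "\<omega> \<in> B" using False by auto
    have "A \<inter> B = cyl (I \<union> J) \<omega>" using w by (auto simp: I J cyl_def)
    then show ?thesis using I J unfolding cyls_def by blast
  qed (simp add: cyls_def)
qed

lemma sets_path_filtration_cyls:
  assumes t: "0 \<le> t"
  shows "sets (path_filtration t :: (real \<Rightarrow> 'a::finite) measure) = sigma_sets (space path_space) (cyls t)"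
proof
  have sub: "cyls t \<subseteq> Pow (space path_space)"
    by (auto simp: cyls_def cyl_def)
  let ?S = "sigma (space path_space) (cyls t :: (real \<Rightarrow> 'a) set set)"
  have S: "sets ?S = sigma_sets (space path_space) (cyls t)"
    by (rule sets_measure_of[OF sub])
  show "sets (path_filtration t :: (real \<Rightarrow> 'a) measure) \<subseteq> sigma_sets (space path_space) (cyls t)"
    unfolding sets_path_filtration
  proof (rule sigma_sets_mono, rule subsetI)
    fix A :: "(real \<Rightarrow> 'a) set"
    assume "A \<in> {{\<omega> \<in> space path_space. \<omega> s \<in> B} | s B. 0 \<le> s \<and> s \<le> t}"
    then obtain r B where A: "A = {\<omega> \<in> space path_space. \<omega> r \<in> B}" "0 \<le> r" "r \<le> t" by auto
    \<comment> \<open>The time \<open>r\<close> is tested first, so that \<open>v\<close> is the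
      value there even when \<open>r\<close> is 0 or \<open>t\<close>. The values \<open>u\<close>
      and \<open>w\<close> at the endpoints are free and run through the finite state space.\<close>
    let ?a = "\<lambda>u v w q. if q = r then v else if q = 0 then u else w :: 'a"
    have "A = (\<Union>u. \<Union>v\<in>B. \<Union>w. cyl {0, r, t} (?a u v w))"
    proof (intro set_eqI iffI)
      fix \<omega> assume w: "\<omega> \<in> A"
      then have "\<omega> \<in> cyl {0, r, t} (?a (\<omega> 0) (\<omega> r) (\<omega> t))" by (auto simp: A(1) cyl_def)
      then show "\<omega> \<in> (\<Union>u. \<Union>v\<in>B. \<Union>w. cyl {0, r, t} (?a u v w))" using w by (auto simp: A(1))
    qed (auto simp: A(1) cyl_def)
    also have "\<dots> \<in> sets ?S"
    proof (intro sets.finite_UN)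
      fix u v w
      have "cyl {0, r, t} (?a u v w) \<in> cyls t" using A(2,3) t unfolding cyls_def by (intro insertI2 CollectI exI conjI) (rule refl, auto)
      then show "cyl {0, r, t} (?a u v w) \<in> sets ?S" unfolding S by (rule sigma_sets.Basic)
    qed auto
    finally show "A \<in> sigma_sets (space path_space) (cyls t)" by (simp add: S)
  qed
  show "sigma_sets (space path_space) (cyls t) \<subseteq> sets (path_filtration t :: (real \<Rightarrow> 'a) measure)"
    using sets.sigma_sets_subset[OF cyls_subset[of t]] by simp
qed

section \<open>Windows without a jump\<close>

definition constant_on_window :: "real \<Rightarrow> real \<Rightarrow> (real \<Rightarrow> 'a) set" where
  "constant_on_window s t = {\<omega> \<in> space path_space. \<forall>r\<in>{s..t}. \<omega> r = \<omega> s}"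

definition constant_on_grid :: "real \<Rightarrow> real \<Rightarrow> nat \<Rightarrow> (real \<Rightarrow> 'a) set" where
  "constant_on_grid s h n = {\<omega> \<in> space path_space. \<forall>j\<le>n. \<omega> (s + real j * h) = \<omega> s}"

text \<open>Right-continuity reduces a condition at uncountably many times to countably many: just
  after any \<open>r < t\<close> the path keeps the value \<open>\<omega> r\<close> until some time
  \<open>b\<close>, and a fine dyadic grid has a point there. The right end \<open>t\<close> belongs
  to every grid.\<close>

lemma constant_on_window_eq:
  assumes st: "0 \<le> s" "s \<le> t"
  shows "constant_on_window s t = (\<Inter>m. constant_on_grid s ((t - s) / 2 ^ m) (2 ^ m))"
proof (intro set_eqI iffI)
  fix \<omega> assume "\<omega> \<in> constant_on_window s t"
  moreover have "s + real j * ((t - s) / 2 ^ m) \<in> {s..t}" if "j \<le> 2 ^ m" for j m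
  proof -
    have "real j \<le> 2 ^ m" using that by (metis of_nat_le_iff of_nat_numeral of_nat_power)
    then have "real j * (t - s) \<le> 2 ^ m * (t - s)" using st by (intro mult_right_mono) auto
    then have "real j * ((t - s) / 2 ^ m) \<le> t - s" by (simp add: field_simps)
    then show ?thesis using st by auto
  qed
  ultimately show "\<omega> \<in> (\<Inter>m. constant_on_grid s ((t - s) / 2 ^ m) (2 ^ m))"
    by (auto simp: constant_on_window_def constant_on_grid_def)
next
  fix \<omega> assume w: "\<omega> \<in> (\<Inter>m. constant_on_grid s ((t - s) / 2 ^ m) (2 ^ m))"
  then have sp: "\<omega> \<in> space path_space" by (auto simp: constant_on_grid_def)
  have g: "\<omega> (s + real j * ((t - s) / 2 ^ m)) = \<omega> s" if "j \<le> 2 ^ m" for j m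
    using w that by (auto simp: constant_on_grid_def)
  have "\<omega> r = \<omega> s" if r: "r \<in> {s..t}" for r
  proof (cases "r = t")
    case True
    with g[of "1" 0] show ?thesis by simp
  next
    case False
    then have r: "s \<le> r" "r < t" using r by auto
    have "\<forall>\<^sub>F q in at_right r. \<omega> q = \<omega> r"
      using sp r st by (auto simp: space_path_space cadlag_def)
    then obtain b where b: "b > r" "\<And>q. r < q \<Longrightarrow> q < b \<Longrightarrow> \<omega> q = \<omega> r"
      by (auto simp: eventually_at_right_field)
    let ?d = "min b t - r"
    have d: "?d > 0" using b r by auto
    obtain m where m: "(t - s) / ?d < 2 ^ m" using real_arch_pow[of 2] by auto
    then have "t - s < 2 ^ m * ?d" by (simp only: pos_divide_less_eq[OF d])
    then have m: "(t - s) / 2 ^ m < ?d" by (simp add: pos_divide_less_eq mult.commute)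
    let ?h = "(t - s) / 2 ^ m"
    have h: "?h > 0" using r by auto
    \<comment> \<open>The index of the first grid point strictly to the right of \<open>r\<close>.
      The mesh is below \<open>min b t - r\<close>, so this point lies before \<open>b\<close> and
      before \<open>t\<close>.\<close>
    let ?j = "nat \<lfloor>(r - s) / ?h\<rfloor> + 1"
    have f: "real (nat \<lfloor>(r - s) / ?h\<rfloor>) = of_int \<lfloor>(r - s) / ?h\<rfloor>"
      using r h by (intro of_nat_nat) (auto simp del: divide_divide_eq_right)
    have "of_int \<lfloor>(r - s) / ?h\<rfloor> \<le> (r - s) / ?h" "(r - s) / ?h < of_int \<lfloor>(r - s) / ?h\<rfloor> + 1"
      by linarith+
    then have "real ?j - 1 \<le> (r - s) / ?h" "(r - s) / ?h < real ?j" using f by linarith+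
    then have j: "real ?j * ?h \<le> r - s + ?h" "r - s < real ?j * ?h"
      using h by (simp_all only: pos_le_divide_eq pos_divide_less_eq left_diff_distrib mult_1)
    have q: "r < s + real ?j * ?h" "s + real ?j * ?h < b" "s + real ?j * ?h < t"
      using j m by auto
    then have "real ?j * ?h < 2 ^ m * ?h" by simp
    then have "real ?j < 2 ^ m" by (rule mult_right_less_imp_less) (use h in simp)
    then have "real ?j < real (2 ^ m)" by simp
    then have "?j \<le> 2 ^ m" unfolding of_nat_less_iff by (rule less_imp_le)
    from g[OF this] show ?thesis by (rule trans[OF b(2)[OF q(1,2), symmetric]])
  qed
  then show "\<omega> \<in> constant_on_window s t" using sp unfolding constant_on_window_def by blast
qed

lemma constant_on_grid_in_filtration:
  fixes s :: real
  assumes "0 \<le> s" "0 \<le> h" "s + real n * h \<le> t"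
  shows "(constant_on_grid s h n :: (real \<Rightarrow> 'a::finite) set) \<in> sets (path_filtration t)"
proof -
  have le: "s + real j * h \<le> t" if "j \<le> n" for j
    using assms that mult_right_mono[of "real j" "real n" h] by simp
  have "(constant_on_grid s h n :: (real \<Rightarrow> 'a) set) = (\<Union>x. \<Inter>j\<in>{..n}. {\<omega> \<in> space path_space. \<omega> (s + real j * h) = x})"
    (is "?L = ?R")
  proof (intro set_eqI iffI)
    fix \<omega> assume "\<omega> \<in> ?R"
    then obtain x where x: "\<And>j. j \<le> n \<Longrightarrow> \<omega> \<in> space path_space \<and> \<omega> (s + real j * h) = x" by auto
    from x[of 0] x show "\<omega> \<in> ?L" by (auto simp: constant_on_grid_def)
  qed (auto simp: constant_on_grid_def)
  also have "\<dots> \<in> sets (path_filtration t)"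
    using assms le by (intro sets.finite_UN sets.finite_INT eval_eq_in_filtration) auto
  finally show ?thesis .
qed

lemma constant_on_window_in_filtration:
  assumes "0 \<le> s" "s \<le> t" "t \<le> u"
  shows "(constant_on_window s t :: (real \<Rightarrow> 'a::finite) set) \<in> sets (path_filtration u)"
  unfolding constant_on_window_eq[OF assms(1,2)] using assms
  by (intro sets.countable_INT) (auto intro!: constant_on_grid_in_filtration)

section \<open>Finite-dimensional distributions and the Markov property\<close>

locale ctmc = rates p c for p :: "'a::finite \<Rightarrow> 'a \<Rightarrow> real" and c +
  fixes \<mu> :: "'a pmf" and P :: "(real \<Rightarrow> 'a) measure"
  assumes stat: "stationary (generator c p) \<mu>" and law: "ctmc_law (generator c p) \<mu> P"
begin

sublocale prob_space P
  using law by (simp add: ctmc_law_def)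

lemma sets_P [measurable_cong, simp]: "sets P = sets path_space"
  using law by (simp add: ctmc_law_def)

lemma space_P [simp]: "space P = space path_space"
  using sets_P by (rule sets_eq_imp_space_eq)

lemma filtration_in_P: "A \<in> sets (path_filtration t) \<Longrightarrow> A \<in> sets P"
  using path_filtration_sub by simp

lemma subalgebra_P: "subalgebra P (path_filtration t)"
  using subalgebra_path_filtration by (simp add: subalgebra_def)

lemma fdd:
  assumes "t 0 = 0" "\<And>i. i < n \<Longrightarrow> t i < t (Suc i)"
  shows "measure P {\<omega> \<in> space P. \<forall>i\<le>n. \<omega> (t i) = x i} =
    pmf \<mu> (x 0) * (\<Prod>i<n. tp (t (Suc i) - t i) (x i) (x (Suc i)))"
  using law assms unfolding ctmc_law_def by blast

text \<open>\<open>ctmc_law\<close> speaks of increasing sequences of times, \<open>cyls\<close> of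
  finite sets. With \<open>I\<close> listed in increasing order and \<open>t\<close> appended as the
  next time, the two products differ by one transition factor.\<close>

lemma fdd_ext:
  assumes I: "finite I" "I \<subseteq> {0..s}" "0 \<in> I" "s \<in> I" and t: "s < t"
  shows "measure P (cyl (insert t I) (a(t := y))) = measure P (cyl I a) * tp (t - s) (a s) y"
proof -
  define l where "l = sorted_list_of_set I"
  define n where "n = length l - 1"
  define e where "e i = (if i \<le> n then l ! i else t)" for i
  have setl: "set l = I" using I(1) by (simp add: l_def)
  then have len: "length l = Suc n" using I(3) by (cases l) (auto simp: n_def)
  have srt: "sorted_wrt (<) l" by (simp add: l_def)
  have e_img: "e ` {..n} = I"
    using setl len by (auto simp: e_def set_conv_nth less_Suc_eq_le image_iff)
  have inc: "e i < e j" if "i < j" "j \<le> n" for i j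
    using that sorted_wrt_nth_less[OF srt, of i j] len by (auto simp: e_def)
  have e0: "e 0 = 0"
  proof -
    obtain i where i: "i \<le> n" "e i = 0" using e_img I(3) by (metis atMost_iff imageE)
    moreover have "0 \<le> e 0" using e_img I(2) by auto
    ultimately show ?thesis using inc[of 0 i] by (cases "i = 0") auto
  qed
  have en: "e n = s"
  proof -
    obtain i where i: "i \<le> n" "e i = s" using e_img I(4) by (metis atMost_iff imageE)
    moreover have "e n \<le> s" using e_img I(2) by auto
    ultimately show ?thesis using inc[of i n] by (cases "i = n") auto
  qed
  have eS: "e (Suc n) = t" by (simp add: e_def)
  have inc': "e i < e (Suc i)" if "i < Suc n" for i
    using that inc[of i "Suc i"] en eS t by (cases "i = n") auto
  let ?a = "a(t := y)"
  have nt: "t \<notin> I" using I(2) t by auto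
  have "cyl I a = {\<omega> \<in> space P. \<forall>i\<le>n. \<omega> (e i) = ?a (e i)}"
    using nt by (auto simp: cyl_def e_img[symmetric])
  then have 1: "measure P (cyl I a) =
      pmf \<mu> (?a (e 0)) * (\<Prod>i<n. tp (e (Suc i) - e i) (?a (e i)) (?a (e (Suc i))))"
    using fdd[of e n "\<lambda>i. ?a (e i)"] e0 inc' by simp
  have "cyl (insert t I) ?a = {\<omega> \<in> space P. \<forall>i\<le>Suc n. \<omega> (e i) = ?a (e i)}"
    by (auto simp: cyl_def e_img[symmetric] eS le_Suc_eq)
  then have 2: "measure P (cyl (insert t I) ?a) =
      pmf \<mu> (?a (e 0)) * (\<Prod>i<Suc n. tp (e (Suc i) - e i) (?a (e i)) (?a (e (Suc i))))"
    using fdd[of e "Suc n" "\<lambda>i. ?a (e i)"] e0 inc' by simp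
  show ?thesis
    unfolding 1 2 using t by (simp add: eS en)
qed

lemma prob_initial: "measure P {\<omega> \<in> space path_space. \<omega> 0 = x} = pmf \<mu> x"
  using fdd[of "\<lambda>i. 0" 0 "\<lambda>i. x"] by simp

lemma stationary_eq: "0 \<le> t \<Longrightarrow> (\<Sum>x\<in>UNIV. pmf \<mu> x * tp t x y) = pmf \<mu> y"
proof -
  assume t: "0 \<le> t"
  have "measure_pmf.expectation \<mu> (semigroup (generator c p) t (indicator {y})) = measure_pmf.expectation \<mu> (indicator {y})"
    using stat t by (simp add: stationary_def)
  moreover have "measure_pmf.expectation \<mu> f = (\<Sum>x\<in>UNIV. f x * pmf \<mu> x)" for f :: "'a \<Rightarrow> real"
    by (rule integral_measure_pmf_real) auto
  ultimately show ?thesis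
    by (simp add: trans_prob_def mult.commute measure_pmf_single)
qed

text \<open>Stationarity at time 1 writes \<open>pmf \<mu> y\<close> as an average of the positive
  numbers \<open>tp 1 x y\<close>.\<close>

lemma mu_pos: "0 < pmf \<mu> y"
proof -
  obtain x where "0 < pmf \<mu> x" using set_pmf_not_empty[of \<mu>] by (auto intro: pmf_positive)
  then have "0 < (\<Sum>x\<in>UNIV. pmf \<mu> x * tp 1 x y)"
    by (intro sum_pos2[where i=x]) (auto intro!: mult_nonneg_nonneg mult_pos_pos tp_nonneg tp_pos)
  then show ?thesis using stationary_eq[of 1 y] by simp
qed

lemma mu_sum: "(\<Sum>x\<in>UNIV. pmf \<mu> x) = 1"
  by (simp add: sum_pmf_eq_1)

lemma prob_two: "0 < t \<Longrightarrow> measure P {\<omega> \<in> space path_space. \<omega> 0 = x \<and> \<omega> t = y} = pmf \<mu> x * tp t x y"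
  using fdd_ext[of "{0}" 0 t "\<lambda>_. x" y] prob_initial[of x]
  by (simp add: cyl_def conj_commute cong: conj_cong)

lemma prob_three:
  assumes "0 < s" "s < t"
  shows "measure P {\<omega> \<in> space path_space. \<omega> 0 = x \<and> \<omega> s = y \<and> \<omega> t = z} = pmf \<mu> x * tp s x y * tp (t - s) y z"
proof -
  have "cyl (insert t {0, s}) (((\<lambda>_. x)(s := y))(t := z)) = {\<omega> \<in> space path_space. \<omega> 0 = x \<and> \<omega> s = y \<and> \<omega> t = z}"
    using assms by (auto simp: cyl_def)
  moreover have "cyl {0, s} ((\<lambda>_. x)(s := y)) = {\<omega> \<in> space path_space. \<omega> 0 = x \<and> \<omega> s = y}"
    using assms by (auto simp: cyl_def)
  ultimately show ?thesis
    using fdd_ext[of "{0, s}" s t "(\<lambda>_. x)(s := y)" z] assms prob_two[of s x y] by simp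
qed

lemma eval_sets [measurable]: "0 \<le> t \<Longrightarrow> {\<omega> \<in> space path_space. \<omega> t = x} \<in> sets P"
  using filtration_in_P[OF eval_eq_in_filtration[of t t x]] by simp

lemma measure_partition:
  fixes f :: "'b \<Rightarrow> 'c::finite"
  assumes "A \<in> sets M" "finite_measure M" "\<And>x. A \<inter> {\<omega> \<in> space M. f \<omega> = x} \<in> sets M"
  shows "measure M A = (\<Sum>x\<in>UNIV. measure M (A \<inter> {\<omega> \<in> space M. f \<omega> = x}))"
proof -
  interpret finite_measure M by fact
  have "A = (\<Union>x\<in>UNIV. A \<inter> {\<omega> \<in> space M. f \<omega> = x})"
    using sets.sets_into_space[OF assms(1)] by auto
  then have "measure M A = measure M (\<Union>x\<in>UNIV. A \<inter> {\<omega> \<in> space M. f \<omega> = x})" by simp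
  also have "\<dots> = (\<Sum>x\<in>UNIV. measure M (A \<inter> {\<omega> \<in> space M. f \<omega> = x}))"
    using assms by (intro finite_measure_finite_Union) (auto simp: disjoint_family_on_def)
  finally show ?thesis .
qed

lemma prob_partition:
  assumes "A \<in> sets P" "0 \<le> t"
  shows "measure P A = (\<Sum>x\<in>UNIV. measure P (A \<inter> {\<omega> \<in> space path_space. \<omega> t = x}))"
  using measure_partition[of A P "\<lambda>\<omega>. \<omega> t"] assms eval_sets[of t] by (simp add: finite_measure_axioms)

text \<open>Read off from the path law instead of the power series: the intermediate state is summed
  out of a three-time probability, and the factor \<open>pmf \<mu> x\<close> cancels by
  \<open>mu_pos\<close>.\<close>

lemma chapman_kolmogorov:
  assumes "0 \<le> s" "0 \<le> t"
  shows "tp (s + t) x z = (\<Sum>y\<in>UNIV. tp s x y * tp t y z)"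
proof (cases "s = 0 \<or> t = 0")
  case True
  then show ?thesis by (auto simp: tp_0 if_distrib[of "\<lambda>z. z * _"] if_distrib[of "\<lambda>z. _ * z"] cong: if_cong)
next
  case False
  then have st: "0 < s" "0 < t" using assms by auto
  have m: "{\<omega> \<in> space path_space. \<omega> 0 = x \<and> \<omega> (s + t) = z} = {\<omega> \<in> space path_space. \<omega> 0 = x} \<inter> {\<omega> \<in> space path_space. \<omega> (s + t) = z}"
    by auto
  have "measure P {\<omega> \<in> space path_space. \<omega> 0 = x \<and> \<omega> (s + t) = z} =
    (\<Sum>y\<in>UNIV. measure P ({\<omega> \<in> space path_space. \<omega> 0 = x \<and> \<omega> (s + t) = z} \<inter> {\<omega> \<in> space path_space. \<omega> s = y}))"
    using st by (intro prob_partition) (auto simp only: m sets.Int eval_sets)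
  also have "\<dots> = (\<Sum>y\<in>UNIV. pmf \<mu> x * tp s x y * tp t y z)"
    using prob_three[of s "s + t" x _ z] st
    by (intro sum.cong refl) (simp add: Int_def conj_ac)
  finally have "pmf \<mu> x * tp (s + t) x z = pmf \<mu> x * (\<Sum>y\<in>UNIV. tp s x y * tp t y z)"
    using st prob_two[of "s + t" x z] by (simp add: sum_distrib_left mult_ac)
  then show ?thesis using mu_pos[of x] by simp
qed

text \<open>The case of \<open>markov\<close> without a past event; the complements in the induction
  there reduce to it.\<close>

lemma markov_one:
  assumes "0 \<le> s" "s < t"
  shows "measure P {\<omega> \<in> space path_space. \<omega> s = x \<and> \<omega> t = y} = measure P {\<omega> \<in> space path_space. \<omega> s = x} * tp (t - s) x y"
proof (cases "s = 0")
  case True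
  then show ?thesis using assms prob_two[of t x y] prob_initial by simp
next
  case False
  with assms have s: "0 < s" by simp
  have m: "{\<omega> \<in> space path_space. \<omega> s = x \<and> \<omega> t = y} = {\<omega> \<in> space path_space. \<omega> s = x} \<inter> {\<omega> \<in> space path_space. \<omega> t = y}"
    by auto
  have "measure P {\<omega> \<in> space path_space. \<omega> s = x \<and> \<omega> t = y} =
    (\<Sum>z\<in>UNIV. measure P ({\<omega> \<in> space path_space. \<omega> s = x \<and> \<omega> t = y} \<inter> {\<omega> \<in> space path_space. \<omega> 0 = z}))"
    using s assms by (intro prob_partition) (auto simp only: m sets.Int eval_sets)
  also have "\<dots> = (\<Sum>z\<in>UNIV. measure P ({\<omega> \<in> space path_space. \<omega> s = x} \<inter> {\<omega> \<in> space path_space. \<omega> 0 = z}) * tp (t - s) x y)"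
    using prob_three[of s t _ x y] prob_two[of s _ x] s assms
    by (intro sum.cong refl) (simp add: Int_def conj_ac)
  also have "\<dots> = measure P {\<omega> \<in> space path_space. \<omega> s = x} * tp (t - s) x y"
    using prob_partition[of "{\<omega> \<in> space path_space. \<omega> s = x}" 0] s eval_sets[of s x] by (simp flip: sum_distrib_right)
  finally show ?thesis .
qed

lemma prob_eval: "0 \<le> t \<Longrightarrow> measure P {\<omega> \<in> space path_space. \<omega> t = y} = pmf \<mu> y"
proof (cases "t = 0")
  case False
  assume "0 \<le> t"
  with False have t: "0 < t" by simp
  have "measure P {\<omega> \<in> space path_space. \<omega> t = y} =
    (\<Sum>z\<in>UNIV. measure P ({\<omega> \<in> space path_space. \<omega> t = y} \<inter> {\<omega> \<in> space path_space. \<omega> 0 = z}))"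
    using t by (intro prob_partition eval_sets) auto
  also have "\<dots> = (\<Sum>z\<in>UNIV. pmf \<mu> z * tp t z y)"
    using prob_two[OF t, of _ y] by (intro sum.cong refl) (simp add: Int_def conj_ac)
  finally show ?thesis using t stationary_eq by simp
qed (simp add: prob_initial)

text \<open>Both sides are additive in \<open>A\<close>, so a Dynkin argument over
  \<open>cyls s\<close> suffices. A nonempty generator fixes the state at time \<open>s\<close>:
  either it differs from \<open>x\<close> and both sides are 0, or \<open>fdd_ext\<close>
  applies.\<close>

lemma markov:
  assumes A: "A \<in> sets (path_filtration s)" and st: "0 \<le> s" "s < t"
  shows "measure P (A \<inter> {\<omega> \<in> space path_space. \<omega> s = x \<and> \<omega> t = y}) =
    measure P (A \<inter> {\<omega> \<in> space path_space. \<omega> s = x}) * tp (t - s) x y"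
proof -
  let ?B = "{\<omega> \<in> space path_space. \<omega> s = x \<and> \<omega> t = y}" and ?C = "{\<omega> \<in> space path_space. \<omega> s = x}"
  have "?B = ?C \<inter> {\<omega> \<in> space path_space. \<omega> t = y}" by auto
  then have BC: "?B \<in> sets P" "?C \<in> sets P" using st eval_sets[of s x] eval_sets[of t y] by (auto simp only: sets.Int)
  have G: "cyls s \<subseteq> Pow (space path_space)" by (auto simp: cyls_def cyl_def)
  have A': "A \<in> sigma_sets (space path_space) (cyls s)"
    using A st(1) by (simp add: sets_path_filtration_cyls)
  have sub: "X \<in> sets P" if "X \<in> sigma_sets (space path_space) (cyls s)" for X
    using that st(1) filtration_in_P[of X s] by (simp add: sets_path_filtration_cyls)
  show ?thesis
    using Int_stable_cyls G A'
  proof (induction rule: sigma_sets_induct_disjoint)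
    case (basic X)
    then consider "X = {}" | I a where "X = cyl I a" "finite I" "I \<subseteq> {0..s}" "0 \<in> I" "s \<in> I"
      by (auto simp: cyls_def)
    then show ?case
    proof cases
      case 2
      show ?thesis
      proof (cases "a s = x")
        case True
        then have "X \<inter> ?B = cyl (insert t I) (a(t := y))" "X \<inter> ?C = cyl I a"
          using 2 st by (auto simp: cyl_def)
        then show ?thesis using fdd_ext[OF 2(2-5) st(2), of a y] True by simp
      next
        case False
        then have "X \<inter> ?B = {}" "X \<inter> ?C = {}" using 2 by (auto simp: cyl_def)
        then show ?thesis by (simp only: measure_empty mult_zero_left)
      qed
    qed simp
  next
    case (compl X)
    have X: "X \<in> sets P" using compl sub by blast
    have "(space path_space - X) \<inter> B = B - X \<inter> B" if "B \<subseteq> space path_space" for B using that by auto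
    moreover have "measure P (B - X \<inter> B) = measure P B - measure P (X \<inter> B)" if "B \<in> sets P" for B
      using that X by (intro finite_measure_Diff) auto
    ultimately have *: "measure P ((space path_space - X) \<inter> B) = measure P B - measure P (X \<inter> B)" if "B \<in> sets P" for B
      using that sets.sets_into_space[OF that] by simp
    show ?case
      unfolding *[OF BC(1)] *[OF BC(2)] compl.IH markov_one[OF st] by (simp add: algebra_simps)
  next
    case (union X)
    have *: "(\<lambda>i. measure P (X i \<inter> B)) sums measure P ((\<Union>i. X i) \<inter> B)" if "B \<in> sets P" for B
    proof -
      have "(\<lambda>i. measure P (X i \<inter> B)) sums measure P (\<Union>i. X i \<inter> B)"
        using union that sub by (intro finite_measure_UNION) (auto simp: disjoint_family_on_def)
      then show ?thesis by simp
    qed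
    have "(\<lambda>i. measure P (X i \<inter> ?C) * tp (t - s) x y) sums (measure P ((\<Union>i. X i) \<inter> ?C) * tp (t - s) x y)"
      by (intro sums_mult2 * BC)
    then have "(\<lambda>i. measure P (X i \<inter> ?B)) sums (measure P ((\<Union>i. X i) \<inter> ?C) * tp (t - s) x y)"
      using union by simp
    then show ?case using sums_unique2[OF *[OF BC(1)]] by simp
  qed simp
qed

text \<open>The extension of \<open>markov\<close> from past events to nonnegative functions of the
  past, in the form used for one step of the induction in \<open>exp_moment\<close>.\<close>

lemma markov_nn:
  assumes g: "g \<in> borel_measurable (path_filtration s)" and st: "0 \<le> s" "s < t"
  shows "(\<integral>\<^sup>+\<omega>. g \<omega> * indicator {\<omega> \<in> space path_space. \<omega> s = x \<and> \<omega> t = y} \<omega> \<partial>P) =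
    ennreal (tp (t - s) x y) * (\<integral>\<^sup>+\<omega>. g \<omega> * indicator {\<omega> \<in> space path_space. \<omega> s = x} \<omega> \<partial>P)"
proof -
  let ?B = "{\<omega> \<in> space path_space. \<omega> s = x \<and> \<omega> t = y}" and ?C = "{\<omega> \<in> space path_space. \<omega> s = x}"
  have "?B = ?C \<inter> {\<omega> \<in> space path_space. \<omega> t = y}" by auto
  then have BC [measurable]: "?B \<in> sets P" "?C \<in> sets P" using st eval_sets[of s x] eval_sets[of t y] by (auto simp only: sets.Int)
  have mP: "f \<in> borel_measurable P" if "f \<in> borel_measurable (path_filtration s)" for f :: "_ \<Rightarrow> ennreal"
    using measurable_from_subalg[OF subalgebra_P that] .
  show ?thesis
    using g
  proof (induction rule: borel_measurable_induct)
    case (cong f g)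
    have "(\<integral>\<^sup>+\<omega>. f \<omega> * indicator B \<omega> \<partial>P) = (\<integral>\<^sup>+\<omega>. g \<omega> * indicator B \<omega> \<partial>P)" for B
      using cong by (intro nn_integral_cong) auto
    then show ?case using cong by simp
  next
    case (set A)
    have A [measurable]: "A \<in> sets P" using set filtration_in_P by blast
    have "(\<integral>\<^sup>+\<omega>. indicator A \<omega> * indicator B \<omega> \<partial>P) = ennreal (measure P (A \<inter> B))" if "B \<in> sets P" for B
      using that A unfolding indicator_inter_arith[symmetric] by (simp add: emeasure_eq_measure)
    from this[OF BC(1)] this[OF BC(2)] show ?case
      using markov[OF set st, of x y] tp_nonneg[of "t - s" x y] st by (simp only: ennreal_mult' measure_nonneg mult.commute)
  next
    case (mult u v)
    note mP[OF mult(2), measurable]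
    have "(\<integral>\<^sup>+\<omega>. v * u \<omega> * indicator B \<omega> \<partial>P) = v * (\<integral>\<^sup>+\<omega>. u \<omega> * indicator B \<omega> \<partial>P)" if [measurable]: "B \<in> sets P" for B
      by (subst nn_integral_cmult[symmetric]) (auto simp: mult.assoc)
    with mult show ?case using BC by (simp add: mult_ac)
  next
    case (add u v)
    note mP[OF add(1), measurable] mP[OF add(3), measurable]
    have "(\<integral>\<^sup>+\<omega>. (v \<omega> + u \<omega>) * indicator B \<omega> \<partial>P) = (\<integral>\<^sup>+\<omega>. v \<omega> * indicator B \<omega> \<partial>P) + (\<integral>\<^sup>+\<omega>. u \<omega> * indicator B \<omega> \<partial>P)" if [measurable]: "B \<in> sets P" for B
      by (subst nn_integral_add[symmetric]) (auto simp: distrib_right)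
    with add show ?case using BC by (simp add: distrib_left)
  next
    case (seq U)
    note mP[OF seq(1), measurable]
    have "(\<integral>\<^sup>+\<omega>. (SUP i. U i) \<omega> * indicator B \<omega> \<partial>P) = (SUP i. \<integral>\<^sup>+\<omega>. U i \<omega> * indicator B \<omega> \<partial>P)" if [measurable]: "B \<in> sets P" for B
    proof (subst nn_integral_monotone_convergence_SUP[symmetric])
      show "incseq (\<lambda>i \<omega>. U i \<omega> * indicator B \<omega>)"
        using seq(3) by (auto simp: incseq_def le_fun_def intro!: mult_right_mono)
    qed (auto simp: SUP_mult_right_ennreal image_comp)
    then show ?case using seq BC by (simp add: SUP_mult_left_ennreal)
  qed
qed

lemma constant_on_grid_prob:
  assumes A: "A \<in> sets (path_filtration s)" and "0 \<le> s" "0 < h"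
  shows "measure P (A \<inter> {\<omega> \<in> space path_space. \<omega> s = x} \<inter> constant_on_grid s h n) =
    measure P (A \<inter> {\<omega> \<in> space path_space. \<omega> s = x}) * tp h x x ^ n"
proof (induction n)
  case 0
  have "A \<inter> {\<omega> \<in> space path_space. \<omega> s = x} \<inter> constant_on_grid s h 0 = A \<inter> {\<omega> \<in> space path_space. \<omega> s = x}"
    by (auto simp: constant_on_grid_def)
  then show ?case by simp
next
  case (Suc n)
  let ?u = "s + real n * h"
  let ?A = "A \<inter> {\<omega> \<in> space path_space. \<omega> s = x} \<inter> constant_on_grid s h n"
  have "A \<in> sets (path_filtration ?u)" using A path_filtration_mono[of s ?u] assms by auto
  then have A': "?A \<in> sets (path_filtration ?u)"
    using assms by (intro sets.Int eval_eq_in_filtration constant_on_grid_in_filtration) auto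
  have "A \<inter> {\<omega> \<in> space path_space. \<omega> s = x} \<inter> constant_on_grid s h (Suc n) =
      ?A \<inter> {\<omega> \<in> space path_space. \<omega> ?u = x \<and> \<omega> (s + real (Suc n) * h) = x}"
    by (auto simp: constant_on_grid_def le_Suc_eq)
  moreover have "?A = ?A \<inter> {\<omega> \<in> space path_space. \<omega> ?u = x}"
    by (auto simp: constant_on_grid_def)
  ultimately show ?case
    using markov[OF A', of "s + real (Suc n) * h" x x] assms Suc by (simp add: algebra_simps)
qed

text \<open>The probability that a dyadic grid shows no change is a power of
  \<open>tp h x x\<close>, which is at least \<open>1 - Lam * h\<close>. Bernoulli's inequality
  turns the power into a bound that does not depend on the grid and so survives the limit of
  refining grids. The past event \<open>A\<close> makes the bound usable along a sequence of
  windows.\<close>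

lemma constant_on_window_prob:
  assumes A: "A \<in> sets (path_filtration s)" and st: "0 \<le> s" "s \<le> t"
  shows "(1 - Lam * (t - s)) * measure P (A \<inter> {\<omega> \<in> space path_space. \<omega> s = x}) \<le>
    measure P (A \<inter> {\<omega> \<in> space path_space. \<omega> s = x} \<inter> constant_on_window s t)"
proof (cases "s = t \<or> 1 < Lam * (t - s)")
  case True
  then show ?thesis
  proof
    assume "s = t"
    then have "A \<inter> {\<omega> \<in> space path_space. \<omega> s = x} \<inter> constant_on_window s t = A \<inter> {\<omega> \<in> space path_space. \<omega> s = x}"
      by (auto simp: constant_on_window_def)
    with \<open>s = t\<close> show ?thesis by simp
  next
    assume "1 < Lam * (t - s)"
    then have "(1 - Lam * (t - s)) * measure P (A \<inter> {\<omega> \<in> space path_space. \<omega> s = x}) \<le> 0"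
      by (intro mult_nonpos_nonneg) auto
    then show ?thesis using measure_nonneg order_trans by blast
  qed
next
  case False
  then have st': "s < t" and le1: "Lam * (t - s) \<le> 1" using st by auto
  let ?A = "A \<inter> {\<omega> \<in> space path_space. \<omega> s = x}"
  let ?G = "\<lambda>m. constant_on_grid s ((t - s) / 2 ^ m) (2 ^ m) :: (real \<Rightarrow> 'a) set"
  have As: "?A \<in> sets P" using A st by (intro sets.Int filtration_in_P[OF A] eval_sets) auto
  have G: "?G m \<in> sets P" for m
    using st by (intro filtration_in_P[OF constant_on_grid_in_filtration[of s _ _ t]]) auto
  have dec: "decseq (\<lambda>m. ?A \<inter> ?G m)"
  proof (rule decseq_SucI, rule Int_mono[OF subset_refl], rule subsetI)
    fix m \<omega> assume w: "\<omega> \<in> ?G (Suc m)"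
    have "\<omega> (s + real j * ((t - s) / 2 ^ m)) = \<omega> s" if "j \<le> 2 ^ m" for j
    proof -
      have "\<omega> (s + real (2 * j) * ((t - s) / 2 ^ Suc m)) = \<omega> s"
      proof -
        have "\<forall>j\<le>2 ^ Suc m. \<omega> (s + real j * ((t - s) / 2 ^ Suc m)) = \<omega> s"
          using w unfolding constant_on_grid_def by blast
        from spec[OF this, of "2 * j"] show ?thesis using that by simp
      qed
      then show ?thesis by simp
    qed
    then show "\<omega> \<in> ?G m" using w by (auto simp: constant_on_grid_def)
  qed
  have "(\<lambda>m. measure P (?A \<inter> ?G m)) \<longlonglongrightarrow> measure P (\<Inter>m. ?A \<inter> ?G m)"
    using As G dec by (intro finite_Lim_measure_decseq) auto
  moreover have "(\<Inter>m. ?A \<inter> ?G m) = ?A \<inter> constant_on_window s t"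
    unfolding constant_on_window_eq[OF st] by auto
  moreover have "(1 - Lam * (t - s)) * measure P ?A \<le> measure P (?A \<inter> ?G m)" for m
  proof -
    have h: "0 < (t - s) / 2 ^ m" using st' by simp
    have b: "Lam * ((t - s) / 2 ^ m) \<le> 1"
    proof -
      have "Lam * ((t - s) / 2 ^ m) \<le> Lam * (t - s)"
        using st' Lam_ge_1 divide_left_mono[of 1 "2 ^ m" "t - s"] by (intro mult_left_mono) auto
      from this le1 show ?thesis by (rule order_trans)
    qed
    have "1 - Lam * (t - s) = 1 + real (2 ^ m) * (- (Lam * ((t - s) / 2 ^ m)))" by simp
    also have "\<dots> \<le> (1 + - (Lam * ((t - s) / 2 ^ m))) ^ (2 ^ m)"
      using b by (intro Bernoulli_inequality) auto
    also have "\<dots> \<le> tp ((t - s) / 2 ^ m) x x ^ (2 ^ m)"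
      using tp_diag[of "(t - s) / 2 ^ m" x] h b by (intro power_mono) auto
    finally have "(1 - Lam * (t - s)) * measure P ?A \<le> tp ((t - s) / 2 ^ m) x x ^ (2 ^ m) * measure P ?A"
      by (rule mult_right_mono) simp
    also have "\<dots> = measure P (?A \<inter> ?G m)"
      using constant_on_grid_prob[OF A st(1) h, of x "2 ^ m"] by simp
    finally show ?thesis .
  qed
  ultimately show ?thesis by (intro LIMSEQ_le_const) auto
qed

lemma constant_on_window_sets: "0 \<le> s \<Longrightarrow> s \<le> t \<Longrightarrow> constant_on_window s t \<in> sets P"
  using filtration_in_P[OF constant_on_window_in_filtration[of s t t]] by simp

text \<open>Summing over the state at time \<open>s\<close>: a jump in a short window costs a factor
  \<open>Lam * (t - s)\<close>, whatever happened before.\<close>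

lemma nonconstant_window_prob:
  assumes A: "A \<in> sets (path_filtration s)" and st: "0 \<le> s" "s \<le> t"
  shows "measure P (A - constant_on_window s t) \<le> Lam * (t - s) * measure P A"
proof -
  note AP = filtration_in_P[OF A] and W = constant_on_window_sets[OF st]
  have "(1 - Lam * (t - s)) * measure P A =
      (\<Sum>x\<in>UNIV. (1 - Lam * (t - s)) * measure P (A \<inter> {\<omega> \<in> space path_space. \<omega> s = x}))"
    using prob_partition[OF AP st(1)] by (simp add: sum_distrib_left)
  also have "\<dots> \<le> (\<Sum>x\<in>UNIV. measure P (A \<inter> {\<omega> \<in> space path_space. \<omega> s = x} \<inter> constant_on_window s t))"
    by (intro sum_mono constant_on_window_prob assms)
  also have "\<dots> = measure P (A \<inter> constant_on_window s t)"
    using prob_partition[of "A \<inter> constant_on_window s t" s] AP W st by (simp add: Int_ac)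
  also have "\<dots> = measure P A - measure P (A - constant_on_window s t)"
    using finite_measure_Diff'[of A "constant_on_window s t"] AP W by simp
  finally show ?thesis by (simp add: algebra_simps)
qed

end

section \<open>An ergodic theorem uniform in the step\<close>

text \<open>Borel-Cantelli for the union over \<open>I n\<close>: the number of events at stage
  \<open>n\<close> may grow as long as their common bound \<open>e n\<close> beats it. The bounds
  uniform in \<open>\<delta>\<close> below have this form, with \<open>I n\<close> built from the
  cells of the step.\<close>

lemma (in prob_space) AE_eventually_avoids:
  fixes B :: "nat \<Rightarrow> 'i \<Rightarrow> 'a set"
  assumes fin: "\<And>n. finite (I n)" and B: "\<And>n j. j \<in> I n \<Longrightarrow> B n j \<in> sets M"
    and le: "\<And>n j. n \<ge> N \<Longrightarrow> j \<in> I n \<Longrightarrow> prob (B n j) \<le> e n"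
    and s: "summable (\<lambda>n. real (card (I n)) * e n)"
  shows "AE \<omega> in M. \<forall>\<^sub>F n in sequentially. \<forall>j\<in>I n. \<omega> \<notin> B n j"
proof -
  let ?A = "\<lambda>n. \<Union>j\<in>I n. B n j"
  have A: "?A n \<in> sets M" for n using fin B by auto
  have "AE \<omega> in M. \<forall>\<^sub>F n in sequentially. \<omega> \<in> space M - ?A n"
  proof (rule borel_cantelli_AE1)
    show "summable (\<lambda>n. measure M (?A n))"
    proof (rule summable_comparison_test_ev[OF _ s])
      show "\<forall>\<^sub>F n in sequentially. norm (measure M (?A n)) \<le> real (card (I n)) * e n"
        using eventually_ge_at_top[of N]
      proof eventually_elim
        case (elim n)
        have "measure M (?A n) \<le> (\<Sum>j\<in>I n. measure M (B n j))"
          using fin B by (intro finite_measure_subadditive_finite) auto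
        also have "\<dots> \<le> (\<Sum>j\<in>I n. e n)" by (intro sum_mono le elim)
        finally show ?case by simp
      qed
    qed
  qed (use A in \<open>auto simp: emeasure_eq_measure\<close>)
  then show ?thesis by (rule AE_mp) (auto elim!: eventually_mono intro!: AE_I2)
qed

text \<open>For negative \<open>x\<close>, the lower bound \<open>1 - x + x\<^sup>2 / 2\<close> of
  \<open>exp (- x)\<close> is inverted: its product with \<open>1 + x + x\<^sup>2\<close> is at
  least 1.\<close>

lemma exp_le_quadratic:
  fixes x :: real
  assumes "\<bar>x\<bar> \<le> 1"
  shows "exp x \<le> 1 + x + x\<^sup>2"
proof (cases "0 \<le> x")
  case True
  then show ?thesis using assms by (intro exp_bound) auto
next
  case False
  then have x: "- 1 \<le> x" "x < 0" using assms by auto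
  have "1 + (- x) + (- x)\<^sup>2 / 2 \<le> exp (- x)"
    using x by (intro exp_lower_Taylor_quadratic) auto
  then have "exp x * (1 - x + x\<^sup>2 / 2) \<le> exp x * exp (- x)"
    by (intro mult_left_mono) auto
  then have *: "exp x * (1 - x + x\<^sup>2 / 2) \<le> 1" by (simp flip: exp_add)
  have pos: "0 < 1 - x + x\<^sup>2 / 2" using x by (intro add_pos_nonneg) auto
  have "1 \<le> (1 + x + x\<^sup>2) * (1 - x + x\<^sup>2 / 2)"
  proof -
    have "(1 + x + x\<^sup>2) * (1 - x + x\<^sup>2 / 2) = 1 + x\<^sup>2 / 2 * (1 - x + x\<^sup>2)"
      by (simp add: field_simps power2_eq_square)
    moreover have "0 \<le> x\<^sup>2 / 2 * (1 - x + x\<^sup>2)" using x by (intro mult_nonneg_nonneg add_nonneg_nonneg) auto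
    ultimately show ?thesis by linarith
  qed
  with * have "exp x * (1 - x + x\<^sup>2 / 2) \<le> (1 + x + x\<^sup>2) * (1 - x + x\<^sup>2 / 2)" by linarith
  then show ?thesis using pos by (rule mult_right_le_imp_le)
qed

text \<open>Cells of width \<open>\<theta> / n\<close> for the step \<open>\<delta>\<close>: while \<open>\<delta>\<close> varies in one cell, each of the
  first \<open>n\<close> sampling times \<open>i \<delta>\<close> moves by at most \<open>\<theta>\<close>. For \<open>n = 0\<close> the grid is the single
  point \<open>a\<close>, since \<open>x / 0 = 0\<close>.\<close>

definition grid :: "real \<Rightarrow> real \<Rightarrow> nat \<Rightarrow> nat \<Rightarrow> real" where
  "grid a \<theta> n j = a + real j * \<theta> / real n"

definition grid_card :: "real \<Rightarrow> real \<Rightarrow> real \<Rightarrow> nat \<Rightarrow> nat" where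
  "grid_card a b \<theta> n = nat \<lfloor>(b - a) * real n / \<theta>\<rfloor>"

lemma grid_cell:
  assumes "a \<le> \<delta>" "\<delta> \<le> b" "0 < n" "0 < \<theta>"
  shows "\<exists>j\<le>grid_card a b \<theta> n. grid a \<theta> n j \<le> \<delta> \<and> \<delta> \<le> grid a \<theta> n j + \<theta> / real n"
proof (intro exI conjI)
  let ?q = "(\<delta> - a) * real n / \<theta>"
  define j where "j = nat \<lfloor>?q\<rfloor>"
  have q: "0 \<le> ?q" using assms by auto
  have "?q \<le> (b - a) * real n / \<theta>" using assms by (intro divide_right_mono mult_right_mono) auto
  then show "j \<le> grid_card a b \<theta> n" unfolding grid_card_def j_def by (intro nat_mono floor_mono)
  have "real j = of_int \<lfloor>?q\<rfloor>" using q unfolding j_def by (intro of_nat_nat) simp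
  then have "real j \<le> ?q" "?q \<le> real j + 1" by linarith+
  then have 1: "real j * \<theta> \<le> (\<delta> - a) * real n" "(\<delta> - a) * real n \<le> (real j + 1) * \<theta>"
    by (simp_all only: pos_le_divide_eq[OF assms(4)] pos_divide_le_eq[OF assms(4)])
  have 2: "real n > 0" using assms by simp
  from 1 2 show "grid a \<theta> n j \<le> \<delta>" "\<delta> \<le> grid a \<theta> n j + \<theta> / real n"
    by (simp_all add: grid_def field_simps)
qed

lemma grid_bounds:
  assumes "j \<le> grid_card a b \<theta> n" "a \<le> b" "0 < \<theta>"
  shows "a \<le> grid a \<theta> n j" "grid a \<theta> n j \<le> b"
proof -
  show "a \<le> grid a \<theta> n j" using assms by (simp add: grid_def)
  have "real j \<le> (b - a) * real n / \<theta>"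
    using assms by (simp add: grid_card_def le_nat_floor le_nat_iff le_floor_iff)
  then have "real j * \<theta> \<le> (b - a) * real n" using assms by (simp add: field_simps)
  then have "real j * \<theta> / real n \<le> b - a" using assms
    by (cases "n = 0") (auto simp: field_simps)
  then show "grid a \<theta> n j \<le> b" by (simp add: grid_def)
qed

lemma grid_card_le:
  assumes "a \<le> b" "0 < \<theta>"
  shows "real (grid_card a b \<theta> n) \<le> (b - a) / \<theta> * real n"
proof -
  have "0 \<le> (b - a) * real n / \<theta>" using assms by auto
  then have "real (grid_card a b \<theta> n) = of_int \<lfloor>(b - a) * real n / \<theta>\<rfloor>"
    unfolding grid_card_def by (intro of_nat_nat) simp
  also have "\<dots> \<le> (b - a) * real n / \<theta>" by linarith
  finally show ?thesis by (simp add: field_simps)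
qed

lemma summable_linear_geometric:
  fixes r :: real
  assumes "0 \<le> r" "r < 1"
  shows "summable (\<lambda>n. (\<alpha> * real n + \<beta>) * (\<gamma> * r ^ n))"
proof -
  have "summable (\<lambda>n. real n * r ^ n)"
  proof -
    have "summable (\<lambda>n. of_nat (Suc n) * r ^ n)"
      using assms by (intro sums_summable[OF geometric_deriv_sums]) auto
    then have "summable (\<lambda>n. of_nat (Suc n) * r ^ n - r ^ n)"
      using assms by (intro summable_diff summable_geometric) auto
    then show ?thesis by (simp add: algebra_simps)
  qed
  then have "summable (\<lambda>n. \<alpha> * \<gamma> * (real n * r ^ n) + \<beta> * \<gamma> * r ^ n)"
    using assms by (intro summable_add summable_mult summable_geometric) auto
  then show ?thesis by (simp add: algebra_simps)
qed

text \<open>The \<open>i\<close>-th sampling time moves by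
  \<open>i * (\<delta> - u) \<le> i * \<theta> / n \<le> \<theta>\<close>, hence stays in the
  window.\<close>

lemma window_constant_eq:
  assumes "\<omega> \<in> constant_on_window (real i * u) (real i * u + \<theta>)"
    and "i \<le> n" "u \<le> \<delta>" "\<delta> \<le> u + \<theta> / real n" "0 \<le> \<theta>"
  shows "\<omega> (real i * \<delta>) = \<omega> (real i * u)"
proof -
  have "real i * \<delta> \<le> real i * u + \<theta>"
  proof (cases "i = 0")
    case False
    then have n: "0 < n" using assms by auto
    have "real i * \<delta> \<le> real i * (u + \<theta> / real n)" using assms by (intro mult_left_mono) auto
    also have "\<dots> = real i * u + (real i / real n) * \<theta>" by (simp add: algebra_simps)
    also have "(real i / real n) * \<theta> \<le> 1 * \<theta>" using assms n by (intro mult_right_mono) auto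
    finally show ?thesis by simp
  qed (use assms in simp)
  moreover have "real i * u \<le> real i * \<delta>" using assms by (intro mult_left_mono) auto
  ultimately have "real i * \<delta> \<in> {real i * u..real i * u + \<theta>}" by simp
  then show ?thesis using assms(1) unfolding constant_on_window_def by blast
qed

text \<open>The sampling indices at which the letter may change while \<open>\<delta>\<close> moves
  inside the cell with left end \<open>u\<close>.\<close>

definition bad_windows :: "real \<Rightarrow> real \<Rightarrow> nat \<Rightarrow> (real \<Rightarrow> 'a) \<Rightarrow> nat set" where
  "bad_windows u \<theta> n \<omega> = {i. i \<le> n \<and> \<omega> \<notin> constant_on_window (real i * u) (real i * u + \<theta>)}"

definition pair_count :: "real \<Rightarrow> nat \<Rightarrow> 'a \<Rightarrow> 'a \<Rightarrow> (real \<Rightarrow> 'a) \<Rightarrow> nat" where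
  "pair_count u n x y \<omega> = card {i. i < n \<and> \<omega> (real i * u) = x \<and> \<omega> (real (Suc i) * u) = y}"

lemma finite_bad_windows [simp]: "finite (bad_windows u \<theta> n \<omega>)"
  by (auto simp: bad_windows_def)

lemma card_shift_bad: "card {i. i < n \<and> Suc i \<in> bad_windows u \<theta> n \<omega>} \<le> card (bad_windows u \<theta> n \<omega>)"
  by (rule card_inj_on_le[where f=Suc]) auto

lemma pair_count_near_aux:
  assumes "{i. i < n \<and> f i = x \<and> f (Suc i) = y} \<subseteq> {i. i < n \<and> g i = x \<and> g (Suc i) = y} \<union> (B \<union> {i. i < n \<and> Suc i \<in> B})"
    and "finite B" "card {i. i < n \<and> Suc i \<in> B} \<le> card B"
  shows "card {i. i < n \<and> f i = x \<and> f (Suc i) = y} \<le> card {i. i < n \<and> g i = x \<and> g (Suc i) = y} + 2 * card B"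
proof -
  have "card {i. i < n \<and> f i = x \<and> f (Suc i) = y} \<le> card ({i. i < n \<and> g i = x \<and> g (Suc i) = y} \<union> (B \<union> {i. i < n \<and> Suc i \<in> B}))"
    using assms by (intro card_mono) auto
  also have "\<dots> \<le> card {i. i < n \<and> g i = x \<and> g (Suc i) = y} + (card B + card {i. i < n \<and> Suc i \<in> B})"
    by (intro order_trans[OF card_Un_le] add_mono order_refl card_Un_le)
  finally show ?thesis using assms(3) by linarith
qed

text \<open>A bad index can spoil two pairs, one as first and one as second member; hence the factor
  2.\<close>

lemma pair_count_near:
  assumes "u \<le> \<delta>" "\<delta> \<le> u + \<theta> / real n" "0 \<le> \<theta>"
  shows "\<bar>real (pair_count \<delta> n x y \<omega>) - real (pair_count u n x y \<omega>)\<bar> \<le> 2 * real (card (bad_windows u \<theta> n \<omega>))"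
proof -
  let ?B = "bad_windows u \<theta> n \<omega>"
  have eq: "\<omega> (real i * \<delta>) = \<omega> (real i * u)" if "i \<notin> ?B" "i \<le> n" for i
    using that window_constant_eq[of \<omega> i u \<theta> n \<delta>] assms by (auto simp: bad_windows_def)
  have 1: "pair_count \<delta> n x y \<omega> \<le> pair_count u n x y \<omega> + 2 * card ?B"
    unfolding pair_count_def
    by (rule pair_count_near_aux[where f="\<lambda>i. \<omega> (real i * \<delta>)" and g="\<lambda>i. \<omega> (real i * u)"])
      (use eq card_shift_bad[of n u \<theta> \<omega>] in \<open>auto simp del: of_nat_Suc\<close>)
  have 2: "pair_count u n x y \<omega> \<le> pair_count \<delta> n x y \<omega> + 2 * card ?B"
    unfolding pair_count_def
    by (rule pair_count_near_aux[where f="\<lambda>i. \<omega> (real i * u)" and g="\<lambda>i. \<omega> (real i * \<delta>)"])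
      (use eq card_shift_bad[of n u \<theta> \<omega>] in \<open>auto simp del: of_nat_Suc\<close>)
  from 1 2 show ?thesis by linarith
qed

lemma measurable_pair_eval:
  fixes F :: "'a::finite \<Rightarrow> 'a \<Rightarrow> real"
  assumes "0 \<le> s" "s \<le> v" "0 \<le> t" "t \<le> v"
  shows "(\<lambda>\<omega>. F (\<omega> s) (\<omega> t)) \<in> borel_measurable (path_filtration v)"
proof -
  note [measurable] = measurable_eval_filtration[OF assms(1,2)] measurable_eval_filtration[OF assms(3,4)]
  show ?thesis
    by (rule measurable_compose_countable[where f="\<lambda>x \<omega>. F x (\<omega> t)" and g="\<lambda>\<omega>. \<omega> s"]) auto
qed

context ctmc
begin

lemma ev_bad_windows:
  assumes "0 \<le> \<theta>" "\<theta> \<le> u" "finite I" "\<forall>i\<in>I. i < N"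
  shows "{\<omega> \<in> space path_space. \<forall>i\<in>I. \<omega> \<notin> constant_on_window (real i * u) (real i * u + \<theta>)}
    \<in> sets (path_filtration (real N * u) :: (real \<Rightarrow> 'a) measure)"
proof -
  have "constant_on_window (real i * u) (real i * u + \<theta>) \<in> sets (path_filtration (real N * u) :: (real \<Rightarrow> 'a) measure)" if "i \<in> I" for i
  proof -
    have "real (Suc i) * u \<le> real N * u" using that assms by (intro mult_right_mono of_nat_mono) auto
    then show ?thesis using assms by (intro constant_on_window_in_filtration) (auto simp: algebra_simps)
  qed
  then have "(\<Inter>i\<in>I. space path_space - constant_on_window (real i * u) (real i * u + \<theta>)) \<inter> space path_space \<in> sets (path_filtration (real N * u) :: (real \<Rightarrow> 'a) measure)"
    using assms(3) sets.top[of "path_filtration (real N * u) :: (real \<Rightarrow> 'a) measure"]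
    by (cases "I = {}") (auto intro!: sets.Int sets.finite_INT sets.Diff)
  moreover have "{\<omega> \<in> space path_space :: (real \<Rightarrow> 'a) set. \<forall>i\<in>I. \<omega> \<notin> constant_on_window (real i * u) (real i * u + \<theta>)} =
     (\<Inter>i\<in>I. space path_space - constant_on_window (real i * u) (real i * u + \<theta>)) \<inter> space path_space"
    by auto
  ultimately show ?thesis by (simp only:)
qed

text \<open>Since \<open>\<theta> \<le> u\<close>, each window ends no later than the next one
  begins. Removing the latest index leaves an event in the past of its window, and a jump in that
  window costs a factor \<open>Lam * \<theta>\<close>.\<close>

lemma all_bad_windows_prob:
  assumes "0 \<le> \<theta>" "\<theta> \<le> u" "finite I"
  shows "prob {\<omega> \<in> space path_space. \<forall>i\<in>I. \<omega> \<notin> constant_on_window (real i * u) (real i * u + \<theta>)} \<le> (Lam * \<theta>) ^ card I"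
  using assms(3)
proof (induction I rule: finite_linorder_max_induct)
  case empty
  then show ?case by (simp add: prob_space[simplified])
next
  case (insert b A)
  let ?E = "\<lambda>I. {\<omega> \<in> space path_space :: (real \<Rightarrow> 'a) set. \<forall>i\<in>I. \<omega> \<notin> constant_on_window (real i * u) (real i * u + \<theta>)}"
  have "?E (insert b A) = ?E A - constant_on_window (real b * u) (real b * u + \<theta>)" by auto
  then have "prob (?E (insert b A)) = prob (?E A - constant_on_window (real b * u) (real b * u + \<theta>))" by (simp only:)
  moreover have "prob (?E A - constant_on_window (real b * u) (real b * u + \<theta>)) \<le> Lam * (real b * u + \<theta> - real b * u) * prob (?E A)"
    using assms insert by (intro nonconstant_window_prob ev_bad_windows) auto
  moreover have "Lam * (real b * u + \<theta> - real b * u) * prob (?E A) \<le> Lam * \<theta> * (Lam * \<theta>) ^ card A"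
    using insert(3) assms Lam_ge_1 by (simp add: mult_left_mono)
  moreover have "card (insert b A) = Suc (card A)" using insert by (subst card_insert_disjoint) auto
  ultimately show ?case by (simp only: power_Suc mult.assoc)
qed

lemma bad_windows_sets:
  assumes "0 \<le> \<theta>" "\<theta> \<le> u"
  shows "{\<omega> \<in> space path_space :: (real \<Rightarrow> 'a) set. n \<le> r * card (bad_windows u \<theta> n \<omega>)} =
     (\<Union>I\<in>{I. I \<subseteq> {..n} \<and> n \<le> r * card I}. {\<omega> \<in> space path_space. \<forall>i\<in>I. \<omega> \<notin> constant_on_window (real i * u) (real i * u + \<theta>)})"
    (is "?L = ?R")
   and "{\<omega> \<in> space path_space :: (real \<Rightarrow> 'a) set. n \<le> r * card (bad_windows u \<theta> n \<omega>)} \<in> sets P"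
proof -
  show eq: "?L = ?R"
  proof (intro set_eqI iffI)
    fix \<omega> assume "\<omega> \<in> ?L"
    then show "\<omega> \<in> ?R" by (intro UN_I[of "bad_windows u \<theta> n \<omega>"]) (auto simp: bad_windows_def)
  next
    fix \<omega> assume "\<omega> \<in> ?R"
    then obtain I where I: "I \<subseteq> {..n}" "n \<le> r * card I" "\<omega> \<in> space path_space"
      "\<forall>i\<in>I. \<omega> \<notin> constant_on_window (real i * u) (real i * u + \<theta>)" by auto
    have "card I \<le> card (bad_windows u \<theta> n \<omega>)"
      using I by (intro card_mono finite_bad_windows) (auto simp: bad_windows_def)
    then have "r * card I \<le> r * card (bad_windows u \<theta> n \<omega>)" by (rule mult_le_mono2)
    from order_trans[OF I(2) this] show "\<omega> \<in> ?L" using I(3) by simp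
  qed
  have "?R \<in> sets P"
    using assms by (intro sets.finite_UN filtration_in_P[OF ev_bad_windows[of _ _ _ "Suc n"]]) (auto intro: finite_subset)
  then show "?L \<in> sets P" by (simp only: eq)
qed

text \<open>A union bound over the sets \<open>I\<close> of indices whose windows are all bad. There
  are at most \<open>2 ^ (n + 1)\<close> of them, and \<open>n \<le> r * card I\<close> makes each
  probability at most \<open>((1/4) ^ r) ^ card I \<le> (1/4) ^ n\<close>. Thus \<open>1 / r\<close>
  is the tolerated proportion of bad windows, bought by a small \<open>\<theta>\<close>.\<close>

lemma bad_windows_prob:
  assumes "0 \<le> \<theta>" "\<theta> \<le> u" "Lam * \<theta> \<le> (1/4) ^ r"
  shows "prob {\<omega> \<in> space path_space. n \<le> r * card (bad_windows u \<theta> n \<omega>)} \<le> 2 * (1/2) ^ n"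
proof -
  let ?S = "{I. I \<subseteq> {..n} \<and> n \<le> r * card I}"
  let ?E = "\<lambda>I. {\<omega> \<in> space path_space :: (real \<Rightarrow> 'a) set. \<forall>i\<in>I. \<omega> \<notin> constant_on_window (real i * u) (real i * u + \<theta>)}"
  have fin: "finite ?S" by (rule finite_subset[of _ "Pow {..n}"]) auto
  have "prob (\<Union>I\<in>?S. ?E I) \<le> (\<Sum>I\<in>?S. prob (?E I))"
    using fin assms by (intro finite_measure_subadditive_finite) (auto intro!: filtration_in_P[OF ev_bad_windows[of _ _ _ "Suc n"], simplified] intro: finite_subset)
  also have "\<dots> \<le> (\<Sum>I\<in>?S. (1/4) ^ n)"
  proof (rule sum_mono)
    fix I assume I: "I \<in> ?S"
    then have f: "finite I" using finite_subset by auto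
    have "prob (?E I) \<le> (Lam * \<theta>) ^ card I" using assms f by (intro all_bad_windows_prob)
    also have "\<dots> \<le> ((1/4) ^ r) ^ card I" using assms Lam_ge_1 by (intro power_mono) auto
    also have "\<dots> = (1/4) ^ (r * card I)" by (simp add: power_mult)
    also have "\<dots> \<le> (1/4) ^ n" using I by (intro power_decreasing) auto
    finally show "prob (?E I) \<le> (1/4) ^ n" .
  qed
  also have "\<dots> = real (card ?S) * (1/4) ^ n" by simp
  also have "\<dots> \<le> real (card (Pow {..n})) * (1/4) ^ n"
    by (intro mult_right_mono of_nat_mono card_mono) auto
  also have "\<dots> = 2 * (1/2) ^ n"
  proof -
    have "(1/4::real) = (1/2) * (1/2)" by simp
    then show ?thesis by (simp only: power_mult_distrib card_Pow finite_atMost card_atMost) (simp add: power_one_over)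
  qed
  finally show ?thesis unfolding bad_windows_sets(1)[OF assms(1,2)] .
qed

lemma AE_bad_windows:
  assumes "0 < \<theta>" "\<theta> \<le> a" "a \<le> b" "Lam * \<theta> \<le> (1/4) ^ r"
  shows "AE \<omega> in P. \<forall>\<^sub>F n in sequentially. \<forall>j\<in>{..grid_card a b \<theta> n}. r * card (bad_windows (grid a \<theta> n j) \<theta> n \<omega>) < n"
proof -
  have u: "\<theta> \<le> grid a \<theta> n j" for n j using assms by (auto simp: grid_def intro: add_increasing2)
  have "AE \<omega> in P. \<forall>\<^sub>F n in sequentially. \<forall>j\<in>{..grid_card a b \<theta> n}.
      \<omega> \<notin> {\<omega> \<in> space path_space. n \<le> r * card (bad_windows (grid a \<theta> n j) \<theta> n \<omega>)}"
  proof (rule AE_eventually_avoids[where N=0])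
    show "prob {\<omega> \<in> space path_space. n \<le> r * card (bad_windows (grid a \<theta> n j) \<theta> n \<omega>)} \<le> 2 * (1/2) ^ n" for n j
      using assms u by (intro bad_windows_prob) auto
    show "summable (\<lambda>n. real (card {..grid_card a b \<theta> n}) * (2 * (1 / 2) ^ n))"
    proof (rule summable_comparison_test[OF _ summable_linear_geometric[of "1/2" "(b - a) / \<theta>" 1 2]], intro exI allI impI)
      fix n
      show "norm (real (card {..grid_card a b \<theta> n}) * (2 * (1 / 2) ^ n)) \<le> ((b - a) / \<theta> * real n + 1) * (2 * (1 / 2) ^ n)"
        using grid_card_le[OF assms(3,1), of n] by (simp add: abs_mult mult_right_mono)
    qed auto
    show "{\<omega> \<in> space path_space. n \<le> r * card (bad_windows (grid a \<theta> n j) \<theta> n \<omega>)} \<in> events" for n j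
      using u[of n j] assms by (intro bad_windows_sets(2)) auto
  qed auto
  then show ?thesis
    by (rule AE_mp) (auto elim!: eventually_mono intro!: AE_I2 simp: not_le)
qed

text \<open>Doeblin's argument: all entries of \<open>tp 1\<close> are at least some
  \<open>\<kappa> > 0\<close>, so each unit of time shrinks the oscillation of
  \<open>tp t w x\<close> in \<open>w\<close> by a factor \<open>1 - \<kappa>\<close>. By
  stationarity \<open>pmf \<mu> x\<close> is an average of the numbers \<open>tp t v x\<close> over
  \<open>v\<close>, so a small oscillation means closeness to it.\<close>

lemma mixing:
  assumes "0 < \<epsilon>"
  shows "\<exists>T>0. \<forall>t\<ge>T. \<forall>w x. \<bar>tp t w x - pmf \<mu> x\<bar> \<le> \<epsilon>"
proof -
  obtain \<kappa> where k: "\<kappa> > 0" "\<And>x y. \<kappa> \<le> tp 1 x y" using tp_lower_uniform[of 1 1] by auto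
  have k1: "\<kappa> \<le> 1" using k(2)[of undefined undefined] tp_le_1[of 1 undefined undefined] by simp
  have contract: "tp (t + 1) w x - tp (t + 1) w' x \<le> (1 - \<kappa>) * B"
    if "0 \<le> t" "0 \<le> B" and B: "\<And>w w'. tp t w x - tp t w' x \<le> B" for t B w w' x
  proof -
    have "\<exists>v. \<forall>z. tp t v x \<le> tp t z x"
    proof -
      have "finite (range (\<lambda>z. tp t z x))" "range (\<lambda>z. tp t z x) \<noteq> {}" by auto
      then have "Min (range (\<lambda>z. tp t z x)) \<in> range (\<lambda>z. tp t z x)" by (rule Min_in)
      then obtain v where v: "Min (range (\<lambda>z. tp t z x)) = tp t v x" by blast
      have "tp t v x \<le> tp t z x" for z unfolding v[symmetric] by (intro Min_le) auto
      then show ?thesis by blast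
    qed
    then obtain v where v: "\<And>z. tp t v x \<le> tp t z x" by blast
    let ?f = "\<lambda>z. tp t z x - tp t v x"
    have ck: "tp (t + 1) w x = tp t v x + (\<Sum>z\<in>UNIV. tp 1 w z * ?f z)" for w
    proof -
      have "tp (t + 1) w x = (\<Sum>z\<in>UNIV. tp 1 w z * tp t z x)"
        using chapman_kolmogorov[of 1 t w x] that by (simp add: add.commute)
      moreover have "(\<Sum>z\<in>UNIV. tp 1 w z * tp t v x) = tp t v x"
        using tp_row_sum[of 1 w] by (simp flip: sum_distrib_right)
      ultimately show ?thesis by (simp add: right_diff_distrib sum_subtractf)
    qed
    \<comment> \<open>Both rows dominate the constant \<open>\<kappa>\<close>, and this common part
      cancels in the difference. \<open>?f\<close> is nonnegative by the choice of the minimizing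
      state \<open>v\<close>.\<close>
    have "tp (t + 1) w x - tp (t + 1) w' x = (\<Sum>z\<in>UNIV. (tp 1 w z - \<kappa>) * ?f z) - (\<Sum>z\<in>UNIV. (tp 1 w' z - \<kappa>) * ?f z)"
      unfolding ck by (simp add: left_diff_distrib sum_subtractf)
    also have "\<dots> \<le> (\<Sum>z\<in>UNIV. (tp 1 w z - \<kappa>) * B) - 0"
      using k B v by (intro diff_mono sum_mono sum_nonneg mult_left_mono mult_nonneg_nonneg) auto
    also have "\<dots> = (1 - real (card (UNIV::'a set)) * \<kappa>) * B"
      using tp_row_sum[of 1 w] by (simp add: sum_subtractf flip: sum_distrib_right)
    also have "\<dots> \<le> (1 - \<kappa>) * B"
      using k \<open>0 \<le> B\<close> by (intro mult_right_mono) (auto simp: Suc_le_eq finite_UNIV_card_ge_0)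
    finally show ?thesis .
  qed
  have osc: "tp (r + real n) w x - tp (r + real n) w' x \<le> (1 - \<kappa>) ^ n" if "0 \<le> r" for r n w w' x
  proof (induction n arbitrary: w w')
    case 0
    then show ?case using tp_le_1[of r w x] tp_nonneg[of r w' x] that by simp
  next
    case (Suc n)
    have "tp (r + real n + 1) w x - tp (r + real n + 1) w' x \<le> (1 - \<kappa>) * (1 - \<kappa>) ^ n"
      using that k1 by (intro contract Suc) auto
    then show ?case by (simp add: add_ac)
  qed
  obtain N where N: "(1 - \<kappa>) ^ N < \<epsilon>"
    using real_arch_pow_inv[of \<epsilon> "1 - \<kappa>"] assms k by auto
  show ?thesis
  proof (intro exI[of _ "real (Suc N)"] conjI allI impI)
    fix t w x assume t: "real (Suc N) \<le> t"
    have o: "tp t w x - tp t w' x \<le> \<epsilon>" for w w'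
      using osc[of "t - real N" N w x w'] t N by simp
    have "tp t w x - pmf \<mu> x = (\<Sum>v\<in>UNIV. pmf \<mu> v * (tp t w x - tp t v x))"
      using stationary_eq[of t x] mu_sum t by (simp add: right_diff_distrib sum_subtractf flip: sum_distrib_right)
    also have "\<bar>\<dots>\<bar> \<le> (\<Sum>v\<in>UNIV. pmf \<mu> v * \<epsilon>)"
    proof (rule order_trans[OF sum_abs sum_mono])
      fix v
      have "\<bar>tp t w x - tp t v x\<bar> \<le> \<epsilon>" using o[of w v] o[of v w] by linarith
      then show "\<bar>pmf \<mu> v * (tp t w x - tp t v x)\<bar> \<le> pmf \<mu> v * \<epsilon>" by (simp add: abs_mult mult_left_mono)
    qed
    also have "\<dots> = \<epsilon>" using mu_sum by (simp flip: sum_distrib_right)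
    finally show "\<bar>tp t w x - pmf \<mu> x\<bar> \<le> \<epsilon>" .
  qed simp
qed

text \<open>A multiplicative drift argument: the transition kernel weighted by \<open>exp F\<close>
  maps \<open>V\<close> to at most \<open>\<rho> * V\<close>, so each step multiplies the
  expectation by at most \<open>\<rho>\<close>. The integrals \<open>?E\<close> keep the final state
  apart, since the next weight depends on it. Two choices of \<open>V\<close> occur:
  \<open>1 + l * h\<close> for deviations of pair counts, and the constant 1 for second moments of
  likelihood ratios.\<close>

lemma exp_moment:
  fixes F :: "'a \<Rightarrow> 'a \<Rightarrow> real" and V :: "'a \<Rightarrow> real"
  assumes u: "0 < u" and V: "\<And>w. 0 \<le> V w" and \<rho>: "0 \<le> \<rho>"
    and step: "\<And>w. (\<Sum>z\<in>UNIV. tp u w z * exp (F w z) * V z) \<le> \<rho> * V w"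
  shows "(\<integral>\<^sup>+\<omega>. ennreal (exp (\<Sum>i<n. F (\<omega> (real i * u)) (\<omega> (real (Suc i) * u)))) * ennreal (V (\<omega> (real n * u))) \<partial>P)
    \<le> ennreal (\<rho> ^ n * (\<Sum>w\<in>UNIV. pmf \<mu> w * V w))"
proof -
  let ?S = "\<lambda>n \<omega>. ennreal (exp (\<Sum>i<n. F (\<omega> (real i * u)) (\<omega> (real (Suc i) * u))))"
  let ?C = "\<lambda>n w. {\<omega> \<in> space path_space. \<omega> (real n * u) = w}"
  let ?E = "\<lambda>n w. \<integral>\<^sup>+\<omega>. ?S n \<omega> * indicator (?C n w) \<omega> \<partial>P"
  have Smeas: "?S n \<in> borel_measurable (path_filtration (real n * u))" for n
  proof -
    have "real i * u \<le> real n * u" "real (Suc i) * u \<le> real n * u" if "i < n" for i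
      using that u by (auto intro!: mult_right_mono of_nat_mono simp del: of_nat_Suc)
    then show ?thesis
      using u by (intro measurable_compose[OF _ measurable_ennreal] measurable_compose[OF _ borel_measurable_exp] borel_measurable_sum measurable_pair_eval) auto
  qed
  note SP [measurable] = measurable_from_subalg[OF subalgebra_P Smeas]
  have C [measurable]: "?C n w \<in> sets P" for n w using u by (intro eval_sets) auto
  have E_Suc: "?E (Suc n) z = (\<Sum>w\<in>UNIV. ennreal (tp u w z * exp (F w z)) * ?E n w)" for n z
  proof -
    let ?D = "\<lambda>w. {\<omega> \<in> space path_space. \<omega> (real n * u) = w \<and> \<omega> (real (Suc n) * u) = z}"
    have D [measurable]: "?D w \<in> sets P" for w
    proof -
      have "?D w = ?C n w \<inter> ?C (Suc n) z" by auto
      then show ?thesis using C by (simp only: sets.Int)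
    qed
    have "?E (Suc n) z = (\<integral>\<^sup>+\<omega>. (\<Sum>w\<in>UNIV. ennreal (exp (F w z)) * (?S n \<omega> * indicator (?D w) \<omega>)) \<partial>P)"
    proof (rule nn_integral_cong)
      fix \<omega> assume w: "\<omega> \<in> space P"
      have "(\<Sum>w\<in>UNIV. ennreal (exp (F w z)) * (?S n \<omega> * indicator (?D w) \<omega>)) =
        (\<Sum>w\<in>{\<omega> (real n * u)}. ennreal (exp (F w z)) * (?S n \<omega> * indicator (?D w) \<omega>))"
        by (intro sum.mono_neutral_right) auto
      also have "\<dots> = ?S (Suc n) \<omega> * indicator (?C (Suc n) z) \<omega>"
        using w by (auto simp: indicator_def exp_add ennreal_mult mult_ac)
      finally show "?S (Suc n) \<omega> * indicator (?C (Suc n) z) \<omega> = (\<Sum>w\<in>UNIV. ennreal (exp (F w z)) * (?S n \<omega> * indicator (?D w) \<omega>))" by simp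
    qed
    also have "\<dots> = (\<Sum>w\<in>UNIV. ennreal (exp (F w z)) * (\<integral>\<^sup>+\<omega>. ?S n \<omega> * indicator (?D w) \<omega> \<partial>P))"
      by (subst nn_integral_sum) (auto intro!: sum.cong nn_integral_cmult simp del: of_nat_Suc)
    also have "\<dots> = (\<Sum>w\<in>UNIV. ennreal (exp (F w z)) * (ennreal (tp u w z) * ?E n w))"
      using markov_nn[OF Smeas, of n "real (Suc n) * u"] u by (intro sum.cong refl arg_cong2[where f="(*)"]) (simp add: algebra_simps)
    also have "\<dots> = (\<Sum>w\<in>UNIV. ennreal (tp u w z * exp (F w z)) * ?E n w)"
      using u by (intro sum.cong refl) (simp add: ennreal_mult tp_nonneg mult_ac)
    finally show ?thesis .
  qed
  have total: "(\<integral>\<^sup>+\<omega>. ?S n \<omega> * ennreal (V (\<omega> (real n * u))) \<partial>P) = (\<Sum>w\<in>UNIV. ennreal (V w) * ?E n w)" for n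
  proof -
    have "(\<integral>\<^sup>+\<omega>. ?S n \<omega> * ennreal (V (\<omega> (real n * u))) \<partial>P) = (\<integral>\<^sup>+\<omega>. (\<Sum>w\<in>UNIV. ennreal (V w) * (?S n \<omega> * indicator (?C n w) \<omega>)) \<partial>P)"
    proof (rule nn_integral_cong)
      fix \<omega> assume w: "\<omega> \<in> space P"
      have "(\<Sum>w\<in>UNIV. ennreal (V w) * (?S n \<omega> * indicator (?C n w) \<omega>)) =
        (\<Sum>w\<in>{\<omega> (real n * u)}. ennreal (V w) * (?S n \<omega> * indicator (?C n w) \<omega>))"
        by (intro sum.mono_neutral_right) auto
      then show "?S n \<omega> * ennreal (V (\<omega> (real n * u))) = (\<Sum>w\<in>UNIV. ennreal (V w) * (?S n \<omega> * indicator (?C n w) \<omega>))"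
        using w by (simp add: mult_ac)
    qed
    also have "\<dots> = (\<Sum>w\<in>UNIV. ennreal (V w) * ?E n w)"
      by (subst nn_integral_sum) (auto intro!: sum.cong nn_integral_cmult simp del: of_nat_Suc)
    finally show ?thesis .
  qed
  have "(\<Sum>w\<in>UNIV. ennreal (V w) * ?E n w) \<le> ennreal (\<rho> ^ n * (\<Sum>w\<in>UNIV. pmf \<mu> w * V w))"
  proof (induction n)
    case 0
    have "?E 0 w = ennreal (pmf \<mu> w)" for w
      using prob_initial[of w] eval_sets[of 0 w] by (simp add: emeasure_eq_measure)
    then have "(\<Sum>w\<in>UNIV. ennreal (V w) * ?E 0 w) = (\<Sum>w\<in>UNIV. ennreal (V w) * ennreal (pmf \<mu> w))"
      by (simp only:)
    also have "\<dots> = ennreal (\<Sum>w\<in>UNIV. V w * pmf \<mu> w)"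
      using V by (simp add: ennreal_mult[symmetric] sum_ennreal)
    finally show ?case by (simp add: mult.commute)
  next
    case (Suc n)
    have "(\<Sum>z\<in>UNIV. ennreal (V z) * ?E (Suc n) z) = (\<Sum>w\<in>UNIV. (\<Sum>z\<in>UNIV. ennreal (tp u w z * exp (F w z) * V z)) * ?E n w)"
      unfolding E_Suc sum_distrib_left sum_distrib_right
      using V u by (subst sum.swap) (auto intro!: sum.cong simp: ennreal_mult tp_nonneg mult_ac)
    also have "\<dots> \<le> (\<Sum>w\<in>UNIV. ennreal (\<rho> * V w) * ?E n w)"
      using step V u by (intro sum_mono mult_right_mono) (auto simp: tp_nonneg intro!: ennreal_leI)
    also have "\<dots> = ennreal \<rho> * (\<Sum>w\<in>UNIV. ennreal (V w) * ?E n w)"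
      using V \<rho> by (simp add: ennreal_mult sum_distrib_left mult_ac)
    also have "\<dots> \<le> ennreal \<rho> * ennreal (\<rho> ^ n * (\<Sum>w\<in>UNIV. pmf \<mu> w * V w))"
      by (intro mult_left_mono Suc) auto
    also have "\<dots> = ennreal (\<rho> ^ Suc n * (\<Sum>w\<in>UNIV. pmf \<mu> w * V w))"
      using \<rho> V by (simp add: ennreal_mult'[symmetric] mult_ac)
    finally show ?case .
  qed
  then show ?thesis unfolding total .
qed

end

lemma uniform_continuity_family:
  fixes f :: "'a::finite \<Rightarrow> 'a \<Rightarrow> real \<Rightarrow> real"
  assumes "\<And>x y. continuous_on {a..b} (f x y)" "0 < \<epsilon>"
  shows "\<exists>\<eta>>0. \<forall>s\<in>{a..b}. \<forall>t\<in>{a..b}. \<bar>s - t\<bar> < \<eta> \<longrightarrow> (\<forall>x y. \<bar>f x y s - f x y t\<bar> \<le> \<epsilon>)"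
proof -
  have "\<exists>\<eta>>0. \<forall>s\<in>{a..b}. \<forall>t\<in>{a..b}. \<bar>s - t\<bar> < \<eta> \<longrightarrow> \<bar>f x y s - f x y t\<bar> \<le> \<epsilon>" for x y
  proof -
    have "uniformly_continuous_on {a..b} (f x y)"
      using assms by (intro compact_uniformly_continuous) auto
    then obtain \<eta> where "\<eta> > 0" "\<forall>x'\<in>{a..b}. \<forall>x''\<in>{a..b}. dist x'' x' < \<eta> \<longrightarrow> dist (f x y x'') (f x y x') < \<epsilon>"
      using assms(2) unfolding uniformly_continuous_on_def by blast
    then show ?thesis by (intro exI[of _ \<eta>]) (auto simp: dist_real_def intro: less_imp_le)
  qed
  then have "\<forall>z. \<exists>\<eta>>0. \<forall>s\<in>{a..b}. \<forall>t\<in>{a..b}. \<bar>s - t\<bar> < \<eta> \<longrightarrow> \<bar>f (fst z) (snd z) s - f (fst z) (snd z) t\<bar> \<le> \<epsilon>"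
    by blast
  then obtain \<eta> where \<eta>: "\<And>z. \<eta> z > 0"
    "\<And>z s t. s \<in> {a..b} \<Longrightarrow> t \<in> {a..b} \<Longrightarrow> \<bar>s - t\<bar> < \<eta> z \<Longrightarrow> \<bar>f (fst z) (snd z) s - f (fst z) (snd z) t\<bar> \<le> \<epsilon>"
    unfolding choice_iff by blast
  show ?thesis
  proof (intro exI[of _ "Min (range \<eta>)"] conjI ballI impI allI)
    show "0 < Min (range \<eta>)" using \<eta>(1) by auto
    fix s t x y assume st: "s \<in> {a..b}" "t \<in> {a..b}" "\<bar>s - t\<bar> < Min (range \<eta>)"
    have "Min (range \<eta>) \<le> \<eta> (x, y)" by (intro Min_le) auto
    then show "\<bar>f x y s - f x y t\<bar> \<le> \<epsilon>" using \<eta>(2)[of s t "(x, y)"] st by auto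
  qed
qed

lemma (in rates) tp_continuous_on: "continuous_on A (\<lambda>t. tp t x y)"
  using continuous_tp by (intro continuous_at_imp_continuous_on) auto

lemma sum_indicator_pairs:
  "(\<Sum>i<n. if \<omega> (real i * u) = x \<and> \<omega> (real (Suc i) * u) = y then 1 else 0 :: real) = real (pair_count u n x y \<omega>)"
proof -
  have "(\<Sum>i<n. if \<omega> (real i * u) = x \<and> \<omega> (real (Suc i) * u) = y then 1 else 0 :: real) = real (card ({..<n} \<inter> {i. \<omega> (real i * u) = x \<and> \<omega> (real (Suc i) * u) = y}))"
    by (subst sum.If_cases) auto
  moreover have "{..<n} \<inter> {i. \<omega> (real i * u) = x \<and> \<omega> (real (Suc i) * u) = y} = {i. i < n \<and> \<omega> (real i * u) = x \<and> \<omega> (real (Suc i) * u) = y}"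
    by auto
  ultimately show ?thesis by (simp only: pair_count_def)
qed

section \<open>Deviations of pair counts, uniformly in the step\<close>

context ctmc
begin

lemma measurable_pair_count:
  assumes "0 \<le> u"
  shows "(\<lambda>\<omega>. real (pair_count u n x y \<omega>)) \<in> borel_measurable P"
proof -
  have "(\<lambda>\<omega>. \<Sum>i<n. if \<omega> (real i * u) = x \<and> \<omega> (real (Suc i) * u) = y then 1 else 0 :: real) \<in> borel_measurable P"
  proof (rule borel_measurable_sum)
    fix i assume i: "i \<in> {..<n}"
    have "(\<lambda>\<omega>. (\<lambda>w z. if w = x \<and> z = y then 1 else 0 :: real) (\<omega> (real i * u)) (\<omega> (real (Suc i) * u)))
      \<in> borel_measurable (path_filtration (real (Suc i) * u))"
      using assms by (intro measurable_pair_eval) (auto intro: mult_right_mono)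
    from measurable_from_subalg[OF subalgebra_P this]
    show "(\<lambda>\<omega>. if \<omega> (real i * u) = x \<and> \<omega> (real (Suc i) * u) = y then 1 else 0 :: real) \<in> borel_measurable P" .
  qed
  then show ?thesis by (simp only: sum_indicator_pairs)
qed

text \<open>The function \<open>h\<close> below is an approximate solution of the Poisson equation for the
  centered pair indicator, and \<open>1 + \<lambda> h\<close> turns the exponential moment into a supermartingale.\<close>

lemma pair_count_tail:
  assumes ab: "0 < a" and \<epsilon>: "0 < \<epsilon>" and \<sigma>: "\<bar>\<sigma>\<bar> = (1::real)"
  shows "\<exists>\<rho>. 0 \<le> \<rho> \<and> \<rho> < 1 \<and> (\<forall>u\<ge>a. \<forall>n x y.
    prob {\<omega> \<in> space path_space. \<epsilon> * real n \<le> \<sigma> * (real (pair_count u n x y \<omega>) - real n * (pmf \<mu> x * tp u x y))} \<le> 3 * \<rho> ^ n)"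
proof -
  \<comment> \<open>Half of the Chernoff exponent \<open>l * \<epsilon>\<close> will be spent on the
    growth of the moment: \<open>\<rho>\<close> below is at most
    \<open>exp (4 * l * e) = exp (l * \<epsilon> / 2)\<close>.\<close>
  define e where "e = \<epsilon> / 8"
  have e: "0 < e" using \<epsilon> by (simp add: e_def)
  obtain T where T: "T > 0" "\<And>t w x. T \<le> t \<Longrightarrow> \<bar>tp t w x - pmf \<mu> x\<bar> \<le> e" using mixing[OF e] by blast
  \<comment> \<open>\<open>m\<close>, and with it \<open>l\<close> and the rate, depend on the step
    \<open>u\<close> only through its lower bound \<open>a\<close>: the time \<open>m * u\<close>
    exceeds \<open>T\<close> for every \<open>u \<ge> a\<close>.\<close>
  obtain m :: nat where m: "T < real m * a" using reals_Archimedean3[OF ab] by blast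
  \<comment> \<open>\<open>l * m \<le> 1/2\<close> keeps \<open>V\<close> between \<open>1/2\<close>
    and \<open>3/2\<close>, and \<open>l * (m + 2) \<le> e\<close> absorbs the quadratic error
    terms.\<close>
  define l where "l = min e (1/2) / (real m + 2)"
  have l0: "0 < l" using e by (simp add: l_def)
  have le: "l * (real m + 2) \<le> e" "l * (real m + 2) \<le> 1/2" by (simp_all add: l_def)
  then have lm: "l * real m \<le> 1/2" using l0 by (simp add: distrib_left)
  have l1: "l \<le> 1" using le(2) l0 mult_left_mono[of 1 "real m + 2" l] by linarith
  show ?thesis
  proof (intro exI[of _ "exp (- (l * \<epsilon> / 2))"] conjI allI impI)
    show "exp (- (l * \<epsilon> / 2)) < 1" using l0 \<epsilon> by simp
    fix u n x y assume ua: "a \<le> u"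
    have u: "0 < u" using ua ab by simp
    define q where "q = tp u x y"
    have q: "0 \<le> q" "q \<le> 1" using u by (auto simp: q_def tp_nonneg tp_le_1)
    \<comment> \<open>Up to the sign \<open>\<sigma>\<close>, the conditional expectation of the
      centered indicator of a pair that begins \<open>k\<close> steps later, given the present state
      \<open>w\<close>.\<close>
    define g where "g k w = \<sigma> * q * (tp (real k * u) w x - pmf \<mu> x)" for k :: nat and w
    have d1: "\<bar>tp t w x - pmf \<mu> x\<bar> \<le> 1" if "0 \<le> t" for t w
      using tp_nonneg[OF that, of w x] tp_le_1[OF that, of w x] pmf_le_1[of \<mu> x] pmf_nonneg[of \<mu> x] by linarith
    have g1: "\<bar>g k w\<bar> \<le> 1" for k w
      unfolding g_def using d1[of "real k * u" w] u q \<sigma> by (simp add: abs_mult mult_le_one)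
    define h where "h w = (\<Sum>k<m. g k w)" for w
    have h: "\<bar>h w\<bar> \<le> real m" for w
      unfolding h_def by (rule order_trans[OF sum_abs]) (use sum_bounded_above[of "{..<m}" "\<lambda>k. \<bar>g k w\<bar>" 1] g1 in simp)
    define F where "F w z = \<sigma> * ((if w = x \<and> z = y then 1 else 0) - pmf \<mu> x * q)" for w z
    have F1: "\<bar>F w z\<bar> \<le> 1" for w z
    proof -
      have "0 \<le> pmf \<mu> x * q" "pmf \<mu> x * q \<le> 1" using q by (auto simp: pmf_le_1 mult_le_one)
      then show ?thesis unfolding F_def using \<sigma> by (auto simp: abs_mult)
    qed
    have sumF: "(\<Sum>z\<in>UNIV. tp u w z * F w z) = g 0 w" for w
    proof -
      have "(\<Sum>z\<in>UNIV. tp u w z * F w z) = \<sigma> * ((\<Sum>z\<in>UNIV. tp u w z * (if w = x \<and> z = y then 1 else 0)) - (\<Sum>z\<in>UNIV. tp u w z) * (pmf \<mu> x * q))"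
        unfolding F_def by (simp add: sum_distrib_left sum_distrib_right right_diff_distrib sum_subtractf mult_ac)
      also have "(\<Sum>z\<in>UNIV. tp u w z * (if w = x \<and> z = y then 1 else 0)) = (if w = x then q else 0)"
        by (simp add: q_def if_distrib[of "\<lambda>z. _ * z"] cong: if_cong)
      finally show ?thesis using u by (simp add: tp_row_sum g_def tp_0 algebra_simps)
    qed
    have g_Suc: "(\<Sum>z\<in>UNIV. tp u w z * g k z) = g (Suc k) w" for k w
    proof -
      have "(\<Sum>z\<in>UNIV. tp u w z * g k z) = \<sigma> * q * ((\<Sum>z\<in>UNIV. tp u w z * tp (real k * u) z x) - (\<Sum>z\<in>UNIV. tp u w z) * pmf \<mu> x)"
        unfolding g_def by (simp add: sum_distrib_left sum_distrib_right right_diff_distrib sum_subtractf mult_ac)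
      then show ?thesis
        using u chapman_kolmogorov[of u "real k * u" w x] by (simp add: tp_row_sum g_def algebra_simps)
    qed
    \<comment> \<open>Applying the transition matrix to \<open>h\<close> shifts the sum:
      \<open>g 0\<close>, the mean of \<open>F\<close>, is lost and \<open>g m\<close> is gained. So
      \<open>h\<close> solves the Poisson equation up to \<open>g m\<close>, which mixing makes
      small.\<close>
    have sumh: "(\<Sum>z\<in>UNIV. tp u w z * (F w z + h z)) \<le> h w + e" for w
    proof -
      have "(\<Sum>z\<in>UNIV. tp u w z * h z) = (\<Sum>k<m. g (Suc k) w)"
        unfolding h_def sum_distrib_left by (subst sum.swap) (simp add: g_Suc)
      moreover have "g 0 w + (\<Sum>k<m. g (Suc k) w) = (\<Sum>k<m. g k w) + g m w"
        using sum.lessThan_Suc_shift[of "\<lambda>k. g k w" m] sum.lessThan_Suc[of "\<lambda>k. g k w" m] by simp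
      ultimately have "(\<Sum>z\<in>UNIV. tp u w z * (F w z + h z)) = h w + g m w"
        by (simp add: distrib_left sum.distrib sumF h_def)
      moreover have "g m w \<le> e"
      proof -
        have "real m * a \<le> real m * u" using ua by (intro mult_left_mono) auto
        then have "\<bar>tp (real m * u) w x - pmf \<mu> x\<bar> \<le> e" using m by (intro T(2)) auto
        then have "\<bar>g m w\<bar> \<le> 1 * e"
          unfolding g_def abs_mult using q \<sigma> by (intro mult_mono) auto
        then show ?thesis by simp
      qed
      ultimately show ?thesis by simp
    qed
    define V where "V w = 1 + l * h w" for w
    have lh: "\<bar>l * h w\<bar> \<le> 1/2" for w
    proof -
      have "l * \<bar>h w\<bar> \<le> l * real m" using h[of w] l0 by (intro mult_left_mono) auto
      moreover have "\<bar>l * h w\<bar> = l * \<bar>h w\<bar>" using l0 by (simp add: abs_mult)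
      ultimately show ?thesis using lm by linarith
    qed
    have V: "1/2 \<le> V w" "V w \<le> 3/2" for w
      using lh[of w] unfolding V_def abs_le_iff by linarith+
    define \<rho> where "\<rho> = 1 + 4 * l * e"
    have step: "(\<Sum>z\<in>UNIV. tp u w z * exp (l * F w z) * V z) \<le> \<rho> * V w" for w
    proof -
      have "(\<Sum>z\<in>UNIV. tp u w z * exp (l * F w z) * V z) \<le> (\<Sum>z\<in>UNIV. tp u w z * ((1 + l * e) + l * (F w z + h z)))"
      proof (rule sum_mono)
        fix z
        have f: "\<bar>l * F w z\<bar> \<le> l" using F1[of w z] l0 by (simp add: abs_mult mult_left_le)
        then have "exp (l * F w z) \<le> 1 + l * F w z + (l * F w z)\<^sup>2"
          using l1 by (intro exp_le_quadratic) auto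
        also have "(l * F w z)\<^sup>2 \<le> l\<^sup>2" using f l0 abs_le_square_iff[of "l * F w z" l] by simp
        finally have "exp (l * F w z) * V z \<le> (1 + l * F w z + l\<^sup>2) * V z"
          using V(1)[of z] by (intro mult_right_mono) auto
        also have "\<dots> = 1 + l * (F w z + h z) + l\<^sup>2 * (F w z * h z) + l\<^sup>2 * V z"
          by (simp add: V_def algebra_simps power2_eq_square)
        also have "\<dots> \<le> 1 + l * (F w z + h z) + l\<^sup>2 * real m + l\<^sup>2 * 2"
        proof -
          have "\<bar>F w z * h z\<bar> \<le> 1 * real m" unfolding abs_mult using F1 h by (intro mult_mono) auto
          then have "F w z * h z \<le> real m" by simp
          then have "l\<^sup>2 * (F w z * h z) \<le> l\<^sup>2 * real m" by (intro mult_left_mono) auto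
          moreover have "l\<^sup>2 * V z \<le> l\<^sup>2 * 2" using V(2)[of z] by (intro mult_left_mono) auto
          ultimately show ?thesis by simp
        qed
        also have "\<dots> = 1 + l * (F w z + h z) + l * (l * (real m + 2))"
          by (simp add: algebra_simps power2_eq_square)
        also have "\<dots> \<le> 1 + l * (F w z + h z) + l * e"
          using le(1) l0 by simp
        finally have "exp (l * F w z) * V z \<le> (1 + l * e) + l * (F w z + h z)" by simp
        then have "tp u w z * (exp (l * F w z) * V z) \<le> tp u w z * ((1 + l * e) + l * (F w z + h z))"
          using u by (intro mult_left_mono) (auto simp: tp_nonneg)
        then show "tp u w z * exp (l * F w z) * V z \<le> tp u w z * ((1 + l * e) + l * (F w z + h z))"
          by (simp add: mult.assoc)
      qed
      also have "\<dots> = (\<Sum>z\<in>UNIV. tp u w z) * (1 + l * e) + l * (\<Sum>z\<in>UNIV. tp u w z * (F w z + h z))"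
        unfolding sum_distrib_left sum_distrib_right sum.distrib[symmetric]
        by (intro sum.cong refl) (simp add: algebra_simps)
      also have "\<dots> \<le> 1 + l * e + l * (h w + e)"
        using sumh[of w] l0 u by (simp add: tp_row_sum)
      \<comment> \<open>The additive error \<open>2 * l * e\<close> becomes multiplicative because
        \<open>V w \<ge> 1/2\<close>.\<close>
      also have "\<dots> = V w + (4 * l * e) * (1/2)" by (simp add: V_def algebra_simps)
      also have "\<dots> \<le> V w + (4 * l * e) * V w"
        using V(1)[of w] l0 e by (intro add_left_mono mult_left_mono) auto
      finally show ?thesis by (simp add: \<rho>_def algebra_simps)
    qed
    have \<rho>0: "0 \<le> \<rho>" using l0 e by (auto simp: \<rho>_def)
    let ?Z = "\<lambda>\<omega>. real (pair_count u n x y \<omega>)"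
    let ?A = "{\<omega> \<in> space path_space. \<epsilon> * real n \<le> \<sigma> * (?Z \<omega> - real n * (pmf \<mu> x * tp u x y))}"
    have sumS: "(\<Sum>i<n. l * F (\<omega> (real i * u)) (\<omega> (real (Suc i) * u))) = l * (\<sigma> * (?Z \<omega> - real n * (pmf \<mu> x * tp u x y)))" for \<omega>
    proof -
      have "(\<Sum>i<n. F (\<omega> (real i * u)) (\<omega> (real (Suc i) * u))) = \<sigma> * (?Z \<omega> - real n * (pmf \<mu> x * tp u x y))"
        unfolding F_def sum_distrib_left[symmetric] sum_subtractf sum_indicator_pairs q_def by simp
      then show ?thesis by (simp add: sum_distrib_left[symmetric])
    qed
    have A: "?A \<in> sets P"
    proof -
      note [measurable] = measurable_pair_count[OF less_imp_le[OF u], of n x y]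
      have "{\<omega> \<in> space P. \<epsilon> * real n \<le> \<sigma> * (?Z \<omega> - real n * (pmf \<mu> x * tp u x y))} \<in> sets P"
        by measurable
      then show ?thesis by simp
    qed
    have "ennreal (exp (l * \<epsilon> * real n) / 2 * prob ?A) = (\<integral>\<^sup>+\<omega>. ennreal (exp (l * \<epsilon> * real n) / 2) * indicator ?A \<omega> \<partial>P)"
      unfolding nn_integral_cmult_indicator[OF A] emeasure_eq_measure by (rule ennreal_mult) auto
    also have "\<dots> \<le> (\<integral>\<^sup>+\<omega>. ennreal (exp (\<Sum>i<n. l * F (\<omega> (real i * u)) (\<omega> (real (Suc i) * u)))) * ennreal (V (\<omega> (real n * u))) \<partial>P)"
    proof (rule nn_integral_mono)
      fix \<omega>
      show "ennreal (exp (l * \<epsilon> * real n) / 2) * indicator ?A \<omega> \<le> ennreal (exp (\<Sum>i<n. l * F (\<omega> (real i * u)) (\<omega> (real (Suc i) * u)))) * ennreal (V (\<omega> (real n * u)))"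
      proof (cases "\<omega> \<in> ?A")
        case True
        then have "l * (\<epsilon> * real n) \<le> l * (\<sigma> * (?Z \<omega> - real n * (pmf \<mu> x * tp u x y)))"
          using l0 by (intro mult_left_mono) auto
        then have "exp (l * \<epsilon> * real n) * (1/2) \<le> exp (l * (\<sigma> * (?Z \<omega> - real n * (pmf \<mu> x * tp u x y)))) * V (\<omega> (real n * u))"
          using V(1) by (intro mult_mono) (auto simp: mult.assoc)
        then show ?thesis using True unfolding sumS
          by (subst ennreal_mult[symmetric]) (use V(1)[of "\<omega> (real n * u)"] in \<open>auto intro!: ennreal_leI\<close>)
      qed simp
    qed
    also have "\<dots> \<le> ennreal (\<rho> ^ n * (\<Sum>w\<in>UNIV. pmf \<mu> w * V w))"
      using V step \<rho>0 by (intro exp_moment u) (auto intro: order_trans[of 0 "1/2"])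
    finally have "exp (l * \<epsilon> * real n) / 2 * prob ?A \<le> \<rho> ^ n * (\<Sum>w\<in>UNIV. pmf \<mu> w * V w)"
      by (subst (asm) ennreal_le_iff) (use \<rho>0 V in \<open>auto intro!: mult_nonneg_nonneg sum_nonneg intro: order_trans[of 0 "1/2"]\<close>)
    also have "(\<Sum>w\<in>UNIV. pmf \<mu> w * V w) \<le> (\<Sum>w\<in>UNIV. pmf \<mu> w * (3/2))"
      using V(2) by (intro sum_mono mult_left_mono) auto
    also have "\<dots> = 3/2" using mu_sum by (simp flip: sum_distrib_right sum_divide_distrib)
    finally have "exp (l * \<epsilon> * real n) * prob ?A \<le> 3 * \<rho> ^ n"
      using \<rho>0 by (simp add: mult_left_mono)
    also have "\<rho> ^ n \<le> exp (4 * l * e) ^ n"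
      using \<rho>0 exp_ge_add_one_self[of "4 * l * e"] by (intro power_mono) (auto simp: \<rho>_def)
    also have "\<dots> = exp (l * \<epsilon> * real n) * exp (- (l * \<epsilon> / 2)) ^ n"
      by (simp add: e_def mult_ac flip: exp_of_nat_mult exp_add)
    finally show "prob ?A \<le> 3 * exp (- (l * \<epsilon> / 2)) ^ n" by simp
  qed simp
qed

text \<open>Three errors of \<open>\<epsilon> / 3\<close> each: the letters changed by moving from
  \<open>\<delta>\<close> to the left end \<open>u\<close> of its cell, the deviation of the count
  at \<open>u\<close>, and the change of \<open>tp\<close> between \<open>u\<close> and
  \<open>\<delta>\<close>.\<close>

lemma pair_count_uniform:
  assumes ab: "0 < a" "a \<le> b" and \<epsilon>: "0 < \<epsilon>"
  shows "AE \<omega> in P. \<forall>\<^sub>F n in sequentially. \<forall>\<delta>\<in>{a..b}. \<forall>x y.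
    \<bar>real (pair_count \<delta> n x y \<omega>) - real n * (pmf \<mu> x * tp \<delta> x y)\<bar> \<le> \<epsilon> * real n"
proof -
  \<comment> \<open>With at most \<open>n / r\<close> bad windows a pair count changes by at most
    \<open>2 * n / r\<close>, which is to be at most \<open>\<epsilon> / 3 * n\<close>.\<close>
  obtain r :: nat where r: "6 / \<epsilon> < real r" using reals_Archimedean2 by blast
  have r0: "0 < real r" using r \<epsilon> by (smt (verit) divide_pos_pos)
  then have rr: "2 / real r \<le> \<epsilon> / 3" using r \<epsilon> by (simp add: field_simps)
  define \<theta> where "\<theta> = min a ((1/4) ^ r / Lam)"
  have L: "0 < Lam" using Lam_ge_1 by simp
  have \<theta>: "0 < \<theta>" "\<theta> \<le> a" "Lam * \<theta> \<le> (1/4) ^ r"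
  proof -
    show "0 < \<theta>" "\<theta> \<le> a" using ab L by (auto simp: \<theta>_def)
    have "Lam * \<theta> \<le> Lam * ((1/4) ^ r / Lam)" using L by (intro mult_left_mono) (auto simp: \<theta>_def)
    then show "Lam * \<theta> \<le> (1/4) ^ r" using L by simp
  qed
  obtain \<eta> where \<eta>: "\<eta> > 0" "\<And>s t x y. s \<in> {a..b} \<Longrightarrow> t \<in> {a..b} \<Longrightarrow> \<bar>s - t\<bar> < \<eta> \<Longrightarrow> \<bar>tp s x y - tp t x y\<bar> \<le> \<epsilon> / 3"
    using uniform_continuity_family[of a b "\<lambda>x y t. tp t x y" "\<epsilon> / 3"] tp_continuous_on \<epsilon> by (metis divide_pos_pos zero_less_numeral)
  obtain \<rho>1 where \<rho>1: "0 \<le> \<rho>1" "\<rho>1 < 1" "\<forall>u\<ge>a. \<forall>n x y.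
    prob {\<omega> \<in> space path_space. \<epsilon> / 3 * real n \<le> 1 * (real (pair_count u n x y \<omega>) - real n * (pmf \<mu> x * tp u x y))} \<le> 3 * \<rho>1 ^ n"
    using pair_count_tail[OF ab(1), of "\<epsilon> / 3" 1] \<epsilon> by auto
  obtain \<rho>2 where \<rho>2: "0 \<le> \<rho>2" "\<rho>2 < 1" "\<forall>u\<ge>a. \<forall>n x y.
    prob {\<omega> \<in> space path_space. \<epsilon> / 3 * real n \<le> (-1) * (real (pair_count u n x y \<omega>) - real n * (pmf \<mu> x * tp u x y))} \<le> 3 * \<rho>2 ^ n"
    using pair_count_tail[OF ab(1), of "\<epsilon> / 3" "-1"] \<epsilon> by auto
  have dev: "AE \<omega> in P. \<forall>\<^sub>F n in sequentially. \<forall>z\<in>{..grid_card a b \<theta> n} \<times> (UNIV :: ('a \<times> 'a) set).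
      \<omega> \<notin> {\<omega> \<in> space path_space. \<epsilon> / 3 * real n \<le> \<sigma> * (real (pair_count (grid a \<theta> n (fst z)) n (fst (snd z)) (snd (snd z)) \<omega>)
         - real n * (pmf \<mu> (fst (snd z)) * tp (grid a \<theta> n (fst z)) (fst (snd z)) (snd (snd z))))}"
    if \<rho>: "0 \<le> \<rho>" "\<rho> < 1" "\<forall>u\<ge>a. \<forall>n x y.
      prob {\<omega> \<in> space path_space. \<epsilon> / 3 * real n \<le> \<sigma> * (real (pair_count u n x y \<omega>) - real n * (pmf \<mu> x * tp u x y))} \<le> 3 * \<rho> ^ n"
    for \<rho> \<sigma>
  proof (rule AE_eventually_avoids[where N=0 and e="\<lambda>n. 3 * \<rho> ^ n"])
    have u: "a \<le> grid a \<theta> n j" for n j using \<theta> by (simp add: grid_def)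
    fix n and z :: "nat \<times> 'a \<times> 'a"
    let ?u = "grid a \<theta> n (fst z)"
    let ?S = "\<lambda>\<omega>. \<sigma> * (real (pair_count ?u n (fst (snd z)) (snd (snd z)) \<omega>) - real n * (pmf \<mu> (fst (snd z)) * tp ?u (fst (snd z)) (snd (snd z))))"
    show "prob {\<omega> \<in> space path_space. \<epsilon> / 3 * real n \<le> ?S \<omega>} \<le> 3 * \<rho> ^ n"
      using \<rho>(3) u by blast
    have [measurable]: "?S \<in> borel_measurable P"
      using u[of n "fst z"] ab by (intro borel_measurable_times borel_measurable_diff measurable_pair_count) auto
    have "{\<omega> \<in> space P. \<epsilon> / 3 * real n \<le> ?S \<omega>} \<in> sets P" by measurable
    then show "{\<omega> \<in> space path_space. \<epsilon> / 3 * real n \<le> ?S \<omega>} \<in> sets P" by simp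
  next
    define cc where "cc = real (card (UNIV :: ('a \<times> 'a) set))"
    show "summable (\<lambda>n. real (card ({..grid_card a b \<theta> n} \<times> (UNIV :: ('a \<times> 'a) set))) * (3 * \<rho> ^ n))"
    proof (rule summable_comparison_test[OF _ summable_linear_geometric[of \<rho> "(b - a) / \<theta> * cc" cc 3]], intro exI allI impI)
      fix n
      have "(real (grid_card a b \<theta> n) + 1) * cc \<le> ((b - a) / \<theta> * real n + 1) * cc"
        using grid_card_le[OF ab(2) \<theta>(1), of n] by (intro mult_right_mono) (auto simp: cc_def)
      also have "\<dots> = (b - a) / \<theta> * cc * real n + cc" by (simp add: algebra_simps)
      finally have "(real (grid_card a b \<theta> n) + 1) * cc * (3 * \<rho> ^ n) \<le> ((b - a) / \<theta> * cc * real n + cc) * (3 * \<rho> ^ n)"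
        using \<rho>(1) by (intro mult_right_mono) auto
      moreover have "real (card ({..grid_card a b \<theta> n} \<times> (UNIV :: ('a \<times> 'a) set))) = (real (grid_card a b \<theta> n) + 1) * cc"
        by (simp only: card_cartesian_product card_atMost cc_def of_nat_mult of_nat_Suc add.commute)
      ultimately show "norm (real (card ({..grid_card a b \<theta> n} \<times> (UNIV :: ('a \<times> 'a) set))) * (3 * \<rho> ^ n)) \<le> ((b - a) / \<theta> * cc * real n + cc) * (3 * \<rho> ^ n)"
        using \<rho>(1) by (simp only: real_norm_def) (subst abs_of_nonneg, auto simp: cc_def)
    qed (use \<rho> in auto)
  qed auto
  have ev: "\<forall>\<^sub>F n in sequentially. \<theta> / real n < \<eta> \<and> 0 < n"
  proof -
    obtain N :: nat where N: "\<theta> / \<eta> < real N" using reals_Archimedean2 by blast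
    show ?thesis
    proof (rule eventually_sequentiallyI[of "Suc N"])
      fix n assume n: "Suc N \<le> n"
      then have "\<theta> / \<eta> < real n" using N by linarith
      then show "\<theta> / real n < \<eta> \<and> 0 < n" using n \<eta>(1) by (simp add: field_simps)
    qed
  qed
  show ?thesis
    using AE_bad_windows[OF \<theta>(1,2) ab(2) \<theta>(3)] dev[OF \<rho>1] dev[OF \<rho>2] AE_space
  proof eventually_elim
    case (elim \<omega>)
    from elim(1-3) ev show ?case
    proof eventually_elim
      case (elim n)
      have n: "0 < n" using elim by simp
      show ?case
      proof (intro ballI allI)
        fix \<delta> x y assume \<delta>: "\<delta> \<in> {a..b}"
        obtain j where j: "j \<le> grid_card a b \<theta> n" "grid a \<theta> n j \<le> \<delta>" "\<delta> \<le> grid a \<theta> n j + \<theta> / real n"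
          using grid_cell[of a \<delta> b n \<theta>] \<delta> n \<theta>(1) by auto
        let ?u = "grid a \<theta> n j"
        have u: "?u \<in> {a..b}" using grid_bounds[OF j(1) ab(2) \<theta>(1)] by simp
        have "r * card (bad_windows ?u \<theta> n \<omega>) < n" using elim(1) j(1) by auto
        then have "real r * real (card (bad_windows ?u \<theta> n \<omega>)) \<le> real n" by (metis less_imp_le of_nat_le_iff of_nat_mult)
        then have "real (card (bad_windows ?u \<theta> n \<omega>)) \<le> real n / real r" using r0 by (simp add: pos_le_divide_eq mult.commute)
        then have "\<bar>real (pair_count \<delta> n x y \<omega>) - real (pair_count ?u n x y \<omega>)\<bar> \<le> 2 / real r * real n"
          using pair_count_near[OF j(2,3), of x y \<omega>] \<theta>(1) by simp
        also have "\<dots> \<le> \<epsilon> / 3 * real n" using rr by (rule mult_right_mono) simp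
        finally have 1: "\<bar>real (pair_count \<delta> n x y \<omega>) - real (pair_count ?u n x y \<omega>)\<bar> \<le> \<epsilon> / 3 * real n" .
        let ?m = "real n * (pmf \<mu> x * tp ?u x y)"
        have "(j, x, y) \<in> {..grid_card a b \<theta> n} \<times> (UNIV :: ('a \<times> 'a) set)" using j by auto
        from bspec[OF elim(2) this] bspec[OF elim(3) this] \<open>\<omega> \<in> space P\<close>
        have 2: "\<bar>real (pair_count ?u n x y \<omega>) - ?m\<bar> \<le> \<epsilon> / 3 * real n" by (auto simp: abs_if not_le)
        have "\<bar>tp ?u x y - tp \<delta> x y\<bar> \<le> \<epsilon> / 3"
          using j elim(4) by (intro \<eta>(2) u \<delta>) auto
        then have "\<bar>pmf \<mu> x * (tp ?u x y - tp \<delta> x y)\<bar> \<le> 1 * (\<epsilon> / 3)"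
          unfolding abs_mult by (intro mult_mono) (auto simp: pmf_le_1)
        then have "real n * \<bar>pmf \<mu> x * (tp ?u x y - tp \<delta> x y)\<bar> \<le> real n * (\<epsilon> / 3)" by (intro mult_left_mono) auto
        moreover have "?m - real n * (pmf \<mu> x * tp \<delta> x y) = real n * (pmf \<mu> x * (tp ?u x y - tp \<delta> x y))" by (simp add: algebra_simps)
        ultimately have 3: "\<bar>?m - real n * (pmf \<mu> x * tp \<delta> x y)\<bar> \<le> \<epsilon> / 3 * real n" by (simp add: abs_mult mult.commute)
        from 1 2 3 show "\<bar>real (pair_count \<delta> n x y \<omega>) - real n * (pmf \<mu> x * tp \<delta> x y)\<bar> \<le> \<epsilon> * real n" by argo
      qed
    qed
  qed
qed

text \<open>The intervals from \<open>1 / (j + 1)\<close> to \<open>j + 1\<close> and the tolerances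
  \<open>1 / (k + 1)\<close> exhaust all steps and accuracies. They are countably many, so one null
  set serves for all \<open>\<delta>\<close>.\<close>

lemma pair_count_LLN:
  "AE \<omega> in P. \<forall>\<delta>>0. \<forall>x y. (\<lambda>n. real (pair_count \<delta> n x y \<omega>) / real n) \<longlonglongrightarrow> pmf \<mu> x * tp \<delta> x y"
proof -
  have "AE \<omega> in P. \<forall>j k :: nat. \<forall>\<^sub>F n in sequentially. \<forall>\<delta>\<in>{1 / real (Suc j)..real (Suc j)}. \<forall>x y.
    \<bar>real (pair_count \<delta> n x y \<omega>) - real n * (pmf \<mu> x * tp \<delta> x y)\<bar> \<le> 1 / real (Suc k) * real n"
    unfolding AE_all_countable
  proof (intro allI pair_count_uniform)
    show "1 / real (Suc j) \<le> real (Suc j)" for j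
      by (rule order_trans[of _ 1]) auto
  qed auto
  then show ?thesis
  proof eventually_elim
    case (elim \<omega>)
    show ?case
    proof (intro allI impI)
      fix \<delta> :: real and x y assume \<delta>: "0 < \<delta>"
      obtain j :: nat where j: "max \<delta> (1 / \<delta>) < real j" using reals_Archimedean2 by blast
      then have "\<delta> \<le> real (Suc j)" "1 / \<delta> \<le> real (Suc j)" by auto
      then have d: "\<delta> \<in> {1 / real (Suc j)..real (Suc j)}" using \<delta> by (auto simp: field_simps)
      show "(\<lambda>n. real (pair_count \<delta> n x y \<omega>) / real n) \<longlonglongrightarrow> pmf \<mu> x * tp \<delta> x y"
      proof (rule tendstoI)
        fix e :: real assume "0 < e"
        then obtain k where k: "1 / real (Suc k) < e" using nat_approx_posE by auto
        have "\<forall>\<^sub>F n in sequentially. \<bar>real (pair_count \<delta> n x y \<omega>) - real n * (pmf \<mu> x * tp \<delta> x y)\<bar> \<le> 1 / real (Suc k) * real n"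
          using elim[rule_format, of j k] by (rule eventually_mono) (use d in blast)
        then show "\<forall>\<^sub>F n in sequentially. dist (real (pair_count \<delta> n x y \<omega>) / real n) (pmf \<mu> x * tp \<delta> x y) < e"
          using eventually_gt_at_top[of 0]
        proof eventually_elim
          case (elim n)
          have "real (pair_count \<delta> n x y \<omega>) / real n - pmf \<mu> x * tp \<delta> x y = (real (pair_count \<delta> n x y \<omega>) - real n * (pmf \<mu> x * tp \<delta> x y)) / real n"
            using elim(2) by (simp add: diff_divide_distrib)
          then have "dist (real (pair_count \<delta> n x y \<omega>) / real n) (pmf \<mu> x * tp \<delta> x y) = \<bar>real (pair_count \<delta> n x y \<omega>) - real n * (pmf \<mu> x * tp \<delta> x y)\<bar> / real n"
            by (simp only: dist_real_def abs_divide abs_of_nat)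
          also have "\<dots> \<le> 1 / real (Suc k)" using elim by (simp only: pos_divide_le_eq of_nat_0_less_iff)
          finally show ?case using k by simp
        qed
      qed
    qed
  qed
qed

end

section \<open>Waiting times: upper bound\<close>

lemma eventually_linear_le_exp:
  assumes "0 < \<alpha>"
  shows "\<forall>\<^sub>F n in sequentially. \<beta> * real n \<le> exp (\<alpha> * real n)"
proof -
  obtain N :: nat where N: "2 * \<bar>\<beta>\<bar> / \<alpha>\<^sup>2 < real N" using reals_Archimedean2 by blast
  show ?thesis
  proof (rule eventually_sequentiallyI[of N])
    fix n assume "N \<le> n"
    then have "2 * \<bar>\<beta>\<bar> / \<alpha>\<^sup>2 \<le> real n" using N by linarith
    then have "2 * \<bar>\<beta>\<bar> \<le> real n * \<alpha>\<^sup>2" using assms by (simp add: pos_divide_le_eq)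
    then have "\<bar>\<beta>\<bar> * real n \<le> (real n * \<alpha>\<^sup>2 / 2) * real n" by (intro mult_right_mono) auto
    also have "\<dots> = (\<alpha> * real n)\<^sup>2 / 2" by (simp add: power2_eq_square mult_ac)
    also have "\<dots> \<le> exp (\<alpha> * real n)"
    proof -
      have "0 \<le> \<alpha> * real n" using assms by simp
      then show ?thesis using exp_lower_Taylor_quadratic[of "\<alpha> * real n"] by linarith
    qed
    finally show "\<beta> * real n \<le> exp (\<alpha> * real n)"
      by (smt (verit) mult_right_mono of_nat_0_le_iff abs_ge_self)
  qed
qed

section \<open>Matches that persist for nearby steps\<close>

definition robust_match :: "real \<Rightarrow> real \<Rightarrow> nat \<Rightarrow> nat \<Rightarrow> (nat \<Rightarrow> 'a) \<Rightarrow> (real \<Rightarrow> 'a) set" where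
  "robust_match v \<tau> k n w = {\<omega> \<in> space path_space. \<forall>i\<in>{1..n}.
     \<omega> \<in> constant_on_window (real (k + i) * v) (real (k + i) * v + \<tau>) \<and> \<omega> (real (k + i) * v) = w i}"

lemma robust_match_Suc:
  "robust_match v \<tau> k (Suc n) w = robust_match v \<tau> k n w \<inter>
     ({\<omega> \<in> space path_space. \<omega> (real (k + Suc n) * v) = w (Suc n)} \<inter> constant_on_window (real (k + Suc n) * v) (real (k + Suc n) * v + \<tau>))"
  by (auto simp: robust_match_def atLeastAtMostSuc_conv simp del: of_nat_Suc add_Suc_right)

lemma robust_match_in_filtration:
  fixes w :: "nat \<Rightarrow> 'a::finite"
  assumes "0 \<le> \<tau>" "\<tau> \<le> v"
  shows "robust_match v \<tau> k n w \<in> sets (path_filtration (real (k + n) * v + \<tau>))"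
proof (induction n)
  case 0
  have "robust_match v \<tau> k 0 w = space (path_filtration (real (k + 0) * v + \<tau>))"
    by (simp add: robust_match_def)
  then show ?case by (simp only: sets.top)
next
  case (Suc n)
  have v: "0 \<le> v" using assms by simp
  have "real (k + n) * v + \<tau> \<le> real (k + Suc n) * v + \<tau>" using v by (simp add: mult_right_mono)
  then have "robust_match v \<tau> k n w \<in> sets (path_filtration (real (k + Suc n) * v + \<tau>))"
    using Suc path_filtration_mono by blast
  moreover have "0 \<le> real (k + Suc n) * v" using v by (intro mult_nonneg_nonneg) auto
  ultimately show ?case
    unfolding robust_match_Suc using assms
    by (intro sets.Int eval_eq_in_filtration constant_on_window_in_filtration) auto
qed

text \<open>The sampling time of index \<open>k + i\<close> moves by
  \<open>(k + i) * (\<delta> - v)\<close>, so the cell width \<open>d\<close> may be at most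
  \<open>\<tau> / (k + n)\<close>. With \<open>k\<close> exponentially large this dictates the size
  of the cells.\<close>

lemma robust_match_imp_match:
  assumes w: "\<omega> \<in> robust_match v \<tau> k n w" and "v \<le> \<delta>" "\<delta> \<le> v + d" "real (k + n) * d \<le> \<tau>" "0 \<le> d" and i: "i \<in> {1..n}"
  shows "\<omega> (real (k + i) * \<delta>) = w i"
proof -
  have 1: "\<omega> \<in> constant_on_window (real (k + i) * v) (real (k + i) * v + \<tau>)" "\<omega> (real (k + i) * v) = w i"
    using w i unfolding robust_match_def by auto
  have "real (k + i) * \<delta> \<le> real (k + i) * (v + d)" using assms by (intro mult_left_mono) auto
  moreover have "real (k + i) * d \<le> real (k + n) * d" using assms i by (intro mult_right_mono) auto
  moreover have "real (k + i) * v \<le> real (k + i) * \<delta>" using assms by (intro mult_left_mono) auto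
  ultimately have "real (k + i) * \<delta> \<in> {real (k + i) * v..real (k + i) * v + \<tau>}"
    using assms(4) unfolding atLeastAtMost_iff distrib_left by linarith
  with 1(1) have "\<omega> (real (k + i) * \<delta>) = \<omega> (real (k + i) * v)"
    unfolding constant_on_window_def by blast
  with 1(2) show ?thesis by (rule trans[rotated])
qed

context ctmc
begin

text \<open>Letters are numbered from 1 to \<open>n\<close>, as in \<open>waiting_time\<close>,
  which gives \<open>n - 1\<close> transitions. The first letter carries no factor: it would change
  the logarithm by a bounded amount only.\<close>

definition weight :: "real \<Rightarrow> nat \<Rightarrow> (nat \<Rightarrow> 'a) \<Rightarrow> real" where
  "weight t n w = (\<Prod>i\<in>{1..<n}. tp t (w i) (w (Suc i)))"

lemma weight_pos: "0 < t \<Longrightarrow> 0 < weight t n w"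
  by (auto simp: weight_def intro!: prod_pos tp_pos)

lemma weight_le_1: "0 \<le> t \<Longrightarrow> weight t n w \<le> 1"
  unfolding weight_def by (intro prod_le_1) (auto simp: tp_nonneg tp_le_1)

lemma weight_Suc: "weight t (Suc (Suc n)) w = weight t (Suc n) w * tp t (w (Suc n)) (w (Suc (Suc n)))"
  by (simp add: weight_def)

lemma window_after_prob:
  assumes A: "A \<in> sets (path_filtration s)" and s: "0 \<le> s" "s < t" and \<tau>: "0 \<le> \<tau>" "Lam * \<tau> \<le> 1"
    and q: "0 \<le> q" "q * prob A \<le> prob (A \<inter> {\<omega> \<in> space path_space. \<omega> t = y})"
  shows "(1 - Lam * \<tau>) * q * prob A \<le> prob (A \<inter> ({\<omega> \<in> space path_space. \<omega> t = y} \<inter> constant_on_window t (t + \<tau>)))"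
proof -
  have A': "A \<in> sets (path_filtration t)" using A path_filtration_mono[of s t] s by auto
  have "(1 - Lam * \<tau>) * (q * prob A) \<le> (1 - Lam * \<tau>) * prob (A \<inter> {\<omega> \<in> space path_space. \<omega> t = y})"
    using \<tau> q by (intro mult_left_mono) auto
  also have "\<dots> \<le> prob (A \<inter> {\<omega> \<in> space path_space. \<omega> t = y} \<inter> constant_on_window t (t + \<tau>))"
    using constant_on_window_prob[OF A', of "t + \<tau>" y] s \<tau> by simp
  finally show ?thesis by (simp add: Int_assoc mult.assoc)
qed

text \<open>A window of length \<open>\<tau>\<close> without a jump carries the letter
  \<open>w i\<close> to its end, so a time \<open>v - \<tau>\<close> remains for the transition to
  the next letter; hence the weight at \<open>v - \<tau>\<close>. The first letter is reached from
  an arbitrary past with probability at least \<open>\<kappa>\<close>, and each window costs a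
  factor \<open>1 - Lam * \<tau>\<close>.\<close>

lemma robust_match_prob:
  assumes \<tau>: "0 \<le> \<tau>" "\<tau> < v" "Lam * \<tau> \<le> 1" and A: "A \<in> sets (path_filtration (real k * v + \<tau>))"
    and \<kappa>: "0 \<le> \<kappa>" "\<And>x y. \<kappa> \<le> tp (v - \<tau>) x y"
  shows "\<kappa> * (1 - Lam * \<tau>) ^ Suc n * weight (v - \<tau>) (Suc n) w * prob A \<le> prob (A \<inter> robust_match v \<tau> k (Suc n) w)"
proof (induction n)
  case 0
  let ?s = "real k * v + \<tau>" and ?t = "real (k + Suc 0) * v"
  have s: "0 \<le> ?s" "?s < ?t" using \<tau> by (auto simp: algebra_simps)
  have t: "?t - ?s = v - \<tau>" by (simp add: algebra_simps)
  note AP = filtration_in_P[OF A]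
  have T: "{\<omega> \<in> space path_space. \<omega> ?t = w (Suc 0)} \<in> sets P" using s by (intro eval_sets) auto
  have "\<kappa> * prob A = (\<Sum>x\<in>UNIV. prob (A \<inter> {\<omega> \<in> space path_space. \<omega> ?s = x}) * \<kappa>)"
    by (subst prob_partition[OF AP s(1)]) (simp only: sum_distrib_left mult.commute)
  also have "\<dots> \<le> (\<Sum>x\<in>UNIV. prob (A \<inter> {\<omega> \<in> space path_space. \<omega> ?s = x}) * tp (?t - ?s) x (w (Suc 0)))"
    unfolding t by (intro sum_mono mult_left_mono \<kappa>) auto
  also have "\<dots> = (\<Sum>x\<in>UNIV. prob (A \<inter> {\<omega> \<in> space path_space. \<omega> ?t = w (Suc 0)} \<inter> {\<omega> \<in> space path_space. \<omega> ?s = x}))"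
  proof (intro sum.cong refl)
    fix x
    have "A \<inter> {\<omega> \<in> space path_space. \<omega> ?t = w (Suc 0)} \<inter> {\<omega> \<in> space path_space. \<omega> ?s = x} = A \<inter> {\<omega> \<in> space path_space. \<omega> ?s = x \<and> \<omega> ?t = w (Suc 0)}"
      by auto
    then show "prob (A \<inter> {\<omega> \<in> space path_space. \<omega> ?s = x}) * tp (?t - ?s) x (w (Suc 0)) = prob (A \<inter> {\<omega> \<in> space path_space. \<omega> ?t = w (Suc 0)} \<inter> {\<omega> \<in> space path_space. \<omega> ?s = x})"
      using markov[OF A s, of x "w (Suc 0)"] by (simp only:)
  qed
  also have "\<dots> = prob (A \<inter> {\<omega> \<in> space path_space. \<omega> ?t = w (Suc 0)})"
    by (intro prob_partition[symmetric] sets.Int AP T s)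
  finally have "(1 - Lam * \<tau>) * \<kappa> * prob A \<le> prob (A \<inter> ({\<omega> \<in> space path_space. \<omega> ?t = w (Suc 0)} \<inter> constant_on_window ?t (?t + \<tau>)))"
    by (intro window_after_prob[OF A s \<tau>(1,3) \<kappa>(1)])
  moreover have "A \<inter> robust_match v \<tau> k (Suc 0) w = A \<inter> ({\<omega> \<in> space path_space. \<omega> ?t = w (Suc 0)} \<inter> constant_on_window ?t (?t + \<tau>))"
    unfolding robust_match_Suc using sets.sets_into_space[OF AP] by (auto simp: robust_match_def)
  ultimately show ?case by (simp add: weight_def mult.commute)
next
  case (Suc n)
  let ?k = "k + Suc n"
  let ?s = "real ?k * v + \<tau>" and ?t = "real (k + Suc (Suc n)) * v"
  let ?A = "A \<inter> robust_match v \<tau> k (Suc n) w"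
  have v: "0 < v" using \<tau> by simp
  have s: "0 \<le> ?s" "?s < ?t" using \<tau> by (auto simp: algebra_simps intro!: add_nonneg_nonneg mult_nonneg_nonneg)
  have t: "?t - ?s = v - \<tau>" by (simp add: algebra_simps)
  have "real k * v + \<tau> \<le> ?s" using v by (simp add: mult_right_mono)
  then have "A \<in> sets (path_filtration ?s)" using A path_filtration_mono by blast
  then have A': "?A \<in> sets (path_filtration ?s)" using \<tau> by (intro sets.Int robust_match_in_filtration) auto
  have "?A = ?A \<inter> {\<omega> \<in> space path_space. \<omega> ?s = w (Suc n)}"
  proof -
    have "\<omega> ?s = w (Suc n)" if "\<omega> \<in> robust_match v \<tau> k (Suc n) w" for \<omega>
    proof -
      have w: "\<omega> \<in> constant_on_window (real ?k * v) (real ?k * v + \<tau>)" "\<omega> (real ?k * v) = w (Suc n)"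
        using that unfolding robust_match_Suc by auto
      have "?s \<in> {real ?k * v..real ?k * v + \<tau>}" using \<tau> by simp
      then have "\<omega> ?s = \<omega> (real ?k * v)" using w(1) unfolding constant_on_window_def by blast
      with w(2) show ?thesis by (rule trans[rotated])
    qed
    moreover have "robust_match v \<tau> k (Suc n) w \<subseteq> space path_space" by (auto simp: robust_match_def)
    ultimately show ?thesis by blast
  qed
  then have "prob ?A * tp (v - \<tau>) (w (Suc n)) (w (Suc (Suc n))) = prob (?A \<inter> {\<omega> \<in> space path_space. \<omega> ?s = w (Suc n) \<and> \<omega> ?t = w (Suc (Suc n))})"
    using markov[OF A' s, of "w (Suc n)" "w (Suc (Suc n))"] unfolding t by simp
  also have "\<dots> \<le> prob (?A \<inter> {\<omega> \<in> space path_space. \<omega> ?t = w (Suc (Suc n))})"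
    using s by (intro finite_measure_mono sets.Int[OF filtration_in_P[OF A']] eval_sets) auto
  finally have "(1 - Lam * \<tau>) * tp (v - \<tau>) (w (Suc n)) (w (Suc (Suc n))) * prob ?A \<le>
      prob (?A \<inter> ({\<omega> \<in> space path_space. \<omega> ?t = w (Suc (Suc n))} \<inter> constant_on_window ?t (?t + \<tau>)))"
    using \<tau> by (intro window_after_prob[OF A' s \<tau>(1,3)]) (auto simp: tp_nonneg mult.commute)
  moreover have "?A \<inter> ({\<omega> \<in> space path_space. \<omega> ?t = w (Suc (Suc n))} \<inter> constant_on_window ?t (?t + \<tau>)) = A \<inter> robust_match v \<tau> k (Suc (Suc n)) w"
    unfolding robust_match_Suc[of v \<tau> k "Suc n"] by (simp only: Int_assoc)
  moreover have "(1 - Lam * \<tau>) * tp (v - \<tau>) (w (Suc n)) (w (Suc (Suc n))) * (\<kappa> * (1 - Lam * \<tau>) ^ Suc n * weight (v - \<tau>) (Suc n) w * prob A) \<le>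
     (1 - Lam * \<tau>) * tp (v - \<tau>) (w (Suc n)) (w (Suc (Suc n))) * prob ?A"
    using Suc \<tau> by (intro mult_left_mono mult_nonneg_nonneg) (auto simp: tp_nonneg)
  ultimately show ?case unfolding weight_Suc by (simp add: mult_ac)
qed

text \<open>The trials use consecutive blocks of \<open>n\<close> samples, so each succeeds with
  probability at least \<open>q\<close> given the failure of all earlier ones. Trial
  \<open>j\<close> has starting index \<open>1 + j * n\<close>, in accordance with the condition
  \<open>k \<ge> 1\<close> in the waiting time.\<close>

lemma no_robust_match_prob:
  fixes n :: nat and w :: "nat \<Rightarrow> 'a"
  assumes \<tau>: "0 \<le> \<tau>" "\<tau> < v" "Lam * \<tau> \<le> 1" and \<kappa>: "0 \<le> \<kappa>" "\<And>x y. \<kappa> \<le> tp (v - \<tau>) x y" and n: "0 < n"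
  defines "q \<equiv> \<kappa> * (1 - Lam * \<tau>) ^ n * weight (v - \<tau>) n w"
  defines "N \<equiv> \<lambda>J. {\<omega> \<in> space path_space. \<forall>j<J. \<omega> \<notin> robust_match v \<tau> (1 + j * n) n w}"
  shows "prob (N J) \<le> exp (- q * real J)" and "N J \<in> sets P"
proof -
  have q0: "0 \<le> q" using \<tau> \<kappa> weight_pos[of "v - \<tau>" n w] by (simp add: q_def)
  have match: "q * prob A \<le> prob (A \<inter> robust_match v \<tau> k n w)" if "A \<in> sets (path_filtration (real k * v + \<tau>))" for A k
    using robust_match_prob[OF \<tau> that \<kappa>, of "n - 1" w] n by (simp add: q_def)
  have N_meas: "N J \<in> sets (path_filtration (real (1 + J * n) * v + \<tau>))" for J
  proof (induction J)
    case 0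
    have "N 0 = space (path_filtration (real (1 + 0 * n) * v + \<tau>))" by (simp add: N_def)
    then show ?case by (simp only: sets.top)
  next
    case (Suc J)
    have le: "1 + J * n + n = 1 + Suc J * n" by simp
    have "N (Suc J) = N J - robust_match v \<tau> (1 + J * n) n w" by (auto simp: N_def less_Suc_eq)
    moreover have "robust_match v \<tau> (1 + J * n) n w \<in> sets (path_filtration (real (1 + Suc J * n) * v + \<tau>))"
      using robust_match_in_filtration[of \<tau> v "1 + J * n" n w] \<tau> unfolding le by simp
    moreover have "N J \<in> sets (path_filtration (real (1 + Suc J * n) * v + \<tau>))"
    proof -
      have "real (1 + J * n) * v + \<tau> \<le> real (1 + Suc J * n) * v + \<tau>" using \<tau> by (simp add: mult_right_mono)
      then show ?thesis using Suc path_filtration_mono by blast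
    qed
    ultimately show ?case by auto
  qed
  then show "N J \<in> sets P" by (rule filtration_in_P)
  show "prob (N J) \<le> exp (- q * real J)"
  proof (induction J)
    case (Suc J)
    let ?M = "robust_match v \<tau> (1 + J * n) n w"
    have M: "?M \<in> sets P" using \<tau> by (intro filtration_in_P[OF robust_match_in_filtration]) auto
    have "N (Suc J) = N J - N J \<inter> ?M" by (auto simp: N_def less_Suc_eq)
    then have "prob (N (Suc J)) = prob (N J) - prob (N J \<inter> ?M)"
      using finite_measure_Diff[of "N J" "N J \<inter> ?M"] filtration_in_P[OF N_meas[of J]] M by simp
    also have "\<dots> \<le> (1 - q) * prob (N J)" using match[OF N_meas[of J]] by (simp add: algebra_simps)
    also have "\<dots> \<le> exp (- q) * prob (N J)" using exp_ge_add_one_self[of "- q"] by (intro mult_right_mono) auto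
    also have "\<dots> \<le> exp (- q) * exp (- q * real J)" by (intro mult_left_mono Suc) auto
    finally show ?case by (simp add: algebra_simps flip: exp_add)
  qed simp
qed

lemma weight_cong: "(\<And>i. i \<in> {1..n} \<Longrightarrow> w i = w' i) \<Longrightarrow> weight t n w = weight t n w'"
  unfolding weight_def by (intro prod.cong refl) auto

lemma robust_match_cong: "(\<And>i. i \<in> {1..n} \<Longrightarrow> w i = w' i) \<Longrightarrow> robust_match v \<tau> k n w = robust_match v \<tau> k n w'"
  unfolding robust_match_def by auto

text \<open>On each cell of exponentially small width, a match that is robust against the change of \<open>\<delta>\<close>
  fails to occur with superexponentially small probability, which beats the number of cells and words.\<close>

lemma waiting_upper:
  assumes ab: "0 < a" "a \<le> b" and \<epsilon>: "0 < \<epsilon>"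
  shows "AE \<omega> in P. \<forall>\<^sub>F n in sequentially. \<forall>\<delta>\<in>{a..b}. \<forall>w.
    \<exists>k\<ge>1. real k \<le> exp (\<epsilon> * real n) / weight \<delta> n w \<and> (\<forall>i\<in>{1..n}. w i = \<omega> (real (k + i) * \<delta>))"
proof -
  have L: "0 < Lam" using Lam_ge_1 by simp
  have cont: "continuous_on {a/2..b} (\<lambda>t. ln (tp t x y))" for x y
    using ab by (intro continuous_on_ln tp_continuous_on) (auto intro!: less_imp_neq[symmetric] tp_pos)
  obtain \<eta> where \<eta>: "\<eta> > 0" "\<And>s t x y. s \<in> {a/2..b} \<Longrightarrow> t \<in> {a/2..b} \<Longrightarrow> \<bar>s - t\<bar> < \<eta> \<Longrightarrow> \<bar>ln (tp s x y) - ln (tp t x y)\<bar> \<le> \<epsilon> / 8"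
    using uniform_continuity_family[of "a/2" b "\<lambda>x y t. ln (tp t x y)" "\<epsilon> / 8"] cont \<epsilon> by (metis divide_pos_pos zero_less_numeral)
  obtain \<kappa>' where k': "\<kappa>' > 0" "\<And>t x y. t \<in> {a/2..b} \<Longrightarrow> \<kappa>' \<le> tp t x y"
    using tp_lower_uniform[of "a/2" b] ab by auto
  define \<kappa> where "\<kappa> = min 1 \<kappa>'"
  have \<kappa>: "0 < \<kappa>" "\<kappa> \<le> 1" "\<And>t x y. t \<in> {a/2..b} \<Longrightarrow> \<kappa> \<le> tp t x y"
    using k' by (auto simp: \<kappa>_def min_le_iff_disj)
  \<comment> \<open>In this order, the four bounds keep \<open>v - \<tau>\<close> above
    \<open>a / 2\<close>, allow comparing \<open>tp\<close> at \<open>v - \<tau>\<close> and at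
    \<open>\<delta>\<close>, and make \<open>1 - Lam * \<tau>\<close> at least
    \<open>exp (- (\<epsilon> / 8))\<close> and at least \<open>1/2\<close>.\<close>
  define \<tau> where "\<tau> = Min {a / 2, \<eta> / 3, (1 - exp (- (\<epsilon> / 8))) / Lam, 1 / (2 * Lam)}"
  have e1: "exp (- (\<epsilon> / 8)) < 1" using \<epsilon> by simp
  have \<tau>: "0 < \<tau>" "\<tau> \<le> a / 2" "\<tau> \<le> \<eta> / 3" "\<tau> \<le> (1 - exp (- (\<epsilon> / 8))) / Lam" "\<tau> \<le> 1 / (2 * Lam)"
  proof -
    show "0 < \<tau>" using ab \<eta>(1) L e1 by (auto simp: \<tau>_def)
    show "\<tau> \<le> a / 2" "\<tau> \<le> \<eta> / 3" "\<tau> \<le> (1 - exp (- (\<epsilon> / 8))) / Lam" "\<tau> \<le> 1 / (2 * Lam)"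
      unfolding \<tau>_def by (intro Min_le; simp)+
  qed
  have L1: "exp (- (\<epsilon> / 8)) \<le> 1 - Lam * \<tau>" "1 / 2 \<le> 1 - Lam * \<tau>"
    using \<tau>(4,5) L by (simp_all add: field_simps)
  \<comment> \<open>The smallest possible weight of a word gives
    \<open>exp (\<epsilon> / 2 * n) / Q \<le> R ^ n\<close>, so \<open>2 * R ^ n\<close> bounds the
    number of trials on any cell.\<close>
  define R where "R = 2 * exp \<epsilon> / \<kappa>"
  have R1: "1 \<le> R" unfolding R_def using \<kappa> \<epsilon> by (simp add: field_simps) (smt (verit) exp_ge_add_one_self)
  \<comment> \<open>A match found within the trials has \<open>k + n \<le> n * (3 * R ^ n)\<close>.
    Cells have width \<open>th n / n\<close>, so inside a cell the last letter of the match moves by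
    at most \<open>\<tau>\<close>.\<close>
  define th where "th n = \<tau> / (3 * R ^ n)" for n :: nat
  have th: "0 < th n" "th n \<le> \<tau>" for n
  proof -
    have "1 \<le> R ^ n" using R1 by simp
    then have "1 \<le> 3 * R ^ n" by linarith
    then show "0 < th n" "th n \<le> \<tau>" unfolding th_def using \<tau>(1) divide_left_mono[of 1 "3 * R ^ n" \<tau>] by auto
  qed
  define Q where "Q v n w = (1 - Lam * \<tau>) ^ n * weight (v - \<tau>) n w" for v n w
  \<comment> \<open>So many trials that \<open>Q * J \<ge> exp (\<epsilon> / 2 * n)\<close>, which
    makes the probability that all fail at most
    \<open>exp (- (\<kappa> * exp (\<epsilon> / 2 * n)))\<close>.\<close>
  define J where "J v n w = nat \<lceil>exp (\<epsilon> / 2 * real n) / Q v n w\<rceil>" for v n w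
  have vb: "v - \<tau> \<in> {a/2..b}" "\<tau> < v" "v - \<tau> > 0" if "v \<in> {a..b}" for v
    using that \<tau> ab by auto
  have Q_pos: "0 < Q v n w" if "v \<in> {a..b}" for v n w
    unfolding Q_def using vb[OF that] L1 by (intro mult_pos_pos weight_pos zero_less_power) auto
  have Q_le: "Q v n w \<le> 1" if "v \<in> {a..b}" for v n w
    unfolding Q_def using vb[OF that] L1 L \<tau>(1) by (intro mult_le_one weight_le_1 power_le_one) (auto intro!: less_imp_le[OF weight_pos])
  have J_ge: "exp (\<epsilon> / 2 * real n) / Q v n w \<le> real (J v n w)" for v n w
    unfolding J_def by linarith
  have J_le: "real (J v n w) \<le> 2 * exp (\<epsilon> / 2 * real n) / Q v n w" if "v \<in> {a..b}" for v n w
  proof -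
    have "1 \<le> exp (\<epsilon> / 2 * real n)" using \<epsilon> by simp
    then have "1 \<le> exp (\<epsilon> / 2 * real n) / Q v n w"
      using Q_pos[OF that, of n w] Q_le[OF that, of n w] by (subst pos_le_divide_eq) linarith+
    then show ?thesis unfolding J_def by linarith
  qed
  have Q_ge_R: "2 * exp (\<epsilon> / 2 * real n) / Q v n w \<le> 2 * R ^ n" if v: "v \<in> {a..b}" for v n w
  proof -
    have "\<kappa> ^ n \<le> \<kappa> ^ card {1..<n}" using \<kappa> by (intro power_decreasing) auto
    also have "\<dots> = (\<Prod>i\<in>{1..<n}. \<kappa>)" by simp
    also have "\<dots> \<le> weight (v - \<tau>) n w"
      unfolding weight_def using \<kappa> vb[OF v] by (intro prod_mono) auto
    finally have "(1/2) ^ n * \<kappa> ^ n \<le> Q v n w"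
      unfolding Q_def using L1 \<kappa> by (intro mult_mono power_mono) auto
    then have "(\<kappa> / 2) ^ n \<le> Q v n w" by (simp flip: power_mult_distrib)
    then have "exp (\<epsilon> / 2 * real n) / Q v n w \<le> exp (\<epsilon> * real n) / (\<kappa> / 2) ^ n"
      using \<kappa> \<epsilon> by (intro frac_le) auto
    also have "\<dots> = R ^ n"
      unfolding R_def by (simp add: power_divide power_mult_distrib field_simps exp_of_nat_mult[symmetric])
    finally show ?thesis by simp
  qed
  \<comment> \<open>Two factors \<open>exp (- (\<epsilon> / 8)) ^ n\<close>: one for the windows,
    one for replacing \<open>tp \<delta>\<close> by \<open>tp (v - \<tau>)\<close>.\<close>
  have Q_ge_w: "1 / Q v n w \<le> exp (\<epsilon> / 4 * real n) / weight \<delta> n w"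
    if v: "v \<in> {a..b}" and \<delta>: "\<delta> \<in> {a..b}" "\<bar>\<delta> - v\<bar> \<le> \<tau>" for v \<delta> n w
  proof -
    have wpos: "0 < weight \<delta> n w" using \<delta> ab by (intro weight_pos) auto
    have "exp (- (\<epsilon> / 8)) ^ n * weight \<delta> n w \<le> (\<Prod>i\<in>{1..<n}. exp (- (\<epsilon> / 8))) * weight \<delta> n w"
      using wpos \<epsilon> by (intro mult_right_mono) (auto intro!: power_decreasing)
    also have "\<dots> = (\<Prod>i\<in>{1..<n}. exp (- (\<epsilon> / 8)) * tp \<delta> (w i) (w (Suc i)))"
      unfolding weight_def prod.distrib ..
    also have "\<dots> \<le> weight (v - \<tau>) n w"
      unfolding weight_def
    proof (intro prod_mono conjI)
      fix i
      have d: "0 < tp \<delta> (w i) (w (Suc i))" using \<delta> ab by (intro tp_pos) auto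
      then show "0 \<le> exp (- (\<epsilon> / 8)) * tp \<delta> (w i) (w (Suc i))" by simp
      have d': "0 < tp (v - \<tau>) (w i) (w (Suc i))" using vb[OF v] by (intro tp_pos) auto
      have "\<bar>ln (tp \<delta> (w i) (w (Suc i))) - ln (tp (v - \<tau>) (w i) (w (Suc i)))\<bar> \<le> \<epsilon> / 8"
      proof (rule \<eta>(2))
        have "\<bar>\<delta> - (v - \<tau>)\<bar> \<le> 2 * \<tau>" using \<delta>(2) \<tau>(1) by linarith
        then show "\<bar>\<delta> - (v - \<tau>)\<bar> < \<eta>" using \<tau>(3) \<eta>(1) by linarith
      qed (use \<delta> ab vb[OF v] in auto)
      then have "- (\<epsilon> / 8) + ln (tp \<delta> (w i) (w (Suc i))) \<le> ln (tp (v - \<tau>) (w i) (w (Suc i)))" by linarith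
      then have "exp (- (\<epsilon> / 8) + ln (tp \<delta> (w i) (w (Suc i)))) \<le> tp (v - \<tau>) (w i) (w (Suc i))"
        using d' by (metis exp_le_cancel_iff exp_ln)
      then show "exp (- (\<epsilon> / 8)) * tp \<delta> (w i) (w (Suc i)) \<le> tp (v - \<tau>) (w i) (w (Suc i))"
        unfolding exp_add exp_ln[OF d] .
    qed
    finally have "exp (- (\<epsilon> / 8)) ^ n * (exp (- (\<epsilon> / 8)) ^ n * weight \<delta> n w) \<le> Q v n w"
      unfolding Q_def using L1 wpos by (intro mult_mono power_mono) auto
    moreover have "exp (- (\<epsilon> / 8)) ^ n * (exp (- (\<epsilon> / 8)) ^ n * weight \<delta> n w) = exp (- (\<epsilon> / 4 * real n)) * weight \<delta> n w"
    proof -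
      have "exp (- (\<epsilon> / 8)) ^ n * exp (- (\<epsilon> / 8)) ^ n = exp (- (\<epsilon> / 4 * real n))"
        unfolding exp_of_nat_mult[symmetric] exp_add[symmetric] by (rule arg_cong[where f=exp]) (simp add: algebra_simps)
      then show ?thesis by (simp only: mult.assoc[symmetric])
    qed
    ultimately have "1 / Q v n w \<le> 1 / (exp (- (\<epsilon> / 4 * real n)) * weight \<delta> n w)"
      using wpos by (intro divide_left_mono) (auto intro: mult_pos_pos Q_pos[OF v])
    then show ?thesis by (simp add: exp_minus field_simps)
  qed
  \<comment> \<open>Only the letters at positions 1 to \<open>n\<close> matter. Words with exactly
    this domain form a finite set, as the union bound requires.\<close>
  define I where "I n = {..grid_card a b (th n) n} \<times> ({1..n} \<rightarrow>\<^sub>E (UNIV :: 'a set))" for n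
  define B where "B n z = {\<omega> \<in> space path_space. \<forall>j<J (grid a (th n) n (fst z)) n (snd z).
      \<omega> \<notin> robust_match (grid a (th n) n (fst z)) \<tau> (1 + j * n) n (snd z)}" for n z
  define N where "N = real (CARD('a))"
  have N1: "1 \<le> N" by (simp add: N_def Suc_le_eq finite_UNIV_card_ge_0)
  \<comment> \<open>Up to a constant \<open>S ^ n\<close> bounds the size of the index set: of order
    \<open>n * R ^ n\<close> cells, with \<open>n \<le> 2 ^ n\<close>, and \<open>N ^ n\<close>
    words.\<close>
  define S where "S = 2 * R * N"
  have S1: "1 \<le> S" unfolding S_def using R1 N1 mult_mono[of 1 R 1 N] by simp
  have g: "grid a (th n) n j \<in> {a..b}" if "j \<le> grid_card a b (th n) n" for n j
    using grid_bounds[OF that ab(2) th(1)] by simp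
  have finI: "finite (I n)" for n by (auto simp: I_def intro!: finite_PiE)
  have cardI: "real (card (I n)) \<le> (3 * (b - a) / \<tau> + 1) * S ^ n" for n
  proof -
    have "real (grid_card a b (th n) n) \<le> (b - a) / th n * real n" by (rule grid_card_le[OF ab(2) th(1)])
    also have "\<dots> = 3 * (b - a) / \<tau> * (R ^ n * real n)" by (simp add: th_def)
    also have "\<dots> \<le> 3 * (b - a) / \<tau> * (R ^ n * 2 ^ n)"
      using ab \<tau>(1) R1 less_exp[of n] by (intro mult_left_mono) (auto intro!: less_imp_le)
    finally have "real (grid_card a b (th n) n) + 1 \<le> 3 * (b - a) / \<tau> * (2 * R) ^ n + 1" by (simp add: power_mult_distrib mult_ac)
    also have "1 \<le> (2 * R) ^ n" using R1 by (intro one_le_power) simp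
    finally have "real (grid_card a b (th n) n) + 1 \<le> (3 * (b - a) / \<tau> + 1) * (2 * R) ^ n" by (simp add: algebra_simps)
    then have "(real (grid_card a b (th n) n) + 1) * N ^ n \<le> (3 * (b - a) / \<tau> + 1) * (2 * R) ^ n * N ^ n"
      using N1 by (intro mult_right_mono) auto
    moreover have "real (card (I n)) = (real (grid_card a b (th n) n) + 1) * N ^ n"
      by (simp add: I_def card_cartesian_product card_PiE N_def distrib_right)
    ultimately show ?thesis by (simp add: S_def power_mult_distrib mult_ac)
  qed
  have B_meas: "B n z \<in> sets P" if "z \<in> I n" "0 < n" for n z
    unfolding B_def using that g[of "fst z" n] vb[of "grid a (th n) n (fst z)"] \<tau> \<kappa>(1) \<kappa>(3) L1
    by (intro no_robust_match_prob(2)[where \<kappa>=\<kappa>]) (auto simp: I_def)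
  have B_prob: "prob (B n z) \<le> exp (- (\<kappa> * exp (\<epsilon> / 2 * real n)))" if z: "z \<in> I n" and n: "0 < n" for n z
  proof -
    let ?v = "grid a (th n) n (fst z)"
    have v: "?v \<in> {a..b}" using z g by (auto simp: I_def)
    have "prob (B n z) \<le> exp (- (\<kappa> * (1 - Lam * \<tau>) ^ n * weight (?v - \<tau>) n (snd z)) * real (J ?v n (snd z)))"
      unfolding B_def using n vb[OF v] \<tau> \<kappa> L1 by (intro no_robust_match_prob(1)) auto
    also have "\<dots> \<le> exp (- (\<kappa> * exp (\<epsilon> / 2 * real n)))"
    proof -
      have "exp (\<epsilon> / 2 * real n) \<le> Q ?v n (snd z) * real (J ?v n (snd z))"
        using J_ge[of n ?v "snd z"] Q_pos[OF v, of n "snd z"] by (simp add: pos_divide_le_eq mult.commute)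
      then have "\<kappa> * exp (\<epsilon> / 2 * real n) \<le> \<kappa> * (Q ?v n (snd z) * real (J ?v n (snd z)))"
        using \<kappa> by (intro mult_left_mono) auto
      then show ?thesis by (simp add: Q_def mult.assoc)
    qed
    finally show ?thesis .
  qed
  have "\<forall>\<^sub>F n in sequentially. ln (2 * S) / \<kappa> * real n \<le> exp (\<epsilon> / 2 * real n)"
    using \<epsilon> by (intro eventually_linear_le_exp) auto
  then obtain M where M: "\<And>n. n \<ge> M \<Longrightarrow> ln (2 * S) / \<kappa> * real n \<le> exp (\<epsilon> / 2 * real n)"
    by (auto simp: eventually_sequentially)
  \<comment> \<open>The index is shifted because the trials are set up for words of positive
    length.\<close>
  have AE1: "AE \<omega> in P. \<forall>\<^sub>F n in sequentially. \<forall>z\<in>I (Suc n). \<omega> \<notin> B (Suc n) z"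
  proof (rule AE_eventually_avoids[where N=M and e="\<lambda>n. (1 / (2 * S)) ^ Suc n"])
    fix n z assume n: "M \<le> n" and z: "z \<in> I (Suc n)"
    have "ln (2 * S) * real (Suc n) \<le> \<kappa> * exp (\<epsilon> / 2 * real (Suc n))"
      using M[of "Suc n"] n \<kappa>(1) by (simp add: field_simps)
    then have "exp (- (\<kappa> * exp (\<epsilon> / 2 * real (Suc n)))) \<le> exp (- (ln (2 * S) * real (Suc n)))" by simp
    also have "\<dots> = (1 / (2 * S)) ^ Suc n"
    proof -
      have "exp (- (ln (2 * S) * real (Suc n))) = exp (- ln (2 * S)) ^ Suc n"
        by (simp only: exp_of_nat_mult[symmetric] mult_minus_right mult.commute)
      then show ?thesis using S1 by (simp only: exp_minus) (simp add: inverse_eq_divide)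
    qed
    finally show "prob (B (Suc n) z) \<le> (1 / (2 * S)) ^ Suc n" using B_prob[OF z] by simp
  next
    show "summable (\<lambda>n. real (card (I (Suc n))) * (1 / (2 * S)) ^ Suc n)"
    proof (rule summable_comparison_test)
      show "\<exists>N. \<forall>n\<ge>N. norm (real (card (I (Suc n))) * (1 / (2 * S)) ^ Suc n) \<le> (3 * (b - a) / \<tau> + 1) * (1/2) ^ Suc n"
      proof (intro exI allI impI)
        fix n
        have "real (card (I (Suc n))) * (1 / (2 * S)) ^ Suc n \<le> (3 * (b - a) / \<tau> + 1) * S ^ Suc n * (1 / (2 * S)) ^ Suc n"
          using S1 by (intro mult_right_mono cardI) auto
        also have "\<dots> = (3 * (b - a) / \<tau> + 1) * (S * (1 / (2 * S))) ^ Suc n" by (simp only: power_mult_distrib mult.assoc)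
        also have "S * (1 / (2 * S)) = 1/2" using S1 by simp
        finally show "norm (real (card (I (Suc n))) * (1 / (2 * S)) ^ Suc n) \<le> (3 * (b - a) / \<tau> + 1) * (1/2) ^ Suc n"
          using S1 by (simp only: real_norm_def) (subst abs_of_nonneg, auto)
      qed
      show "summable (\<lambda>n. (3 * (b - a) / \<tau> + 1) * (1/2::real) ^ Suc n)"
        by (intro summable_mult) (auto intro!: summable_mult summable_geometric)
    qed
  qed (use finI B_meas in auto)
  \<comment> \<open>A quarter of the exponent absorbs the factor \<open>2 * n\<close> in the
    position of the match; the other parts are \<open>\<epsilon> / 2\<close> from \<open>J\<close>
    and \<open>\<epsilon> / 4\<close> from \<open>Q_ge_w\<close>.\<close>
  have ev: "\<forall>\<^sub>F n in sequentially. 2 * real n \<le> exp (\<epsilon> / 4 * real n)"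
    using \<epsilon> by (intro eventually_linear_le_exp) auto
  show ?thesis
    using AE1 AE_space
  proof eventually_elim
    case (elim \<omega>)
    from elim(1) have "\<forall>\<^sub>F n in sequentially. \<forall>z\<in>I n. \<omega> \<notin> B n z"
      using eventually_sequentially_Suc[of "\<lambda>n. \<forall>z\<in>I n. \<omega> \<notin> B n z"] by simp
    then show ?case using ev eventually_gt_at_top[of 0]
    proof eventually_elim
      case (elim n)
      note n = elim(3)
      show ?case
      proof (intro ballI allI)
        fix \<delta> and w :: "nat \<Rightarrow> 'a" assume \<delta>: "\<delta> \<in> {a..b}"
        obtain j where j: "j \<le> grid_card a b (th n) n" "grid a (th n) n j \<le> \<delta>" "\<delta> \<le> grid a (th n) n j + th n / real n"
          using grid_cell[of a \<delta> b n "th n"] \<delta> n th(1) by auto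
        let ?v = "grid a (th n) n j"
        let ?w = "restrict w {1..n}"
        have v: "?v \<in> {a..b}" by (rule g[OF j(1)])
        have "(j, ?w) \<in> I n" using j(1) by (auto simp: I_def)
        with elim(1) have "\<omega> \<notin> B n (j, ?w)" by blast
        then obtain i where i: "i < J ?v n ?w" "\<omega> \<in> robust_match ?v \<tau> (1 + i * n) n ?w"
          using \<open>\<omega> \<in> space P\<close> by (auto simp: B_def)
        let ?k = "1 + i * n"
        have rm: "\<omega> \<in> robust_match ?v \<tau> ?k n w"
          using i(2) robust_match_cong[of n ?w w] by simp
        have Jw: "J ?v n ?w = J ?v n w"
          unfolding J_def Q_def using weight_cong[of n ?w w] by simp
        have "?k \<le> J ?v n w * n"
        proof -
          have "Suc i * n \<le> J ?v n w * n" using i(1) Jw by (intro mult_le_mono1) auto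
          then show ?thesis using n by simp
        qed
        then have k1: "real ?k \<le> real n * real (J ?v n w)" by (metis of_nat_le_iff of_nat_mult mult.commute)
        also have "\<dots> \<le> real n * (2 * exp (\<epsilon> / 2 * real n) / Q ?v n w)"
          by (intro mult_left_mono J_le v) auto
        finally have k2: "real ?k \<le> real n * (2 * exp (\<epsilon> / 2 * real n) / Q ?v n w)" .
        also have "\<dots> \<le> real n * (2 * R ^ n)"
          by (intro mult_left_mono Q_ge_R v) auto
        finally have k3: "real (?k + n) \<le> real n * (3 * R ^ n)"
        proof -
          assume "real ?k \<le> real n * (2 * R ^ n)"
          moreover have "real n * 1 \<le> real n * R ^ n" using R1 by (intro mult_left_mono) auto
          ultimately show ?thesis by (simp add: algebra_simps)
        qed
        have d: "real (?k + n) * (th n / real n) \<le> \<tau>"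
        proof -
          have "real (?k + n) * (th n / real n) \<le> real n * (3 * R ^ n) * (th n / real n)"
            using th(1)[of n] by (intro mult_right_mono k3) auto
          also have "\<dots> = \<tau>" using n R1 by (simp add: th_def)
          finally show ?thesis .
        qed
        have match: "\<forall>i\<in>{1..n}. w i = \<omega> (real (?k + i) * \<delta>)"
          using robust_match_imp_match[OF rm j(2,3) d] th(1)[of n] n by (auto simp: less_imp_le)
        have "th n / real n \<le> th n" using n th(1)[of n] by (simp add: divide_le_eq)
        then have dv: "\<bar>\<delta> - ?v\<bar> \<le> \<tau>" using j(2,3) th(2)[of n] by linarith
        have "real ?k \<le> real n * (2 * exp (\<epsilon> / 2 * real n)) * (1 / Q ?v n w)" using k2 by simp
        also have "\<dots> \<le> real n * (2 * exp (\<epsilon> / 2 * real n)) * (exp (\<epsilon> / 4 * real n) / weight \<delta> n w)"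
          by (intro mult_left_mono Q_ge_w v \<delta> dv) auto
        also have "\<dots> = (2 * real n) * (exp (\<epsilon> / 2 * real n) * exp (\<epsilon> / 4 * real n) / weight \<delta> n w)" by simp
        also have "\<dots> \<le> exp (\<epsilon> / 4 * real n) * (exp (\<epsilon> / 2 * real n) * exp (\<epsilon> / 4 * real n) / weight \<delta> n w)"
          using elim(2) \<delta> ab weight_pos[of \<delta> n w] by (intro mult_right_mono) auto
        also have "\<dots> = exp (\<epsilon> * real n) / weight \<delta> n w"
        proof -
          have "exp (\<epsilon> / 4 * real n) * (exp (\<epsilon> / 2 * real n) * exp (\<epsilon> / 4 * real n)) = exp (\<epsilon> * real n)"
            unfolding exp_add[symmetric] by (simp add: field_simps)
          then show ?thesis by (simp only: times_divide_eq_right)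
        qed
        finally have "real ?k \<le> exp (\<epsilon> * real n) / weight \<delta> n w" .
        with match show "\<exists>k\<ge>1. real k \<le> exp (\<epsilon> * real n) / weight \<delta> n w \<and> (\<forall>i\<in>{1..n}. w i = \<omega> (real (k + i) * \<delta>))"
          by (intro exI[of _ ?k]) auto
      qed
    qed
  qed
qed

end

section \<open>Waiting times: lower bound\<close>

text \<open>What remains of a match between \<open>X\<close> and \<open>Y\<close> at a step \<open>\<delta>\<close> and a starting time \<open>k \<delta>\<close> when both
  are only known up to a cell: \<open>B\<close> collects the positions at which \<open>X\<close> jumps in a short
  window, and the letters are read off at the corner of the cell.\<close>

definition loose_match :: "real \<Rightarrow> real \<Rightarrow> real \<Rightarrow> nat \<Rightarrow> nat set \<Rightarrow> (nat \<Rightarrow> 'a) \<Rightarrow> (real \<Rightarrow> 'a) set" where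
  "loose_match u \<theta> s n B x = {\<omega> \<in> space path_space. \<forall>i\<in>{1..n}. i \<in> B \<or>
     \<omega> \<notin> constant_on_window (s + real i * u) (s + real i * u + 2 * \<theta>) \<or> \<omega> (s + real i * u) = x i}"

lemma loose_match_Suc:
  "loose_match u \<theta> s (Suc n) B x = (if Suc n \<in> B then loose_match u \<theta> s n B x else
     loose_match u \<theta> s n B x \<inter> ((space path_space - constant_on_window (s + real (Suc n) * u) (s + real (Suc n) * u + 2 * \<theta>)) \<union>
       {\<omega> \<in> space path_space. \<omega> (s + real (Suc n) * u) = x (Suc n)}))"
  by (auto simp: loose_match_def atLeastAtMostSuc_conv simp del: of_nat_Suc)

lemma loose_match_in_filtration:
  fixes x :: "nat \<Rightarrow> 'a::finite"
  assumes "0 \<le> \<theta>" "2 * \<theta> \<le> u" "0 \<le> s"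
  shows "loose_match u \<theta> s n B x \<in> sets (path_filtration (s + real (Suc n) * u))"
proof (induction n)
  case 0
  have "loose_match u \<theta> s 0 B x = space (path_filtration (s + real (Suc 0) * u))"
    by (simp add: loose_match_def)
  then show ?case by (simp only: sets.top)
next
  case (Suc n)
  let ?t = "s + real (Suc n) * u" and ?t' = "s + real (Suc (Suc n)) * u"
  have t: "0 \<le> ?t" "?t + 2 * \<theta> \<le> ?t'" "?t \<le> ?t'"
    using assms by (auto simp: algebra_simps intro!: add_nonneg_nonneg mult_nonneg_nonneg)
  have 1: "loose_match u \<theta> s n B x \<in> sets (path_filtration ?t')"
    using Suc path_filtration_mono[OF t(3)] by blast
  have 2: "constant_on_window ?t (?t + 2 * \<theta>) \<in> sets (path_filtration ?t' :: (real \<Rightarrow> 'a) measure)"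
    using assms t by (intro constant_on_window_in_filtration) auto
  have "space path_space - constant_on_window ?t (?t + 2 * \<theta>) \<in> sets (path_filtration ?t' :: (real \<Rightarrow> 'a) measure)"
    using sets.compl_sets[OF 2] by simp
  then show ?case
    unfolding loose_match_Suc using 1 t
    by (auto intro!: sets.Int sets.Un eval_eq_in_filtration simp del: of_nat_Suc)
qed

text \<open>The cell of \<open>k * \<delta>\<close> has width \<open>\<theta>\<close>, and
  \<open>i * \<delta>\<close> exceeds \<open>i * u\<close> by at most \<open>\<theta>\<close>, so
  \<open>(k + i) * \<delta>\<close> lies at most \<open>2 * \<theta>\<close> after
  \<open>s + i * u\<close>. When neither path jumps in its window, the equality of the letters can
  be read off at the corner.\<close>

lemma match_imp_loose_match:
  assumes "u \<le> \<delta>" "\<delta> \<le> u + \<theta> / real n" "0 < \<theta>" "0 \<le> u" "0 < n"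
    and \<omega>: "\<omega> \<in> space path_space" and m: "\<forall>i\<in>{1..n}. \<xi> (real i * \<delta>) = \<omega> (real (k + i) * \<delta>)"
  shows "\<omega> \<in> loose_match u \<theta> (real (nat \<lfloor>real k * \<delta> / \<theta>\<rfloor>) * \<theta>) n (bad_windows u \<theta> n \<xi>) (\<lambda>i. \<xi> (real i * u))"
proof -
  let ?l = "nat \<lfloor>real k * \<delta> / \<theta>\<rfloor>"
  have "0 \<le> real k * \<delta> / \<theta>" using assms by auto
  then have "real ?l = of_int \<lfloor>real k * \<delta> / \<theta>\<rfloor>" by (intro of_nat_nat) simp
  then have "real ?l \<le> real k * \<delta> / \<theta>" "real k * \<delta> / \<theta> \<le> real ?l + 1" by linarith+
  then have l: "real ?l * \<theta> \<le> real k * \<delta>" "real k * \<delta> \<le> real ?l * \<theta> + \<theta>"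
    by (simp_all only: pos_le_divide_eq[OF assms(3)] pos_divide_le_eq[OF assms(3)] distrib_right mult_1)
  show ?thesis
    unfolding loose_match_def
  proof (intro CollectI conjI ballI \<omega>)
    fix i assume i: "i \<in> {1..n}"
    let ?t = "real ?l * \<theta> + real i * u"
    show "i \<in> bad_windows u \<theta> n \<xi> \<or> \<omega> \<notin> constant_on_window ?t (?t + 2 * \<theta>) \<or> \<omega> ?t = \<xi> (real i * u)"
    proof (cases "i \<in> bad_windows u \<theta> n \<xi> \<or> \<omega> \<notin> constant_on_window ?t (?t + 2 * \<theta>)")
      case False
      then have g: "\<xi> \<in> constant_on_window (real i * u) (real i * u + \<theta>)" "\<omega> \<in> constant_on_window ?t (?t + 2 * \<theta>)"
        using i by (auto simp: bad_windows_def)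
      have 1: "\<xi> (real i * \<delta>) = \<xi> (real i * u)"
        using i assms by (intro window_constant_eq[OF g(1)]) auto
      have "real i * \<delta> \<le> real i * (u + \<theta> / real n)" using assms by (intro mult_left_mono) auto
      also have "\<dots> = real i * u + (real i / real n) * \<theta>" by (simp add: algebra_simps)
      also have "(real i / real n) * \<theta> \<le> 1 * \<theta>" using assms i by (intro mult_right_mono) auto
      finally have "real i * \<delta> \<le> real i * u + \<theta>" by simp
      moreover have "real i * u \<le> real i * \<delta>" using assms by (intro mult_left_mono) auto
      moreover have "real (k + i) * \<delta> = real k * \<delta> + real i * \<delta>" by (simp add: distrib_right)
      ultimately have "real (k + i) * \<delta> \<in> {?t..?t + 2 * \<theta>}" using l unfolding atLeastAtMost_iff by linarith
      then have "\<omega> (real (k + i) * \<delta>) = \<omega> ?t" using g(2) unfolding constant_on_window_def by blast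
      with 1 m i have "\<omega> ?t = \<xi> (real i * u)" by (metis (no_types, lifting))
      then show ?thesis by blast
    qed blast
  qed
qed

text \<open>\<open>Q\<close> may be nonmeasurable, so a null set that contains its failures is
  lifted to the product.\<close>

lemma AE_pair_fst:
  assumes "prob_space N" "AE x in M. Q x"
  shows "AE z in M \<Otimes>\<^sub>M N. Q (fst z)"
proof -
  interpret N: prob_space N by fact
  obtain N0 where N0: "{x \<in> space M. \<not> Q x} \<subseteq> N0" "emeasure M N0 = 0" "N0 \<in> sets M"
    using assms(2) by (rule AE_E)
  show ?thesis
  proof (rule AE_I)
    show "{z \<in> space (M \<Otimes>\<^sub>M N). \<not> Q (fst z)} \<subseteq> N0 \<times> space N"
      using N0(1) by (auto simp: space_pair_measure)
    show "emeasure (M \<Otimes>\<^sub>M N) (N0 \<times> space N) = 0"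
      using N0 by (simp add: N.emeasure_pair_measure_Times)
    show "N0 \<times> space N \<in> sets (M \<Otimes>\<^sub>M N)" using N0 by (intro pair_measureI) auto
  qed
qed

lemma AE_pair_snd:
  assumes "prob_space N" "AE y in N. Q y"
  shows "AE z in M \<Otimes>\<^sub>M N. Q (snd z)"
proof -
  interpret N: prob_space N by fact
  obtain N0 where N0: "{y \<in> space N. \<not> Q y} \<subseteq> N0" "emeasure N N0 = 0" "N0 \<in> sets N"
    using assms(2) by (rule AE_E)
  show ?thesis
  proof (rule AE_I)
    show "{z \<in> space (M \<Otimes>\<^sub>M N). \<not> Q (snd z)} \<subseteq> space M \<times> N0"
      using N0(1) by (auto simp: space_pair_measure)
    show "emeasure (M \<Otimes>\<^sub>M N) (space M \<times> N0) = 0"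
      using N0 by (simp add: N.emeasure_pair_measure_Times)
    show "space M \<times> N0 \<in> sets (M \<Otimes>\<^sub>M N)" using N0 by (intro pair_measureI) auto
  qed
qed

section \<open>Probability of loose matches\<close>

context ctmc
begin

text \<open>A state different from \<open>x i\<close> is only allowed after a jump in a short window, which costs a
  factor of order \<open>\<theta>\<close>, whereas a wrong transition gains at most a factor \<open>1 / \<kappa>\<close>.\<close>

lemma loose_match_prob:
  assumes \<theta>: "0 \<le> \<theta>" "2 * \<theta> \<le> u" "0 \<le> s" and u: "0 < u"
    and \<kappa>: "0 < \<kappa>" "\<And>x y. \<kappa> \<le> tp u x y"
    and K: "K = 2 / \<kappa>" and \<beta>: "\<beta> = 2 * Lam * \<theta> * K" "\<beta> \<le> 1"
  shows "prob (loose_match u \<theta> s (Suc n) B x) \<le> K * (K ^ (2 * card (B \<inter> {1..n})) * (\<Prod>i\<in>{1..n}. tp u (x i) (x (Suc i)) + \<beta>))"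
proof -
  have k1: "\<kappa> \<le> 1" using \<kappa>(2)[of undefined undefined] tp_le_1[of u undefined undefined] u by simp
  have K2: "2 \<le> K" using \<kappa> k1 by (simp add: K field_simps)
  have K\<kappa>: "K * \<kappa> = 2" using \<kappa> by (simp add: K)
  have \<beta>0: "0 \<le> \<beta>" using \<theta> K2 Lam_ge_1 by (simp add: \<beta>)
  let ?E = "\<lambda>m. loose_match u \<theta> s m B x" and ?t = "\<lambda>m. s + real (Suc m) * u"
  let ?f = "\<lambda>i. tp u (x i) (x (Suc i)) + \<beta>"
  \<comment> \<open>A bound for the event that the first \<open>m\<close> constraints hold and
    letter \<open>Suc m\<close> is right as well. Each index in \<open>B\<close> adds two factors
    \<open>K\<close>: one because nothing is known about the letter there, one to compensate the
    transition factor, as \<open>K * \<kappa> = 2\<close>.\<close>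
  define \<alpha> where "\<alpha> m = K ^ (2 * card (B \<inter> {1..m})) * (\<Prod>i\<in>{1..m}. ?f i)" for m
  have f: "\<kappa> \<le> ?f i" for i using \<kappa>(2)[of "x i" "x (Suc i)"] \<beta>0 by linarith
  have \<alpha>0: "0 \<le> \<alpha> m" for m
    unfolding \<alpha>_def using K2 f \<kappa>(1) by (intro mult_nonneg_nonneg prod_nonneg) (auto intro: order_trans[OF less_imp_le])
  have t: "0 \<le> ?t m" "?t m + 2 * \<theta> \<le> ?t (Suc m)" "?t m < ?t (Suc m)" "?t (Suc m) - ?t m = u" for m
    using \<theta> u by (auto simp: algebra_simps intro!: add_nonneg_nonneg mult_nonneg_nonneg)
  have EF: "?E m \<in> sets (path_filtration (?t m))" for m
    using \<theta> by (intro loose_match_in_filtration) auto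
  note EP = filtration_in_P[OF EF]
  \<comment> \<open>Two bounds are carried along: with the right letter at time \<open>?t m\<close>,
    where letter \<open>Suc m\<close> is read, and without it at the price of one factor
    \<open>K\<close>.\<close>
  have "prob (?E m \<inter> {\<omega> \<in> space path_space. \<omega> (?t m) = x (Suc m)}) \<le> \<alpha> m \<and> prob (?E m) \<le> K * \<alpha> m" for m
  proof (induction m)
    case 0
    then show ?case using K2 by (simp add: \<alpha>_def order_trans[OF prob_le_1])
  next
    case (Suc m)
    let ?C = "\<lambda>m. {\<omega> \<in> space path_space. \<omega> (?t m) = x (Suc m)}"
    have C: "?C m \<in> sets P" for m using t(1) by (rule eval_sets)
    show ?case
    proof (cases "Suc m \<in> B")
      case True
      have "card (B \<inter> {1..Suc m}) = Suc (card (B \<inter> {1..m}))"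
      proof -
        have "B \<inter> {1..Suc m} = insert (Suc m) (B \<inter> {1..m})" using True by auto
        then show ?thesis by simp
      qed
      then have \<alpha>S: "\<alpha> (Suc m) = (K * ?f (Suc m)) * (K * \<alpha> m)"
        by (simp add: \<alpha>_def power2_eq_square mult_ac)
      have "1 * (K * \<alpha> m) \<le> \<alpha> (Suc m)"
        unfolding \<alpha>S using K2 \<alpha>0 mult_left_mono[OF f[of "Suc m"], of K] K\<kappa> by (intro mult_right_mono) auto
      then have 1: "prob (?E m) \<le> \<alpha> (Suc m)" using Suc by simp
      have E: "?E (Suc m) = ?E m" using True by (simp add: loose_match_Suc)
      have "prob (?E m \<inter> ?C (Suc m)) \<le> prob (?E m)" by (intro finite_measure_mono EP) auto
      moreover have "1 * \<alpha> (Suc m) \<le> K * \<alpha> (Suc m)" using K2 \<alpha>0 by (intro mult_right_mono) auto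
      ultimately show ?thesis using 1 unfolding E by linarith
    next
      case False
      have "card (B \<inter> {1..Suc m}) = card (B \<inter> {1..m})"
      proof -
        have "B \<inter> {1..Suc m} = B \<inter> {1..m}" using False by (auto simp: le_Suc_eq)
        then show ?thesis by simp
      qed
      then have \<alpha>S: "\<alpha> (Suc m) = \<alpha> m * ?f (Suc m)" by (simp add: \<alpha>_def)
      let ?W = "constant_on_window (?t m) (?t m + 2 * \<theta>)"
      have E: "?E (Suc m) = ?E m \<inter> ((space path_space - ?W) \<union> ?C m)"
        using False by (simp add: loose_match_Suc)
      have W: "?W \<in> sets P" using \<theta> t(1) by (intro constant_on_window_sets) auto
      have "prob (?E m - ?W) \<le> Lam * (2 * \<theta>) * prob (?E m)"
        using nonconstant_window_prob[OF EF t(1), of m "?t m + 2 * \<theta>"] \<theta> by simp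
      also have "\<dots> \<le> Lam * (2 * \<theta>) * (K * \<alpha> m)" using Suc \<theta> Lam_ge_1 by (intro mult_left_mono) auto
      also have "\<dots> = \<beta> * \<alpha> m" by (simp add: \<beta>)
      finally have bad: "prob (?E m - ?W) \<le> \<beta> * \<alpha> m" .
      \<comment> \<open>Either letter \<open>Suc m\<close> is right and the transition to the next
        one follows, or the window contains a jump, which costs
        \<open>\<beta> * \<alpha> m\<close>.\<close>
      have "prob (?E (Suc m) \<inter> ?C (Suc m)) \<le> prob ((?E m \<inter> {\<omega> \<in> space path_space. \<omega> (?t m) = x (Suc m) \<and> \<omega> (?t (Suc m)) = x (Suc (Suc m))}) \<union> (?E m - ?W))"
      proof (rule finite_measure_mono)
        have "?E m \<inter> {\<omega> \<in> space path_space. \<omega> (?t m) = x (Suc m) \<and> \<omega> (?t (Suc m)) = x (Suc (Suc m))} = ?E m \<inter> ?C m \<inter> ?C (Suc m)" by auto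
        then show "(?E m \<inter> {\<omega> \<in> space path_space. \<omega> (?t m) = x (Suc m) \<and> \<omega> (?t (Suc m)) = x (Suc (Suc m))}) \<union> (?E m - ?W) \<in> sets P"
          using EP C W by (simp only: sets.Int sets.Un sets.Diff)
      qed (auto simp: E)
      also have "\<dots> \<le> prob (?E m \<inter> {\<omega> \<in> space path_space. \<omega> (?t m) = x (Suc m) \<and> \<omega> (?t (Suc m)) = x (Suc (Suc m))}) + prob (?E m - ?W)"
      proof (rule measure_Un_le)
        have "?E m \<inter> {\<omega> \<in> space path_space. \<omega> (?t m) = x (Suc m) \<and> \<omega> (?t (Suc m)) = x (Suc (Suc m))} = ?E m \<inter> ?C m \<inter> ?C (Suc m)" by auto
        then show "?E m \<inter> {\<omega> \<in> space path_space. \<omega> (?t m) = x (Suc m) \<and> \<omega> (?t (Suc m)) = x (Suc (Suc m))} \<in> sets P"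
          using EP C by (simp only: sets.Int)
      qed (use EP W in auto)
      also have "prob (?E m \<inter> {\<omega> \<in> space path_space. \<omega> (?t m) = x (Suc m) \<and> \<omega> (?t (Suc m)) = x (Suc (Suc m))}) =
          prob (?E m \<inter> ?C m) * tp u (x (Suc m)) (x (Suc (Suc m)))"
        using markov[OF EF t(1) t(3), of m "x (Suc m)" "x (Suc (Suc m))"] unfolding t(4) .
      also have "\<dots> \<le> \<alpha> m * tp u (x (Suc m)) (x (Suc (Suc m)))"
        using Suc u by (intro mult_right_mono) (auto simp: tp_nonneg)
      finally have 1: "prob (?E (Suc m) \<inter> ?C (Suc m)) \<le> \<alpha> (Suc m)"
        using bad by (simp add: \<alpha>S algebra_simps)
      have "prob (?E (Suc m)) \<le> prob ((?E m \<inter> ?C m) \<union> (?E m - ?W))"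
        using EP C W by (intro finite_measure_mono) (auto simp: E)
      also have "\<dots> \<le> prob (?E m \<inter> ?C m) + prob (?E m - ?W)"
        using EP C W by (intro measure_Un_le) auto
      also have "\<dots> \<le> \<alpha> m + 1 * \<alpha> m"
        using Suc bad mult_right_mono[OF \<beta>(2) \<alpha>0[of m]] by linarith
      also have "\<dots> = (K * \<kappa>) * \<alpha> m" unfolding K\<kappa> by simp
      also have "\<dots> \<le> (K * ?f (Suc m)) * \<alpha> m"
        using K2 \<alpha>0 f by (intro mult_right_mono mult_left_mono) auto
      also have "\<dots> = K * \<alpha> (Suc m)" by (simp add: \<alpha>S mult_ac)
      finally show ?thesis using 1 by blast
    qed
  qed
  then have "prob (?E n) \<le> K * \<alpha> n" by blast
  \<comment> \<open>The constraint at the last letter is dropped: \<open>Suc n\<close> letters have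
    only \<open>n\<close> transitions between them.\<close>
  moreover have "prob (?E (Suc n)) \<le> prob (?E n)"
    by (intro finite_measure_mono EP) (auto simp: loose_match_def)
  ultimately show ?thesis unfolding \<alpha>_def by linarith
qed

text \<open>There are about \<open>Z * b / \<theta>\<close> starting cells, and each loose match has
  probability at most \<open>K * (exp (\<epsilon> / 2) ^ n * weight u n x)\<close>. Since
  \<open>Z * weight u n x = exp (- \<epsilon>) ^ n\<close>, half of the exponent remains. The
  condition \<open>1 \<le> Z\<close> absorbs the cell \<open>l = 0\<close> into the count.\<close>

lemma loose_match_cell_prob:
  fixes \<xi> :: "real \<Rightarrow> 'a"
  assumes \<theta>: "0 < \<theta>" "2 * \<theta> \<le> u" and ub: "u \<le> b" and \<epsilon>: "0 < \<epsilon>"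
    and \<kappa>: "0 < \<kappa>" "\<And>x y. \<kappa> \<le> tp u x y"
    and K: "K = 2 / \<kappa>" and \<beta>: "\<beta> = 2 * Lam * \<theta> * K" "\<beta> \<le> 1" "\<beta> / \<kappa> \<le> \<epsilon> / 4" and KR: "K ^ 2 \<le> exp (\<epsilon> / 4 * real r)"
    and B: "finite B" "r * card B < n" and Z: "Z = exp (- (\<epsilon> * real n)) / weight u n x" "1 \<le> Z"
  shows "prob (\<Union>l\<in>{l. real l \<le> Z * b / \<theta>}. loose_match u \<theta> (real l * \<theta>) n B x) \<le> (b / \<theta> + 1) * K * exp (- (\<epsilon> / 2)) ^ n"
proof -
  have u: "0 < u" using \<theta> by simp
  obtain m where n: "n = Suc m" using B by (cases n) auto
  have k1: "\<kappa> \<le> 1" using \<kappa>(2)[of undefined undefined] tp_le_1[of u undefined undefined] u by simp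
  have K2: "2 \<le> K" using \<kappa> k1 by (simp add: K field_simps)
  have \<beta>0: "0 \<le> \<beta>" using \<theta> K2 Lam_ge_1 by (simp add: \<beta>)
  have w: "0 < weight u n x" using u by (rule weight_pos)
  have each: "prob (loose_match u \<theta> (real l * \<theta>) n B x) \<le> K * (exp (\<epsilon> / 2) ^ n * weight u n x)" for l
  proof -
    have "prob (loose_match u \<theta> (real l * \<theta>) (Suc m) B x) \<le> K * (K ^ (2 * card (B \<inter> {1..m})) * (\<Prod>i\<in>{1..m}. tp u (x i) (x (Suc i)) + \<beta>))"
      using \<theta> u by (intro loose_match_prob[where \<kappa>=\<kappa>] \<kappa> K \<beta>(1,2)) auto
    also have "\<dots> \<le> K * (exp (\<epsilon> / 4) ^ n * (exp (\<epsilon> / 4) ^ n * weight u n x))"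
    proof (intro mult_left_mono mult_mono)
      have "K ^ (2 * card (B \<inter> {1..m})) \<le> K ^ (2 * card B)"
        using K2 B by (intro power_increasing mult_le_mono2 card_mono) auto
      also have "\<dots> = (K ^ 2) ^ card B" by (simp add: power_mult)
      also have "\<dots> \<le> exp (\<epsilon> / 4 * real r) ^ card B" using KR by (intro power_mono) auto
      also have "\<dots> = exp (\<epsilon> / 4) ^ (r * card B)"
        by (simp add: mult_ac flip: exp_of_nat_mult)
      also have "\<dots> \<le> exp (\<epsilon> / 4) ^ n" using B \<epsilon> by (intro power_increasing) auto
      finally show "K ^ (2 * card (B \<inter> {1..m})) \<le> exp (\<epsilon> / 4) ^ n" .
      have "(\<Prod>i\<in>{1..m}. tp u (x i) (x (Suc i)) + \<beta>) \<le> (\<Prod>i\<in>{1..m}. exp (\<epsilon> / 4) * tp u (x i) (x (Suc i)))"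
      proof (intro prod_mono conjI)
        fix i
        let ?p = "tp u (x i) (x (Suc i))"
        have p: "\<kappa> \<le> ?p" by (rule \<kappa>)
        then show "0 \<le> ?p + \<beta>" using \<beta>0 \<kappa>(1) by linarith
        have "\<beta> = \<beta> / \<kappa> * \<kappa>" using \<kappa>(1) by simp
        also have "\<dots> \<le> \<epsilon> / 4 * ?p" using p \<kappa>(1) \<beta>(3) \<beta>0 \<epsilon> by (intro mult_mono) auto
        finally have "?p + \<beta> \<le> (1 + \<epsilon> / 4) * ?p" by (simp add: algebra_simps)
        also have "\<dots> \<le> exp (\<epsilon> / 4) * ?p" using p \<kappa>(1) by (intro mult_right_mono exp_ge_add_one_self) auto
        finally show "?p + \<beta> \<le> exp (\<epsilon> / 4) * ?p" .
      qed
      also have "\<dots> = exp (\<epsilon> / 4) ^ m * weight u n x"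
        unfolding prod.distrib by (simp add: weight_def n atLeastLessThanSuc_atLeastAtMost)
      also have "\<dots> \<le> exp (\<epsilon> / 4) ^ n * weight u n x"
        using w \<epsilon> by (intro mult_right_mono power_increasing) (auto simp: n)
      finally show "(\<Prod>i\<in>{1..m}. tp u (x i) (x (Suc i)) + \<beta>) \<le> exp (\<epsilon> / 4) ^ n * weight u n x" .
    qed (use K2 \<kappa> \<beta>0 in \<open>auto intro!: prod_nonneg intro: order_trans[OF less_imp_le] add_nonneg_nonneg\<close>)
    also have "exp (\<epsilon> / 4) ^ n * (exp (\<epsilon> / 4) ^ n * weight u n x) = exp (\<epsilon> / 2) ^ n * weight u n x"
      by (simp only: mult.assoc[symmetric] power_mult_distrib[symmetric] exp_add[symmetric]) simp
    finally show ?thesis unfolding n .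
  qed
  have q0: "0 \<le> Z * b / \<theta>" using Z(2) ub u \<theta> by (intro divide_nonneg_nonneg mult_nonneg_nonneg) auto
  have sub: "{l. real l \<le> Z * b / \<theta>} = {..nat \<lfloor>Z * b / \<theta>\<rfloor>}"
    using order_trans[OF of_nat_mono of_nat_floor[OF q0]] by (auto simp only: mem_Collect_eq atMost_iff le_nat_floor)
  let ?L = "{l. real l \<le> Z * b / \<theta>}"
  have finL: "finite ?L" unfolding sub by simp
  from of_nat_floor[OF q0] have cardL: "real (card ?L) \<le> Z * (b / \<theta> + 1)" unfolding sub using Z(2) by (simp add: algebra_simps)
  have "prob (\<Union>l\<in>?L. loose_match u \<theta> (real l * \<theta>) n B x) \<le> (\<Sum>l\<in>?L. prob (loose_match u \<theta> (real l * \<theta>) n B x))"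
    using finL \<theta> by (intro finite_measure_subadditive_finite) (auto intro!: filtration_in_P[OF loose_match_in_filtration, simplified])
  also have "\<dots> \<le> (\<Sum>l\<in>?L. K * (exp (\<epsilon> / 2) ^ n * weight u n x))" by (intro sum_mono each)
  also have "\<dots> = real (card ?L) * (K * (exp (\<epsilon> / 2) ^ n * weight u n x))" by simp
  also have "\<dots> \<le> Z * (b / \<theta> + 1) * (K * (exp (\<epsilon> / 2) ^ n * weight u n x))"
    using cardL K2 w by (intro mult_right_mono) auto
  also have "\<dots> = (b / \<theta> + 1) * K * (Z * weight u n x * exp (\<epsilon> / 2) ^ n)" by (simp only: mult_ac)
  also have "Z * weight u n x = exp (- \<epsilon>) ^ n" using w by (simp add: Z mult.commute flip: exp_of_nat_mult)
  also have "exp (- \<epsilon>) ^ n * exp (\<epsilon> / 2) ^ n = exp (- (\<epsilon> / 2)) ^ n"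
    by (simp only: power_mult_distrib[symmetric] exp_add[symmetric]) simp
  finally show ?thesis .
qed

text \<open>Two changes at once: the transition matrix, at cost \<open>exp (\<epsilon> / 2)\<close>
  per step, and the letters. A changed letter has a bad index and occurs in at most two transitions,
  each costing at most \<open>1 / \<kappa>\<close>; with fewer than \<open>n / r\<close> bad indices
  this is at most \<open>exp (\<epsilon> / 4) ^ n\<close>.\<close>

lemma weight_change:
  fixes \<xi> :: "real \<Rightarrow> 'a"
  assumes ud: "u \<le> \<delta>" "\<delta> \<le> u + \<theta> / real n" "0 \<le> \<theta>" "0 < u" and \<kappa>: "0 < \<kappa>" "\<kappa> \<le> 1" "\<And>x y. \<kappa> \<le> tp \<delta> x y"
    and near: "\<And>x y. \<bar>ln (tp u x y) - ln (tp \<delta> x y)\<bar> \<le> \<epsilon> / 2" and \<epsilon>: "0 < \<epsilon>"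
    and r: "(1 / \<kappa>)\<^sup>2 \<le> exp (\<epsilon> / 4 * real r)" "r * card (bad_windows u \<theta> n \<xi>) < n"
  shows "weight u n (\<lambda>i. \<xi> (real i * u)) \<le> exp (\<epsilon> * real n) * weight \<delta> n (\<lambda>i. \<xi> (real i * \<delta>))"
proof -
  let ?B = "bad_windows u \<theta> n \<xi>"
  let ?c = "\<lambda>i. (if i \<in> ?B then 1 else 0) + (if Suc i \<in> ?B then 1 else 0 :: nat)"
  have \<delta>: "0 < \<delta>" using ud by simp
  have eq: "\<xi> (real i * \<delta>) = \<xi> (real i * u)" if "i \<notin> ?B" "i \<le> n" for i
    using that window_constant_eq[of \<xi> i u \<theta> n \<delta>] ud by (auto simp: bad_windows_def)
  have w: "0 \<le> weight \<delta> n (\<lambda>i. \<xi> (real i * \<delta>))" using weight_pos[OF \<delta>] by (rule less_imp_le)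
  have k1: "1 \<le> 1 / \<kappa>" using \<kappa> by simp
  have "weight u n (\<lambda>i. \<xi> (real i * u)) \<le> (\<Prod>i\<in>{1..<n}. exp (\<epsilon> / 2) * (1 / \<kappa>) ^ ?c i * tp \<delta> (\<xi> (real i * \<delta>)) (\<xi> (real (Suc i) * \<delta>)))"
    unfolding weight_def
  proof (intro prod_mono conjI)
    fix i assume i: "i \<in> {1..<n}"
    let ?x = "\<xi> (real i * u)" and ?y = "\<xi> (real (Suc i) * u)"
    show "0 \<le> tp u ?x ?y" using ud by (intro tp_nonneg) auto
    have p: "0 < tp u ?x ?y" "0 < tp \<delta> ?x ?y" using ud \<delta> by (auto intro: tp_pos)
    have "ln (tp u ?x ?y) \<le> \<epsilon> / 2 + ln (tp \<delta> ?x ?y)" using near[of ?x ?y] by linarith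
    then have "tp u ?x ?y \<le> exp (\<epsilon> / 2 + ln (tp \<delta> ?x ?y))" using p by (metis exp_le_cancel_iff exp_ln)
    then have 1: "tp u ?x ?y \<le> exp (\<epsilon> / 2) * tp \<delta> ?x ?y" using p by (simp add: exp_add)
    have 2: "tp \<delta> ?x ?y \<le> (1 / \<kappa>) ^ ?c i * tp \<delta> (\<xi> (real i * \<delta>)) (\<xi> (real (Suc i) * \<delta>))"
    proof (cases "i \<in> ?B \<or> Suc i \<in> ?B")
      case True
      then have "(1 / \<kappa>) ^ 1 \<le> (1 / \<kappa>) ^ ?c i" using k1 by (intro power_increasing) auto
      then have "(1 / \<kappa>) * \<kappa> \<le> (1 / \<kappa>) ^ ?c i * tp \<delta> (\<xi> (real i * \<delta>)) (\<xi> (real (Suc i) * \<delta>))"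
        using \<kappa> by (intro mult_mono) auto
      then show ?thesis using \<kappa>(1) tp_le_1[of \<delta> ?x ?y] \<delta> by simp
    next
      case False
      then show ?thesis using eq[of i] eq[of "Suc i"] i by (simp del: of_nat_Suc)
    qed
    show "tp u ?x ?y \<le> exp (\<epsilon> / 2) * (1 / \<kappa>) ^ ?c i * tp \<delta> (\<xi> (real i * \<delta>)) (\<xi> (real (Suc i) * \<delta>))"
      using order_trans[OF 1 mult_left_mono[OF 2 exp_ge_zero]] by (simp only: mult.assoc)
  qed
  also have "\<dots> = exp (\<epsilon> / 2) ^ card {1..<n} * (1 / \<kappa>) ^ (\<Sum>i\<in>{1..<n}. ?c i) * weight \<delta> n (\<lambda>i. \<xi> (real i * \<delta>))"
    unfolding prod.distrib weight_def power_sum by simp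
  also have "\<dots> \<le> exp (\<epsilon> / 2) ^ n * exp (\<epsilon> / 4) ^ n * weight \<delta> n (\<lambda>i. \<xi> (real i * \<delta>))"
  proof (intro mult_right_mono mult_mono w)
    show "exp (\<epsilon> / 2) ^ card {1..<n} \<le> exp (\<epsilon> / 2) ^ n" using \<epsilon> by (intro power_increasing) auto
    have "(\<Sum>i\<in>{1..<n}. ?c i) = card {i\<in>{1..<n}. i \<in> ?B} + card {i\<in>{1..<n}. Suc i \<in> ?B}"
      by (simp add: sum.distrib sum.If_cases Int_def)
    also have "card {i\<in>{1..<n}. i \<in> ?B} \<le> card ?B" by (intro card_mono) auto
    also have "card {i\<in>{1..<n}. Suc i \<in> ?B} \<le> card ?B" by (rule card_inj_on_le[where f=Suc]) auto
    finally have "(1 / \<kappa>) ^ (\<Sum>i\<in>{1..<n}. ?c i) \<le> (1 / \<kappa>) ^ (2 * card ?B)" using k1 by (intro power_increasing) auto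
    also have "\<dots> = ((1 / \<kappa>)\<^sup>2) ^ card ?B" by (simp only: power_mult)
    also have "\<dots> \<le> exp (\<epsilon> / 4 * real r) ^ card ?B" using r by (intro power_mono) auto
    also have "\<dots> = exp (\<epsilon> / 4) ^ (r * card ?B)" by (simp add: mult_ac flip: exp_of_nat_mult)
    also have "\<dots> \<le> exp (\<epsilon> / 4) ^ n" using r(2) \<epsilon> by (intro power_increasing) auto
    finally show "(1 / \<kappa>) ^ (\<Sum>i\<in>{1..<n}. ?c i) \<le> exp (\<epsilon> / 4) ^ n" .
  qed (use k1 \<kappa>(1) in auto)
  also have "\<dots> \<le> exp (\<epsilon> * real n) * weight \<delta> n (\<lambda>i. \<xi> (real i * \<delta>))"
  proof (intro mult_right_mono w)
    have "exp (\<epsilon> / 2) ^ n * exp (\<epsilon> / 4) ^ n = exp (3 / 4 * \<epsilon> * real n)"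
      by (simp add: mult.commute flip: exp_of_nat_mult exp_add)
    also have "\<dots> \<le> exp (\<epsilon> * real n)" using \<epsilon> by (simp add: mult_right_mono)
    finally show "exp (\<epsilon> / 2) ^ n * exp (\<epsilon> / 4) ^ n \<le> exp (\<epsilon> * real n)" .
  qed
  finally show ?thesis .
qed

text \<open>The first path is fixed to begin with, so that its bad windows and its letters at the
  corners are constants in \<open>loose_match_cell_prob\<close>; Fubini comes afterwards. The rates
  of the first path may differ from those of the locale, since its law \<open>Q\<close> is
  controlled only through the frequency of its bad windows.\<close>

lemma waiting_lower:
  fixes Q :: "(real \<Rightarrow> 'a) measure"
  assumes ab: "0 < a" "a \<le> b" and \<epsilon>: "0 < \<epsilon>" and Q: "prob_space Q" "sets Q = sets path_space"
    and L': "0 < L'" and bad: "\<And>\<theta> r. 0 < \<theta> \<Longrightarrow> \<theta> \<le> a \<Longrightarrow> L' * \<theta> \<le> (1/4) ^ r \<Longrightarrow>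
      AE \<xi> in Q. \<forall>\<^sub>F n in sequentially. \<forall>j\<in>{..grid_card a b \<theta> n}. r * card (bad_windows (grid a \<theta> n j) \<theta> n \<xi>) < n"
  shows "AE z in Q \<Otimes>\<^sub>M P. \<forall>\<^sub>F n in sequentially. \<forall>\<delta>\<in>{a..b}. \<forall>k\<ge>1.
    (\<forall>i\<in>{1..n}. fst z (real i * \<delta>) = snd z (real (k + i) * \<delta>)) \<longrightarrow>
    exp (- (2 * \<epsilon> * real n)) / weight \<delta> n (\<lambda>i. fst z (real i * \<delta>)) \<le> real k"
proof -
  interpret Q: prob_space Q by fact
  interpret QP: pair_prob_space Q P by unfold_locales
  have spQ: "space Q = space path_space" using Q(2) by (rule sets_eq_imp_space_eq)
  obtain \<kappa>' where k': "\<kappa>' > 0" "\<And>t x y. t \<in> {a..b} \<Longrightarrow> \<kappa>' \<le> tp t x y"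
    using tp_lower_uniform[of a b] ab by auto
  define \<kappa> where "\<kappa> = min 1 \<kappa>'"
  have \<kappa>: "0 < \<kappa>" "\<kappa> \<le> 1" "\<And>t x y. t \<in> {a..b} \<Longrightarrow> \<kappa> \<le> tp t x y"
    using k' by (auto simp: \<kappa>_def min_le_iff_disj)
  define K where "K = 2 / \<kappa>"
  have K2: "2 \<le> K" using \<kappa> by (simp add: K_def field_simps)
  obtain r :: nat where "2 * ln K / (\<epsilon> / 4) < real r" using reals_Archimedean2 by blast
  then have "2 * ln K \<le> \<epsilon> / 4 * real r" using \<epsilon> by (simp add: field_simps)
  then have "exp (2 * ln K) \<le> exp (\<epsilon> / 4 * real r)" by simp
  moreover have "exp (2 * ln K) = K\<^sup>2" using K2 exp_of_nat_mult[of 2 "ln K"] by simp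
  ultimately have r: "K\<^sup>2 \<le> exp (\<epsilon> / 4 * real r)" by simp
  have "(1 / \<kappa>)\<^sup>2 \<le> K\<^sup>2" using \<kappa> by (intro power_mono) (auto simp: K_def divide_right_mono)
  with r have r': "(1 / \<kappa>)\<^sup>2 \<le> exp (\<epsilon> / 4 * real r)" by linarith
  have LK: "0 < 2 * Lam * K" using Lam_ge_1 K2 by simp
  define \<theta> where "\<theta> = Min {a / 2, (1/4) ^ r / L', 1 / (2 * Lam * K), \<epsilon> / 4 * \<kappa> / (2 * Lam * K)}"
  have \<theta>: "0 < \<theta>" "\<theta> \<le> a / 2" "\<theta> \<le> (1/4) ^ r / L'" "\<theta> \<le> 1 / (2 * Lam * K)" "\<theta> \<le> \<epsilon> / 4 * \<kappa> / (2 * Lam * K)"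
  proof -
    show "0 < \<theta>" using ab L' LK \<epsilon> \<kappa> by (auto simp: \<theta>_def)
    show "\<theta> \<le> a / 2" "\<theta> \<le> (1/4) ^ r / L'" "\<theta> \<le> 1 / (2 * Lam * K)" "\<theta> \<le> \<epsilon> / 4 * \<kappa> / (2 * Lam * K)"
      unfolding \<theta>_def by (intro Min_le; simp)+
  qed
  define \<beta> where "\<beta> = 2 * Lam * \<theta> * K"
  have "\<theta> * (2 * Lam * K) \<le> 1" "\<theta> * (2 * Lam * K) \<le> \<epsilon> / 4 * \<kappa>"
    using \<theta>(4,5) by (simp_all only: pos_le_divide_eq[OF LK])
  moreover have "\<theta> * (2 * Lam * K) = \<beta>" by (simp add: \<beta>_def)
  ultimately have \<beta>: "\<beta> \<le> 1" "\<beta> / \<kappa> \<le> \<epsilon> / 4" using \<kappa>(1) by (simp_all add: pos_divide_le_eq)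
  have L\<theta>: "L' * \<theta> \<le> (1/4) ^ r" using \<theta>(3) L' by (simp add: pos_le_divide_eq mult.commute)
  let ?u = "\<lambda>n j. grid a \<theta> n j"
  let ?x = "\<lambda>n j \<xi> i. \<xi> (real i * ?u n j) :: 'a"
  let ?B = "\<lambda>n j \<xi>. bad_windows (?u n j) \<theta> n \<xi>"
  let ?Z = "\<lambda>n j \<xi>. exp (- (\<epsilon> * real n)) / weight (?u n j) n (?x n j \<xi>)"
  have u: "?u n j \<in> {a..b}" if "j \<le> grid_card a b \<theta> n" for n j
    using grid_bounds[OF that ab(2) \<theta>(1)] by simp
  have u': "a \<le> ?u n j" for n j using \<theta>(1) by (simp add: grid_def)
  \<comment> \<open>\<open>G\<close> claims nothing about a path with many bad windows or with
    \<open>?Z < 1\<close>. With these premises inside, the probability bound holds for every fixed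
    \<open>\<xi>\<close>, without exceptional paths.\<close>
  define G where "G n j \<xi> \<omega> \<longleftrightarrow> (r * card (?B n j \<xi>) < n \<longrightarrow> 1 \<le> ?Z n j \<xi> \<longrightarrow>
      (\<forall>l. real l \<le> ?Z n j \<xi> * b / \<theta> \<longrightarrow> \<omega> \<notin> loose_match (?u n j) \<theta> (real l * \<theta>) n (?B n j \<xi>) (?x n j \<xi>)))" for n j \<xi> \<omega>
  have fixed: "AE \<omega> in P. \<forall>\<^sub>F n in sequentially. \<forall>j\<in>{..grid_card a b \<theta> n}. G n j \<xi> \<omega>" for \<xi>
  proof -
    define A where "A n j = (if r * card (?B n j \<xi>) < n \<and> 1 \<le> ?Z n j \<xi> then
       (\<Union>l\<in>{l. real l \<le> ?Z n j \<xi> * b / \<theta>}. loose_match (?u n j) \<theta> (real l * \<theta>) n (?B n j \<xi>) (?x n j \<xi>)) else {})" for n j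
    have "AE \<omega> in P. \<forall>\<^sub>F n in sequentially. \<forall>j\<in>{..grid_card a b \<theta> n}. \<omega> \<notin> A n j"
    proof (rule AE_eventually_avoids[where N=0])
      fix n j
      have "2 * \<theta> \<le> ?u n j" using u'[of n j] \<theta>(2) by linarith
      then have lm: "loose_match (?u n j) \<theta> (real l * \<theta>) n (?B n j \<xi>) (?x n j \<xi>) \<in> sets P" for l
        using \<theta>(1) by (intro filtration_in_P[OF loose_match_in_filtration]) auto
      show "A n j \<in> sets P" unfolding A_def using lm by (auto intro!: sets.countable_UN'')
      assume j: "j \<in> {..grid_card a b \<theta> n}"
      show "prob (A n j) \<le> (b / \<theta> + 1) * K * exp (- (\<epsilon> / 2)) ^ n"
      proof (cases "r * card (?B n j \<xi>) < n \<and> 1 \<le> ?Z n j \<xi>")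
        case True
        have uj: "?u n j \<in> {a..b}" using j u by auto
        have "prob (\<Union>l\<in>{l. real l \<le> ?Z n j \<xi> * b / \<theta>}. loose_match (?u n j) \<theta> (real l * \<theta>) n (?B n j \<xi>) (?x n j \<xi>)) \<le> (b / \<theta> + 1) * K * exp (- (\<epsilon> / 2)) ^ n"
          using True uj \<theta> \<epsilon> \<kappa>(1) \<kappa>(3)[OF uj] \<beta> r
          by (intro loose_match_cell_prob[where r=r and \<kappa>=\<kappa> and \<beta>=\<beta>]) (auto simp: K_def \<beta>_def)
        then show ?thesis using True by (simp add: A_def)
      next
        case False
        have "0 \<le> (b / \<theta> + 1) * K * exp (- (\<epsilon> / 2)) ^ n" using K2 ab \<theta>(1) by simp
        moreover have "A n j = {}" using False by (simp only: A_def if_False)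
        ultimately show ?thesis by simp
      qed
    next
      show "summable (\<lambda>n. real (card {..grid_card a b \<theta> n}) * ((b / \<theta> + 1) * K * exp (- (\<epsilon> / 2)) ^ n))"
      proof (rule summable_comparison_test[OF _ summable_linear_geometric[of "exp (- (\<epsilon> / 2))" "(b - a) / \<theta>" 1 "(b / \<theta> + 1) * K"]], intro exI allI impI)
        fix n
        have nn: "0 \<le> (b / \<theta> + 1) * K * exp (- (\<epsilon> / 2)) ^ n" using K2 ab \<theta>(1) by simp
        have "real (card {..grid_card a b \<theta> n}) \<le> (b - a) / \<theta> * real n + 1"
          using grid_card_le[OF ab(2) \<theta>(1), of n] by simp
        then have "real (card {..grid_card a b \<theta> n}) * ((b / \<theta> + 1) * K * exp (- (\<epsilon> / 2)) ^ n) \<le> ((b - a) / \<theta> * real n + 1) * ((b / \<theta> + 1) * K * exp (- (\<epsilon> / 2)) ^ n)"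
          using nn by (rule mult_right_mono)
        then show "norm (real (card {..grid_card a b \<theta> n}) * ((b / \<theta> + 1) * K * exp (- (\<epsilon> / 2)) ^ n)) \<le> ((b - a) / \<theta> * real n + 1) * ((b / \<theta> + 1) * K * exp (- (\<epsilon> / 2)) ^ n)"
          using nn by (simp only: real_norm_def) (subst abs_of_nonneg, auto intro: mult_nonneg_nonneg)
      qed (use \<epsilon> in auto)
    qed auto
    then show ?thesis
      by (rule AE_mp) (auto elim!: eventually_mono intro!: AE_I2 simp: A_def G_def)
  qed
  \<comment> \<open>Passing from almost every \<open>\<omega>\<close> for each fixed
    \<open>\<xi>\<close> to almost every pair requires that \<open>G\<close> be measurable on the
    product. The following facts assemble this.\<close>
  let ?M = "Q \<Otimes>\<^sub>M P"
  have fstM: "fst \<in> ?M \<rightarrow>\<^sub>M path_space" using measurable_fst[of Q P] measurable_cong_sets[OF refl Q(2)] by blast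
  have sndM: "snd \<in> ?M \<rightarrow>\<^sub>M path_space" using measurable_snd[of Q P] measurable_cong_sets[OF refl sets_P] by blast
  have evX: "(\<lambda>z. fst z s) \<in> ?M \<rightarrow>\<^sub>M count_space UNIV" if "0 \<le> s" for s
    using measurable_compose[OF fstM measurable_eval_path_space[OF that]] .
  have evY: "(\<lambda>z. snd z s) \<in> ?M \<rightarrow>\<^sub>M count_space UNIV" if "0 \<le> s" for s
    using measurable_compose[OF sndM measurable_eval_path_space[OF that]] .
  have eqM: "Measurable.pred ?M (\<lambda>z. snd z t = fst z s)" if "0 \<le> s" "0 \<le> t" for s t
  proof -
    have "Measurable.pred ?M (\<lambda>z. \<exists>x\<in>UNIV. fst z s = x \<and> snd z t = x)"
      using evX[OF that(1)] evY[OF that(2)] by (intro pred_intros_finite pred_intros_logic pred_eq_const1) auto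
    then show ?thesis by simp
  qed
  have wX: "(\<lambda>z. weight (?u n j) n (?x n j (fst z))) \<in> borel_measurable ?M" for n j
    unfolding weight_def
  proof (rule borel_measurable_prod)
    fix i
    have u0: "0 \<le> ?u n j" using u'[of n j] ab by simp
    have "(\<lambda>\<xi>. tp (?u n j) (\<xi> (real i * ?u n j)) (\<xi> (real (Suc i) * ?u n j))) \<in> borel_measurable (path_filtration (real (Suc i) * ?u n j))"
      using u0 by (intro measurable_pair_eval) (auto intro: mult_right_mono)
    from measurable_compose[OF fstM measurable_from_subalg[OF subalgebra_path_filtration this]]
    show "(\<lambda>z. tp (?u n j) (fst z (real i * ?u n j)) (fst z (real (Suc i) * ?u n j))) \<in> borel_measurable ?M" .
  qed
  have cardX: "Measurable.pred ?M (\<lambda>z. r * card (?B n j (fst z)) < n)" for n j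
  proof -
    have "\<theta> \<le> ?u n j" using u'[of n j] \<theta>(1,2) by linarith
    from bad_windows_sets(2)[OF less_imp_le[OF \<theta>(1)] this, of n r]
    have "{\<xi> \<in> space path_space :: (real \<Rightarrow> 'a) set. n \<le> r * card (?B n j \<xi>)} \<in> sets path_space"
      by (simp only: sets_P)
    from pred_sets2[OF this fstM] have "Measurable.pred ?M (\<lambda>z. \<not> (fst z \<in> {\<xi> \<in> space path_space :: (real \<Rightarrow> 'a) set. n \<le> r * card (?B n j \<xi>)}))"
      by (rule pred_intros_logic)
    moreover have "(\<not> (fst z \<in> {\<xi> \<in> space path_space :: (real \<Rightarrow> 'a) set. n \<le> r * card (?B n j \<xi>)})) \<longleftrightarrow> r * card (?B n j (fst z)) < n" if "z \<in> space ?M" for z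
    proof -
      have "fst z \<in> space path_space" using that unfolding space_pair_measure spQ mem_Times_iff by (rule conjunct1)
      then show ?thesis by (simp only: mem_Collect_eq not_le simp_thms)
    qed
    ultimately show ?thesis by (rule iffD1[OF measurable_cong, rotated])
  qed
  have lmM: "Measurable.pred ?M (\<lambda>z. snd z \<in> loose_match (?u n j) \<theta> (real l * \<theta>) n (?B n j (fst z)) (?x n j (fst z)))" for n j l
  proof -
    have u0: "0 \<le> ?u n j" using u'[of n j] ab by simp
    have t0: "0 \<le> real l * \<theta> + real i * ?u n j" for i :: nat using u0 \<theta>(1) by (intro add_nonneg_nonneg mult_nonneg_nonneg) auto
    have "Measurable.pred ?M (\<lambda>z. \<forall>i\<in>{1..n}. \<not> (fst z \<in> constant_on_window (real i * ?u n j) (real i * ?u n j + \<theta>)) \<or>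
       \<not> (snd z \<in> constant_on_window (real l * \<theta> + real i * ?u n j) (real l * \<theta> + real i * ?u n j + 2 * \<theta>)) \<or>
       snd z (real l * \<theta> + real i * ?u n j) = fst z (real i * ?u n j))"
    proof (intro pred_intros_finite pred_intros_logic)
      fix i
      show "Measurable.pred ?M (\<lambda>z. fst z \<in> constant_on_window (real i * ?u n j) (real i * ?u n j + \<theta>))"
        using u0 \<theta>(1) by (intro pred_sets2[OF _ fstM] path_filtration_sub[OF constant_on_window_in_filtration[OF _ _ order_refl]]) auto
      show "Measurable.pred ?M (\<lambda>z. snd z \<in> constant_on_window (real l * \<theta> + real i * ?u n j) (real l * \<theta> + real i * ?u n j + 2 * \<theta>))"
        using t0 \<theta>(1) by (intro pred_sets2[OF _ sndM] path_filtration_sub[OF constant_on_window_in_filtration[OF _ _ order_refl]]) auto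
      show "Measurable.pred ?M (\<lambda>z. snd z (real l * \<theta> + real i * ?u n j) = fst z (real i * ?u n j))"
        using t0 u0 by (intro eqM) auto
    qed auto
    moreover have "(\<forall>i\<in>{1..n}. \<not> (fst z \<in> constant_on_window (real i * ?u n j) (real i * ?u n j + \<theta>)) \<or>
       \<not> (snd z \<in> constant_on_window (real l * \<theta> + real i * ?u n j) (real l * \<theta> + real i * ?u n j + 2 * \<theta>)) \<or>
       snd z (real l * \<theta> + real i * ?u n j) = fst z (real i * ?u n j)) \<longleftrightarrow>
       snd z \<in> loose_match (?u n j) \<theta> (real l * \<theta>) n (?B n j (fst z)) (?x n j (fst z))" if "z \<in> space ?M" for z
    proof -
      have "snd z \<in> space path_space" using that by (auto simp: space_pair_measure)
      then show ?thesis by (auto simp: loose_match_def bad_windows_def)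
    qed
    ultimately show ?thesis by (rule iffD1[OF measurable_cong, rotated])
  qed
  have GM: "Measurable.pred ?M (\<lambda>z. G n j (fst z) (snd z))" for n j
  proof -
    have le: "Measurable.pred ?M (\<lambda>z. f z \<le> g z)" if "f \<in> borel_measurable ?M" "g \<in> borel_measurable ?M" for f g :: "_ \<Rightarrow> real"
      using that by measurable
    show ?thesis
      unfolding G_def
      by (intro pred_intros_logic pred_intros_countable cardX lmM le borel_measurable_const
          borel_measurable_divide borel_measurable_times wX)
  qed
  have "Measurable.pred ?M (\<lambda>z. \<forall>\<^sub>F n in sequentially. \<forall>j\<in>{..grid_card a b \<theta> n}. G n j (fst z) (snd z))"
    unfolding eventually_sequentially by (intro pred_intros_countable pred_intros_logic pred_intros_finite GM) auto
  then have HM: "{z \<in> space ?M. \<forall>\<^sub>F n in sequentially. \<forall>j\<in>{..grid_card a b \<theta> n}. G n j (fst z) (snd z)} \<in> sets ?M"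
    by (simp add: pred_def)
  have H: "AE z in ?M. \<forall>\<^sub>F n in sequentially. \<forall>j\<in>{..grid_card a b \<theta> n}. G n j (fst z) (snd z)"
    by (rule QP.AE_pair_measure[OF HM]) (use fixed in simp)
  have "\<theta> \<le> a" using \<theta>(1,2) by linarith
  from AE_pair_fst[OF prob_space_axioms bad[OF \<theta>(1) this L\<theta>]]
  have bz: "AE z in ?M. \<forall>\<^sub>F n in sequentially. \<forall>j\<in>{..grid_card a b \<theta> n}. r * card (?B n j (fst z)) < n" .
  have cont: "continuous_on {a..b} (\<lambda>t. ln (tp t x y))" for x y
    using ab by (intro continuous_on_ln tp_continuous_on) (auto intro!: less_imp_neq[symmetric] tp_pos)
  obtain \<eta> where \<eta>: "\<eta> > 0" "\<And>s t x y. s \<in> {a..b} \<Longrightarrow> t \<in> {a..b} \<Longrightarrow> \<bar>s - t\<bar> < \<eta> \<Longrightarrow> \<bar>ln (tp s x y) - ln (tp t x y)\<bar> \<le> \<epsilon> / 2"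
    using uniform_continuity_family[of a b "\<lambda>x y t. ln (tp t x y)" "\<epsilon> / 2"] cont \<epsilon> by (metis divide_pos_pos zero_less_numeral)
  have ev: "\<forall>\<^sub>F n in sequentially. \<theta> / real n < \<eta> \<and> 0 < n"
  proof -
    obtain N :: nat where N: "\<theta> / \<eta> < real N" using reals_Archimedean2 by blast
    show ?thesis
    proof (rule eventually_sequentiallyI[of "Suc N"])
      fix n assume n: "Suc N \<le> n"
      then have "\<theta> / \<eta> < real n" using N by linarith
      then show "\<theta> / real n < \<eta> \<and> 0 < n" using n \<eta>(1) by (simp add: field_simps)
    qed
  qed
  show ?thesis
    using H bz AE_space
  proof eventually_elim
    case (elim z)
    then have sz: "snd z \<in> space path_space" by (auto simp: space_pair_measure)
    from elim(1,2) ev show ?case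
    proof eventually_elim
      case (elim n)
      show ?case
      proof (intro ballI allI impI, rule ccontr)
        \<comment> \<open>A match that starts too early is a loose match in one of the excluded
          starting cells. One \<open>\<epsilon>\<close> of the exponent is the margin in
          \<open>?Z\<close>, the other pays for \<open>weight_change\<close>.\<close>
        fix \<delta> and k :: nat assume \<delta>: "\<delta> \<in> {a..b}" and k: "1 \<le> k"
          and m: "\<forall>i\<in>{1..n}. fst z (real i * \<delta>) = snd z (real (k + i) * \<delta>)"
          and "\<not> exp (- (2 * \<epsilon> * real n)) / weight \<delta> n (\<lambda>i. fst z (real i * \<delta>)) \<le> real k"
        then have klt: "real k < exp (- (2 * \<epsilon> * real n)) / weight \<delta> n (\<lambda>i. fst z (real i * \<delta>))" by simp
        obtain j where j: "j \<le> grid_card a b \<theta> n" "?u n j \<le> \<delta>" "\<delta> \<le> ?u n j + \<theta> / real n"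
          using grid_cell[of a \<delta> b n \<theta>] \<delta> elim(3) \<theta>(1) by auto
        have uj: "?u n j \<in> {a..b}" by (rule u[OF j(1)])
        have bj: "r * card (?B n j (fst z)) < n" using elim(2) j(1) by auto
        have d0: "0 < \<delta>" using \<delta> ab by auto
        have wpos: "0 < weight (?u n j) n (?x n j (fst z))" "0 < weight \<delta> n (\<lambda>i. fst z (real i * \<delta>))"
          using uj ab d0 by (auto intro!: weight_pos)
        have "weight (?u n j) n (?x n j (fst z)) \<le> exp (\<epsilon> * real n) * weight \<delta> n (\<lambda>i. fst z (real i * \<delta>))"
        proof (rule weight_change[OF j(2,3) _ _ \<kappa>(1,2) \<kappa>(3)[OF \<delta>] _ \<epsilon> r' bj])
          show "\<bar>ln (tp (?u n j) x y) - ln (tp \<delta> x y)\<bar> \<le> \<epsilon> / 2" for x y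
            using j elim(3) by (intro \<eta>(2) uj \<delta>) auto
        qed (use \<theta>(1) uj ab in auto)
        then have "exp (- (\<epsilon> * real n)) / (exp (\<epsilon> * real n) * weight \<delta> n (\<lambda>i. fst z (real i * \<delta>))) \<le> ?Z n j (fst z)"
          using wpos by (intro divide_left_mono) auto
        moreover have "exp (- (\<epsilon> * real n)) / (exp (\<epsilon> * real n) * weight \<delta> n (\<lambda>i. fst z (real i * \<delta>))) = exp (- (2 * \<epsilon> * real n)) / weight \<delta> n (\<lambda>i. fst z (real i * \<delta>))"
        proof -
          have "exp (- (2 * \<epsilon> * real n)) = exp (- (\<epsilon> * real n)) / exp (\<epsilon> * real n)"
            unfolding exp_diff[symmetric] by (simp add: algebra_simps)
          then show ?thesis by simp
        qed
        ultimately have kZ: "real k \<le> ?Z n j (fst z)" using klt by linarith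
        then have Z1: "1 \<le> ?Z n j (fst z)" using k by (intro order_trans[OF _ kZ]) simp
        let ?l = "nat \<lfloor>real k * \<delta> / \<theta>\<rfloor>"
        have "real ?l \<le> real k * \<delta> / \<theta>" using d0 \<theta>(1) by (intro of_nat_floor) auto
        also have "\<dots> \<le> ?Z n j (fst z) * b / \<theta>"
          using kZ \<delta> d0 \<theta>(1) Z1 by (intro divide_right_mono mult_mono) auto
        finally have l: "real ?l \<le> ?Z n j (fst z) * b / \<theta>" .
        have "snd z \<in> loose_match (?u n j) \<theta> (real ?l * \<theta>) n (?B n j (fst z)) (?x n j (fst z))"
          using uj ab elim(3) by (intro match_imp_loose_match[OF j(2,3) \<theta>(1) _ _ sz m]) auto
        moreover have "G n j (fst z) (snd z)" using elim(1) j(1) by auto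
        ultimately show False using bj Z1 l unfolding G_def by blast
      qed
    qed
  qed
qed

end

section \<open>Relative entropy on path space\<close>

text \<open>Letters are numbered from 0 here, because the initial state takes part in the law of the
  skeleton.\<close>

definition words :: "nat \<Rightarrow> (nat \<Rightarrow> 'a) set" where
  "words N = {..N} \<rightarrow>\<^sub>E UNIV"

definition depends_upto :: "nat \<Rightarrow> ((nat \<Rightarrow> 'a) \<Rightarrow> 'b) \<Rightarrow> bool" where
  "depends_upto N g \<longleftrightarrow> (\<forall>w w'. (\<forall>i\<le>N. w i = w' i) \<longrightarrow> g w = g w')"

lemma finite_words [simp]: "finite (words N :: (nat \<Rightarrow> 'a::finite) set)"
  by (simp add: words_def finite_PiE)

lemma depends_upto_mult:
  "depends_upto N g \<Longrightarrow> depends_upto N h \<Longrightarrow> depends_upto N (\<lambda>w. g w * h w :: real)"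
  unfolding depends_upto_def by metis

text \<open>Over a finite state space a function of finitely many letters is a finite sum of
  indicators, so its integrability is automatic and its integral is a sum over words.\<close>

lemma skeleton_expand:
  fixes g :: "(nat \<Rightarrow> 'a::finite) \<Rightarrow> real"
  assumes "depends_upto N g"
  shows "g v = (\<Sum>w\<in>words N. g w * (if \<forall>i\<le>N. v i = w i then 1 else 0))"
proof -
  let ?v = "restrict v {..N}"
  have v: "?v \<in> words N" by (auto simp: words_def)
  have "(\<Sum>w\<in>words N. g w * (if \<forall>i\<le>N. v i = w i then 1 else 0)) = (\<Sum>w\<in>{?v}. g w * (if \<forall>i\<le>N. v i = w i then 1 else 0))"
  proof (rule sum.mono_neutral_right)
    show "\<forall>w\<in>words N - {?v}. g w * (if \<forall>i\<le>N. v i = w i then 1 else 0) = 0"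
    proof
      fix w assume w: "w \<in> words N - {?v}"
      have "\<not> (\<forall>i\<le>N. v i = w i)"
      proof
        assume "\<forall>i\<le>N. v i = w i"
        then have "w = ?v" using w by (auto simp: words_def PiE_def extensional_def fun_eq_iff)
        with w show False by simp
      qed
      then show "g w * (if \<forall>i\<le>N. v i = w i then 1 else 0) = 0" by (simp only: if_False mult_zero_right)
    qed
  qed (use v in auto)
  also have "\<dots> = g ?v" by simp
  also have "g ?v = g v" using assms by (auto simp: depends_upto_def)
  finally show ?thesis by simp
qed

text \<open>By monotone convergence the sum of the absolute values has a finite integral, hence is
  finite almost everywhere.\<close>

lemma AE_summable_of_integrals:
  fixes f :: "nat \<Rightarrow> 'x \<Rightarrow> real"
  assumes f: "\<And>j. integrable M (f j)" and s: "summable (\<lambda>j. \<integral>x. \<bar>f j x\<bar> \<partial>M)"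
  shows "AE x in M. summable (\<lambda>j. \<bar>f j x\<bar>)"
proof -
  note [measurable] = borel_measurable_integrable[OF f]
  have "(\<integral>\<^sup>+x. (\<Sum>j. ennreal \<bar>f j x\<bar>) \<partial>M) = (\<Sum>j. \<integral>\<^sup>+x. ennreal \<bar>f j x\<bar> \<partial>M)"
    by (rule nn_integral_suminf) measurable
  also have "\<dots> = (\<Sum>j. ennreal (\<integral>x. \<bar>f j x\<bar> \<partial>M))"
    using f by (intro suminf_cong nn_integral_eq_integral) auto
  also have "\<dots> < \<infinity>" using s by (subst suminf_ennreal2) auto
  finally have "(\<integral>\<^sup>+x. (\<Sum>j. ennreal \<bar>f j x\<bar>) \<partial>M) \<noteq> \<infinity>" by simp
  then have "AE x in M. (\<Sum>j. ennreal \<bar>f j x\<bar>) \<noteq> \<infinity>"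
    by (intro nn_integral_PInf_AE) measurable
  then show ?thesis
    by eventually_elim (auto intro: summable_suminf_not_top)
qed

lemma (in prob_space)
  assumes A: "A \<in> events"
  shows integrable_scaled_indicator: "integrable M (\<lambda>x. b * indicator A x :: real)"
    and integral_scaled_indicator: "(\<integral>x. b * indicator A x \<partial>M) = b * prob A"
proof -
  have "integrable M (indicator A :: _ \<Rightarrow> real)"
    using A by (rule integrable_real_indicator) (simp add: emeasure_eq_measure)
  then show "integrable M (\<lambda>x. b * indicator A x :: real)"
    by (rule integrable_mult_right)
  have "(\<integral>x. b * indicator A x \<partial>M) = b * (\<integral>x. indicator A x \<partial>M)"
    by (rule integral_mult_right_zero)
  also have "(\<integral>x. indicator A x \<partial>M) = prob (A \<inter> space M)"
    by (rule Bochner_Integration.integral_indicator)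
  also have "A \<inter> space M = A" using sets.sets_into_space[OF A] by auto
  finally show "(\<integral>x. b * indicator A x \<partial>M) = b * prob A" .
qed

context ctmc
begin

lemma word_event_sets: "0 < h \<Longrightarrow> {\<omega> \<in> space path_space. \<forall>i\<le>N. \<omega> (real i * h) = w i} \<in> sets P"
proof -
  assume h: "0 < h"
  have "{\<omega> \<in> space path_space. \<forall>i\<le>N. \<omega> (real i * h) = w i} = (\<Inter>i\<in>{..N}. {\<omega> \<in> space path_space. \<omega> (real i * h) = w i})"
    by auto
  then show ?thesis using h by (simp only:) (intro sets.finite_INT eval_sets, auto)
qed

definition word_prob :: "real \<Rightarrow> nat \<Rightarrow> (nat \<Rightarrow> 'a) \<Rightarrow> real" where
  "word_prob h N w = pmf \<mu> (w 0) * (\<Prod>i<N. tp h (w i) (w (Suc i)))"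

lemma prob_word: "0 < h \<Longrightarrow> prob {\<omega> \<in> space path_space. \<forall>i\<le>N. \<omega> (real i * h) = w i} = word_prob h N w"
  using fdd[of "\<lambda>i. real i * h" N w] by (simp add: word_prob_def algebra_simps)

lemma skeleton_integral:
  assumes h: "0 < h" and g: "depends_upto N g"
  shows "integrable P (\<lambda>\<omega>. g (\<lambda>i. \<omega> (real i * h)))"
    and "(\<integral>\<omega>. g (\<lambda>i. \<omega> (real i * h)) \<partial>P) = (\<Sum>w\<in>words N. g w * word_prob h N w)"
proof -
  let ?A = "\<lambda>w. {\<omega> \<in> space path_space. \<forall>i\<le>N. \<omega> (real i * h) = w i}"
  let ?f = "\<lambda>\<omega>. \<Sum>w\<in>words N. g w * indicator (?A w) \<omega>"
  have eq: "g (\<lambda>i. \<omega> (real i * h)) = ?f \<omega>" if "\<omega> \<in> space P" for \<omega>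
    unfolding skeleton_expand[OF g, of "\<lambda>i. \<omega> (real i * h)"] using that
    by (intro sum.cong refl) (simp add: indicator_def)
  have i: "integrable P (\<lambda>\<omega>. g w * indicator (?A w) \<omega>)" for w
    by (rule integrable_scaled_indicator[OF word_event_sets[OF h]])
  have "integrable P ?f" by (rule Bochner_Integration.integrable_sum) (rule i)
  moreover have "integrable P (\<lambda>\<omega>. g (\<lambda>i. \<omega> (real i * h))) = integrable P ?f"
    by (intro Bochner_Integration.integrable_cong refl eq)
  ultimately show "integrable P (\<lambda>\<omega>. g (\<lambda>i. \<omega> (real i * h)))" by (simp only:)
  have "(\<integral>\<omega>. g (\<lambda>i. \<omega> (real i * h)) \<partial>P) = (\<integral>\<omega>. ?f \<omega> \<partial>P)"
    by (intro Bochner_Integration.integral_cong refl eq)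
  also have "\<dots> = (\<Sum>w\<in>words N. \<integral>\<omega>. g w * indicator (?A w) \<omega> \<partial>P)"
    by (rule Bochner_Integration.integral_sum) (rule i)
  also have "\<dots> = (\<Sum>w\<in>words N. g w * word_prob h N w)"
  proof (intro sum.cong refl)
    fix w
    show "(\<integral>\<omega>. g w * indicator (?A w) \<omega> \<partial>P) = g w * word_prob h N w"
      unfolding integral_scaled_indicator[OF word_event_sets[OF h]] prob_word[OF h] ..
  qed
  finally show "(\<integral>\<omega>. g (\<lambda>i. \<omega> (real i * h)) \<partial>P) = (\<Sum>w\<in>words N. g w * word_prob h N w)" .
qed

lemma pair_integral:
  assumes h: "0 < h"
  shows "integrable P (\<lambda>\<omega>. f (\<omega> (real i * h)) (\<omega> (real (Suc i) * h)) :: real)"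
    and "(\<integral>\<omega>. f (\<omega> (real i * h)) (\<omega> (real (Suc i) * h)) \<partial>P) = (\<Sum>x\<in>UNIV. \<Sum>y\<in>UNIV. pmf \<mu> x * tp h x y * f x y)"
proof -
  let ?s = "real i * h" and ?t = "real (Suc i) * h"
  let ?A = "\<lambda>x y. {\<omega> \<in> space path_space. \<omega> ?s = x \<and> \<omega> ?t = y}"
  have st: "0 \<le> ?s" "?s < ?t" "?t - ?s = h" using h by (auto simp: algebra_simps)
  have A: "?A x y \<in> sets P" for x y
  proof -
    have "?A x y = {\<omega> \<in> space path_space. \<omega> ?s = x} \<inter> {\<omega> \<in> space path_space. \<omega> ?t = y}" by auto
    then show ?thesis using eval_sets[of ?s x] eval_sets[of ?t y] st by (simp only: sets.Int)
  qed
  let ?f = "\<lambda>\<omega>. \<Sum>x\<in>UNIV. \<Sum>y\<in>UNIV. f x y * indicator (?A x y) \<omega>"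
  have eq: "f (\<omega> ?s) (\<omega> ?t) = ?f \<omega>" if "\<omega> \<in> space P" for \<omega>
  proof -
    have ind: "f x y * indicator (?A x y) \<omega> = (if \<omega> ?s = x then 1 else 0) * (if \<omega> ?t = y then f x y else 0)" for x y
      using that by (simp add: indicator_def)
    have "(\<Sum>y\<in>UNIV. f x y * indicator (?A x y) \<omega>) = (if \<omega> ?s = x then f x (\<omega> ?t) else 0)" for x
      unfolding ind by (cases "\<omega> ?s = x") simp_all
    then show ?thesis by simp
  qed
  have i: "integrable P (\<lambda>\<omega>. f x y * indicator (?A x y) \<omega>)" for x y
    by (rule integrable_scaled_indicator[OF A])
  have i': "integrable P (\<lambda>\<omega>. \<Sum>y\<in>UNIV. f x y * indicator (?A x y) \<omega>)" for x
    by (rule Bochner_Integration.integrable_sum) (rule i)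
  have If: "integrable P ?f" by (rule Bochner_Integration.integrable_sum) (rule i')
  moreover have "integrable P (\<lambda>\<omega>. f (\<omega> ?s) (\<omega> ?t)) = integrable P ?f"
    by (intro Bochner_Integration.integrable_cong refl eq)
  ultimately show "integrable P (\<lambda>\<omega>. f (\<omega> ?s) (\<omega> ?t))" by (simp only:)
  have "(\<integral>\<omega>. f (\<omega> ?s) (\<omega> ?t) \<partial>P) = (\<integral>\<omega>. ?f \<omega> \<partial>P)"
    by (intro Bochner_Integration.integral_cong refl eq)
  also have "\<dots> = (\<Sum>x\<in>UNIV. \<Sum>y\<in>UNIV. \<integral>\<omega>. f x y * indicator (?A x y) \<omega> \<partial>P)"
    unfolding Bochner_Integration.integral_sum[OF i'] Bochner_Integration.integral_sum[OF i] ..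
  also have "\<dots> = (\<Sum>x\<in>UNIV. \<Sum>y\<in>UNIV. pmf \<mu> x * tp h x y * f x y)"
  proof (intro sum.cong refl)
    fix x y
    have "(\<integral>\<omega>. f x y * indicator (?A x y) \<omega> \<partial>P) = f x y * prob (?A x y)"
      by (rule integral_scaled_indicator[OF A])
    also have "prob (?A x y) = pmf \<mu> x * tp h x y"
      using markov_one[OF st(1,2), of x y] prob_eval[OF st(1), of x] st(3) by simp
    finally show "(\<integral>\<omega>. f x y * indicator (?A x y) \<omega> \<partial>P) = pmf \<mu> x * tp h x y * f x y" by simp
  qed
  finally show "(\<integral>\<omega>. f (\<omega> ?s) (\<omega> ?t) \<partial>P) = (\<Sum>x\<in>UNIV. \<Sum>y\<in>UNIV. pmf \<mu> x * tp h x y * f x y)" .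
qed

end

text \<open>Times are rounded up to the dyadic grid, so they approach \<open>s\<close> from the
  right, where the path is continuous. This recovers cylinders at arbitrary times from dyadic
  skeletons.\<close>

lemma skeleton_cylinder_tendsto:
  fixes a :: "real \<Rightarrow> 'a"
  assumes \<omega>: "\<omega> \<in> space path_space" and I: "finite I" "I \<subseteq> {0..t}" and t: "0 < t"
  shows "(\<lambda>k. if \<forall>s\<in>I. \<omega> (real (nat \<lceil>s * 2 ^ k / t\<rceil>) * (t / 2 ^ k)) = a s then 1 else 0 :: real) \<longlonglongrightarrow> indicator (cyl I a) \<omega>"
proof -
  have near: "s \<le> real (nat \<lceil>s * 2 ^ k / t\<rceil>) * (t / 2 ^ k) \<and> real (nat \<lceil>s * 2 ^ k / t\<rceil>) * (t / 2 ^ k) < s + t / 2 ^ k" if "0 \<le> s" for s k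
  proof -
    let ?h = "t / 2 ^ k"
    have h: "0 < ?h" using t by simp
    have q: "s * 2 ^ k / t = s / ?h" by simp
    have "0 \<le> s / ?h" using that h by (intro divide_nonneg_pos)
    then have "real (nat \<lceil>s / ?h\<rceil>) = of_int \<lceil>s / ?h\<rceil>" by (intro of_nat_nat) simp
    then have "s / ?h \<le> real (nat \<lceil>s / ?h\<rceil>)" "real (nat \<lceil>s / ?h\<rceil>) < s / ?h + 1" by linarith+
    then have "s \<le> real (nat \<lceil>s / ?h\<rceil>) * ?h" "real (nat \<lceil>s / ?h\<rceil>) * ?h < (s / ?h + 1) * ?h"
      by (simp_all only: pos_divide_le_eq[OF h] mult_strict_right_mono[OF _ h])
    moreover have "(s / ?h + 1) * ?h = s + ?h" using h by (simp only: distrib_right mult_1) (use t in simp)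
    ultimately show ?thesis unfolding q by simp
  qed
  have "\<forall>\<^sub>F k in sequentially. \<omega> (real (nat \<lceil>s * 2 ^ k / t\<rceil>) * (t / 2 ^ k)) = \<omega> s" if s: "s \<in> I" for s
  proof -
    have s0: "0 \<le> s" using s I by auto
    have "\<forall>\<^sub>F q in at_right s. \<omega> q = \<omega> s" using \<omega> s0 by (auto simp: space_path_space cadlag_def)
    then obtain b where b: "b > s" "\<And>q. s < q \<Longrightarrow> q < b \<Longrightarrow> \<omega> q = \<omega> s"
      by (auto simp: eventually_at_right_field)
    have "(\<lambda>k. t * (1 / 2) ^ k) \<longlonglongrightarrow> t * 0" by (intro tendsto_mult tendsto_const LIMSEQ_power_zero) simp
    then have "(\<lambda>k. t / 2 ^ k) \<longlonglongrightarrow> 0" by (simp add: power_one_over)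
    then have "\<forall>\<^sub>F k in sequentially. t / 2 ^ k < b - s" using b(1) by (intro order_tendstoD) auto
    then show ?thesis
    proof eventually_elim
      case (elim k)
      let ?q = "real (nat \<lceil>s * 2 ^ k / t\<rceil>) * (t / 2 ^ k)"
      have "s \<le> ?q" "?q < b" using near[OF s0, of k] elim by linarith+
      then show ?case using b(2)[of ?q] by (cases "?q = s") auto
    qed
  qed
  then have "\<forall>\<^sub>F k in sequentially. \<forall>s\<in>I. \<omega> (real (nat \<lceil>s * 2 ^ k / t\<rceil>) * (t / 2 ^ k)) = \<omega> s"
    using I(1) by (intro eventually_ball_finite) auto
  then have "\<forall>\<^sub>F k in sequentially. (if \<forall>s\<in>I. \<omega> (real (nat \<lceil>s * 2 ^ k / t\<rceil>) * (t / 2 ^ k)) = a s then 1 else 0 :: real) = indicator (cyl I a) \<omega>"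
    by eventually_elim (use \<omega> in \<open>auto simp: cyl_def indicator_def\<close>)
  then show ?thesis by (rule tendsto_eventually)
qed

section \<open>Likelihood ratios along dyadic skeletons\<close>

locale ctmc_pair = X: ctmc p c \<mu> P + Y: ctmc p c' \<mu>' P'
  for p :: "'a::finite \<Rightarrow> 'a \<Rightarrow> real" and c c' \<mu> \<mu>' P P'
begin

sublocale two_rates p c c' by unfold_locales

definition lr :: "real \<Rightarrow> nat \<Rightarrow> (nat \<Rightarrow> 'a) \<Rightarrow> real" where
  "lr h N w = pmf \<mu> (w 0) / pmf \<mu>' (w 0) * (\<Prod>i<N. X.tp h (w i) (w (Suc i)) / Y.tp h (w i) (w (Suc i)))"

lemma lr_pos: "0 < h \<Longrightarrow> 0 < lr h N w"
  unfolding lr_def by (intro mult_pos_pos divide_pos_pos prod_pos) (auto simp: X.mu_pos Y.mu_pos X.tp_pos Y.tp_pos)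

lemma lr_depends: "depends_upto N (lr h N)"
  unfolding depends_upto_def lr_def by (auto intro!: arg_cong2[where f="(*)"] prod.cong)

lemma lr_word_prob: "0 < h \<Longrightarrow> lr h N w * Y.word_prob h N w = X.word_prob h N w"
proof -
  assume h: "0 < h"
  have "(\<Prod>i<N. X.tp h (w i) (w (Suc i)) / Y.tp h (w i) (w (Suc i))) * (\<Prod>i<N. Y.tp h (w i) (w (Suc i))) = (\<Prod>i<N. X.tp h (w i) (w (Suc i)))"
    unfolding prod.distrib[symmetric] using Y.tp_pos[OF h] by (intro prod.cong refl) (simp add: less_imp_neq[symmetric])
  moreover have "pmf \<mu> (w 0) / pmf \<mu>' (w 0) * pmf \<mu>' (w 0) = pmf \<mu> (w 0)"
    using Y.mu_pos[of "w 0"] by simp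
  moreover have "lr h N w * Y.word_prob h N w = (pmf \<mu> (w 0) / pmf \<mu>' (w 0) * pmf \<mu>' (w 0)) *
      ((\<Prod>i<N. X.tp h (w i) (w (Suc i)) / Y.tp h (w i) (w (Suc i))) * (\<Prod>i<N. Y.tp h (w i) (w (Suc i))))"
    unfolding lr_def Y.word_prob_def by (simp only: mult_ac)
  ultimately show ?thesis by (simp only: X.word_prob_def)
qed

text \<open>The density of the first law with respect to the second on the skeleton of mesh
  \<open>t / 2 ^ m\<close>. The mesh is halved at each level, so each skeleton contains the coarser
  ones.\<close>

definition Z :: "real \<Rightarrow> nat \<Rightarrow> (real \<Rightarrow> 'a) \<Rightarrow> real" where
  "Z t m \<omega> = lr (t / 2 ^ m) (2 ^ m) (\<lambda>i. \<omega> (real i * (t / 2 ^ m)))"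

lemma Z_pos: "0 < t \<Longrightarrow> 0 < Z t m \<omega>"
  unfolding Z_def by (intro lr_pos) auto

lemma coarsen:
  assumes "m \<le> k" "depends_upto (2 ^ m) g"
  shows "\<exists>g'. depends_upto (2 ^ k) g' \<and> (\<forall>\<omega>::real \<Rightarrow> 'a. g (\<lambda>i. \<omega> (real i * (t / 2 ^ m))) = g' (\<lambda>i. \<omega> (real i * (t / 2 ^ k))))"
proof (intro exI[of _ "\<lambda>w. g (\<lambda>i. w (i * 2 ^ (k - m)))"] conjI allI)
  have k: "(2::nat) ^ m * 2 ^ (k - m) = 2 ^ k" using assms(1) by (simp flip: power_add)
  show "depends_upto (2 ^ k) (\<lambda>w. g (\<lambda>i. w (i * 2 ^ (k - m))))"
    unfolding depends_upto_def
  proof (intro allI impI)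
    fix w w' :: "nat \<Rightarrow> 'a" assume w: "\<forall>i\<le>2 ^ k. w i = w' i"
    have ww: "w (i * 2 ^ (k - m)) = w' (i * 2 ^ (k - m))" if "i \<le> 2 ^ m" for i
    proof -
      have "i * 2 ^ (k - m) \<le> 2 ^ k" using mult_le_mono1[OF that, of "2 ^ (k - m)"] unfolding k .
      then show ?thesis using w by blast
    qed
    show "g (\<lambda>i. w (i * 2 ^ (k - m))) = g (\<lambda>i. w' (i * 2 ^ (k - m)))"
      by (rule assms(2)[unfolded depends_upto_def, rule_format]) (rule ww)
  qed
  fix \<omega> :: "real \<Rightarrow> 'a"
  have k': "(2::real) ^ k = 2 ^ m * 2 ^ (k - m)" using assms(1) by (simp flip: power_add)
  have "real i * (t / 2 ^ m) = real (i * 2 ^ (k - m)) * (t / 2 ^ k)" for i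
    unfolding k' by simp
  then show "g (\<lambda>i. \<omega> (real i * (t / 2 ^ m))) = g (\<lambda>i. \<omega> (real (i * 2 ^ (k - m)) * (t / 2 ^ k)))"
    by (simp only:)
qed

text \<open>On the skeleton of level \<open>k\<close> the identity is a finite sum over words, by
  \<open>lr_word_prob\<close>. Taking \<open>g\<close> from a coarser level expresses the martingale
  property without conditional expectations.\<close>

lemma change_measure:
  assumes t: "0 < t" and mk: "m \<le> k" and g: "depends_upto (2 ^ m) g"
  shows "integrable P (\<lambda>\<omega>. g (\<lambda>i. \<omega> (real i * (t / 2 ^ m))))"
    and "integrable P' (\<lambda>\<omega>. g (\<lambda>i. \<omega> (real i * (t / 2 ^ m))))"
    and "integrable P' (\<lambda>\<omega>. Z t k \<omega> * g (\<lambda>i. \<omega> (real i * (t / 2 ^ m))))"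
    and "(\<integral>\<omega>. Z t k \<omega> * g (\<lambda>i. \<omega> (real i * (t / 2 ^ m))) \<partial>P') = (\<integral>\<omega>. g (\<lambda>i. \<omega> (real i * (t / 2 ^ m))) \<partial>P)"
proof -
  let ?h = "t / 2 ^ k"
  have h: "0 < ?h" using t by simp
  obtain g' where g': "depends_upto (2 ^ k) g'" "\<And>\<omega>::real \<Rightarrow> 'a. g (\<lambda>i. \<omega> (real i * (t / 2 ^ m))) = g' (\<lambda>i. \<omega> (real i * ?h))"
    using coarsen[OF mk g] by blast
  have dep: "depends_upto (2 ^ k) (\<lambda>w. lr ?h (2 ^ k) w * g' w)"
    by (intro depends_upto_mult lr_depends g')
  show "integrable P (\<lambda>\<omega>. g (\<lambda>i. \<omega> (real i * (t / 2 ^ m))))"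
    unfolding g'(2) by (rule X.skeleton_integral(1)[OF h g'(1)])
  show "integrable P' (\<lambda>\<omega>. g (\<lambda>i. \<omega> (real i * (t / 2 ^ m))))"
    unfolding g'(2) by (rule Y.skeleton_integral(1)[OF h g'(1)])
  show "integrable P' (\<lambda>\<omega>. Z t k \<omega> * g (\<lambda>i. \<omega> (real i * (t / 2 ^ m))))"
    unfolding g'(2) Z_def by (rule Y.skeleton_integral(1)[OF h dep])
  have "(\<integral>\<omega>. Z t k \<omega> * g (\<lambda>i. \<omega> (real i * (t / 2 ^ m))) \<partial>P') = (\<Sum>w\<in>words (2 ^ k). lr ?h (2 ^ k) w * g' w * Y.word_prob ?h (2 ^ k) w)"
    unfolding g'(2) Z_def by (rule Y.skeleton_integral(2)[OF h dep])
  also have "\<dots> = (\<Sum>w\<in>words (2 ^ k). g' w * X.word_prob ?h (2 ^ k) w)"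
    by (intro sum.cong refl) (simp add: lr_word_prob[OF h, symmetric])
  also have "\<dots> = (\<integral>\<omega>. g (\<lambda>i. \<omega> (real i * (t / 2 ^ m))) \<partial>P)"
    unfolding g'(2) by (rule X.skeleton_integral(2)[OF h g'(1), symmetric])
  finally show "(\<integral>\<omega>. Z t k \<omega> * g (\<lambda>i. \<omega> (real i * (t / 2 ^ m))) \<partial>P') = (\<integral>\<omega>. g (\<lambda>i. \<omega> (real i * (t / 2 ^ m))) \<partial>P)" .
qed

text \<open>The sum is the second moment of the one-step likelihood ratio under the second chain. It
  exceeds 1 by a term of order \<open>h\<close>: the diagonal term is close to 1, and off the
  diagonal a probability of order \<open>h\<close> meets a ratio bounded by
  \<open>tp_ratio_bounded\<close>. Such a bound stays finite when iterated over \<open>t / h\<close>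
  steps.\<close>

lemma ratio_row_bound:
  "\<exists>C\<ge>0. \<exists>h0>0. \<forall>h w. 0 < h \<and> h \<le> h0 \<longrightarrow> (\<Sum>z\<in>UNIV. X.tp h w z * (X.tp h w z / Y.tp h w z)) \<le> 1 + C * h"
proof -
  obtain K where K: "K > 0" "\<And>(t::real) x y. 0 < t \<Longrightarrow> t \<le> 1 \<Longrightarrow> X.tp t x y \<le> K * Y.tp t x y"
    using tp_ratio_bounded by blast
  let ?n = "real (CARD('a))"
  have L: "1 \<le> Y.Lam" "1 \<le> X.Lam" by (rule Y.Lam_ge_1 X.Lam_ge_1)+
  have C0: "0 \<le> 2 * Y.Lam + ?n * (X.Lam * K)" using L K(1) by (intro add_nonneg_nonneg mult_nonneg_nonneg) auto
  have h0: "0 < 1 / (2 * Y.Lam)" using L by simp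
  have main: "(\<Sum>z\<in>UNIV. X.tp h w z * (X.tp h w z / Y.tp h w z)) \<le> 1 + (2 * Y.Lam + ?n * (X.Lam * K)) * h"
    if h: "0 < h \<and> h \<le> 1 / (2 * Y.Lam)" for h w
  proof -
    have Lh: "Y.Lam * h \<le> 1/2" using h L by (simp add: field_simps)
    have "h \<le> Y.Lam * h" using h L mult_right_mono[of 1 Y.Lam h] by simp
    then have h1: "h \<le> 1" using Lh by linarith
    have "(\<Sum>z\<in>UNIV. X.tp h w z * (X.tp h w z / Y.tp h w z)) =
        X.tp h w w * (X.tp h w w / Y.tp h w w) + (\<Sum>z\<in>UNIV - {w}. X.tp h w z * (X.tp h w z / Y.tp h w z))"
      by (rule sum.remove) auto
    also have "X.tp h w w * (X.tp h w w / Y.tp h w w) \<le> 1 + 2 * Y.Lam * h"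
    proof -
      have "X.tp h w w * X.tp h w w \<le> 1 * 1" using h X.tp_le_1[of h w w] X.tp_nonneg[of h w w] by (intro mult_mono) auto
      \<comment> \<open>\<open>1 / (1 - v) \<le> 1 + 2 * v\<close> for
        \<open>0 \<le> v \<le> 1/2\<close>; this is why \<open>h\<close> is at most
        \<open>1 / (2 * Y.Lam)\<close>.\<close>
      also have "1 * 1 \<le> (1 + 2 * Y.Lam * h) * (1 - Y.Lam * h)"
      proof -
        have "0 \<le> Y.Lam * h * (1 - 2 * (Y.Lam * h))" using Lh h L by (intro mult_nonneg_nonneg) auto
        then show ?thesis by (simp add: algebra_simps)
      qed
      also have "\<dots> \<le> (1 + 2 * Y.Lam * h) * Y.tp h w w"
        using Y.tp_diag[of h w] h L by (intro mult_left_mono) auto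
      finally show ?thesis using Y.tp_pos[of h w w] h by (simp add: pos_divide_le_eq)
    qed
    also have "(\<Sum>z\<in>UNIV - {w}. X.tp h w z * (X.tp h w z / Y.tp h w z)) \<le> (\<Sum>z\<in>UNIV - {w}. X.Lam * h * K)"
    proof (rule sum_mono)
      fix z assume "z \<in> UNIV - {w}"
      then have "X.tp h w z \<le> X.Lam * h" using h X.tp_offdiag[of h w z] by auto
      moreover have "X.tp h w z / Y.tp h w z \<le> K" using K(2)[of h w z] h h1 Y.tp_pos[of h w z] by (simp add: pos_divide_le_eq)
      moreover have "0 \<le> X.tp h w z" "0 \<le> Y.tp h w z" using h X.tp_nonneg[of h] Y.tp_nonneg[of h] by auto
      ultimately show "X.tp h w z * (X.tp h w z / Y.tp h w z) \<le> X.Lam * h * K"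
        using h L by (intro mult_mono) auto
    qed
    also have "\<dots> \<le> ?n * (X.Lam * h * K)"
    proof -
      have "real (card (UNIV - {w})) * (X.Lam * h * K) \<le> ?n * (X.Lam * h * K)"
        using h L K(1) by (intro mult_right_mono of_nat_mono card_mono) auto
      then show ?thesis by simp
    qed
    finally show ?thesis by (simp add: algebra_simps)
  qed
  show ?thesis
    by (rule exI, rule conjI, rule C0, rule exI, rule conjI, rule h0, intro allI impI, rule main)
qed

text \<open>The expectation of \<open>Z\<close> under \<open>P\<close> is its second moment under
  \<open>P'\<close>. Over \<open>2 ^ m\<close> steps the factors \<open>1 + C * t / 2 ^ m\<close>
  accumulate to at most \<open>exp (C * t)\<close>.\<close>

lemma Z_bounded:
  assumes t: "0 < t"
  shows "\<exists>C m0. \<forall>m\<ge>m0. (\<integral>\<omega>. Z t m \<omega> \<partial>P) \<le> C"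
proof -
  obtain C h0 where C: "C \<ge> 0" "h0 > 0" "\<And>h w. 0 < h \<Longrightarrow> h \<le> h0 \<Longrightarrow> (\<Sum>z\<in>UNIV. X.tp h w z * (X.tp h w z / Y.tp h w z)) \<le> 1 + C * h"
    using ratio_row_bound by blast
  define M where "M = (\<Sum>x\<in>UNIV. pmf \<mu> x / pmf \<mu>' x)"
  have M: "pmf \<mu> x / pmf \<mu>' x \<le> M" for x unfolding M_def by (rule member_le_sum) auto
  have M0: "0 \<le> M" unfolding M_def by (intro sum_nonneg) auto
  obtain m0 :: nat where "t / h0 < 2 ^ m0" using real_arch_pow[of 2] by auto
  then have m0: "t < h0 * 2 ^ m0" using C(2) by (simp add: field_simps)
  show ?thesis
  proof (intro exI[of _ "M * exp (C * t)"] exI[of _ m0] allI impI)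
    fix m assume m: "m0 \<le> m"
    let ?h = "t / 2 ^ m"
    have h: "0 < ?h" using t by simp
    have Ch: "0 \<le> C * ?h" using mult_nonneg_nonneg[OF C(1) less_imp_le[OF h]] .
    have pow0: "0 \<le> M * (1 + C * ?h) ^ (2 ^ m)"
      by (intro mult_nonneg_nonneg M0 zero_le_power) (use Ch in linarith)
    have "h0 * 2 ^ m0 \<le> h0 * 2 ^ m" using m C(2) by (intro mult_left_mono power_increasing) auto
    then have hh0: "?h \<le> h0" using m0 by (simp add: pos_divide_le_eq)
    define F where "F x y = ln (X.tp ?h x y / Y.tp ?h x y)" for x y
    have F: "exp (F x y) = X.tp ?h x y / Y.tp ?h x y" for x y
      unfolding F_def using X.tp_pos[OF h] Y.tp_pos[OF h] by simp
    have Zle: "Z t m \<omega> \<le> M * exp (\<Sum>i<2 ^ m. F (\<omega> (real i * ?h)) (\<omega> (real (Suc i) * ?h)))" for \<omega>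
      unfolding Z_def lr_def exp_sum[OF finite_lessThan] F
      using M X.tp_pos[OF h] Y.tp_pos[OF h] by (intro mult_mono prod_nonneg M0) (auto intro: less_imp_le)
    have int: "integrable P (\<lambda>\<omega>. Z t m \<omega>)"
      using change_measure(1)[OF t order_refl lr_depends[of "2 ^ m" ?h]] by (simp only: Z_def)
    have "ennreal (\<integral>\<omega>. Z t m \<omega> \<partial>P) = (\<integral>\<^sup>+\<omega>. ennreal (Z t m \<omega>) \<partial>P)"
      using int Z_pos[OF t] by (intro nn_integral_eq_integral[symmetric]) (auto intro: less_imp_le)
    also have "\<dots> \<le> (\<integral>\<^sup>+\<omega>. ennreal M * (ennreal (exp (\<Sum>i<2 ^ m. F (\<omega> (real i * ?h)) (\<omega> (real (Suc i) * ?h)))) * ennreal 1) \<partial>P)"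
      using Zle M0 by (intro nn_integral_mono) (auto simp: ennreal_mult[symmetric] intro!: ennreal_leI)
    also have "\<dots> = ennreal M * (\<integral>\<^sup>+\<omega>. ennreal (exp (\<Sum>i<2 ^ m. F (\<omega> (real i * ?h)) (\<omega> (real (Suc i) * ?h)))) * ennreal 1 \<partial>P)"
    proof (rule nn_integral_cmult)
      have Fm: "(\<lambda>\<omega>. F (\<omega> (real i * ?h)) (\<omega> (real (Suc i) * ?h))) \<in> borel_measurable P" for i
        by (rule borel_measurable_integrable[OF X.pair_integral(1)[OF h]])
      show "(\<lambda>\<omega>. ennreal (exp (\<Sum>i<2 ^ m. F (\<omega> (real i * ?h)) (\<omega> (real (Suc i) * ?h)))) * ennreal 1) \<in> borel_measurable P"
        by (intro borel_measurable_times_ennreal measurable_compose[OF _ measurable_ennreal] borel_measurable_const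
            measurable_compose[OF _ borel_measurable_exp] borel_measurable_sum Fm)
    qed
    also have "\<dots> \<le> ennreal M * ennreal ((1 + C * ?h) ^ (2 ^ m) * (\<Sum>w\<in>UNIV. pmf \<mu> w * 1))"
    proof (intro mult_left_mono X.exp_moment[where V="\<lambda>_. 1"] h)
      show "0 \<le> 1 + C * ?h" using Ch by linarith
      show "(\<Sum>z\<in>UNIV. X.tp ?h w z * exp (F w z) * 1) \<le> (1 + C * ?h) * 1" for w
        using C(3)[OF h hh0, of w] by (simp only: F mult_1_right)
    qed auto
    also have "\<dots> = ennreal (M * (1 + C * ?h) ^ (2 ^ m))"
      using X.mu_sum M0 by (simp add: ennreal_mult')
    finally have "(\<integral>\<omega>. Z t m \<omega> \<partial>P) \<le> M * (1 + C * ?h) ^ (2 ^ m)"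
      by (simp only: ennreal_le_iff[OF pow0])
    also have "\<dots> \<le> M * exp (C * ?h) ^ (2 ^ m)"
      by (intro mult_left_mono power_mono M0 exp_ge_add_one_self) (use Ch in linarith)
    also have "exp (C * ?h) ^ (2 ^ m) = exp (C * t)"
      by (simp flip: exp_of_nat_mult)
    finally show "(\<integral>\<omega>. Z t m \<omega> \<partial>P) \<le> M * exp (C * t)" .
  qed
qed

lemma Z_integrable: "0 < t \<Longrightarrow> integrable P' (Z t m)"
  using change_measure(2)[OF _ order_refl lr_depends[of "2 ^ m" "t / 2 ^ m"]] by (simp add: Z_def[abs_def])

lemma Z_mult:
  assumes t: "0 < t" and mk: "m \<le> k"
  shows "integrable P' (\<lambda>\<omega>. Z t k \<omega> * Z t m \<omega>)" "(\<integral>\<omega>. Z t k \<omega> * Z t m \<omega> \<partial>P') = (\<integral>\<omega>. Z t m \<omega> \<partial>P)"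
  using change_measure(3,4)[OF t mk lr_depends[of "2 ^ m" "t / 2 ^ m"]] by (simp_all only: Z_def[of t m])

text \<open>Under \<open>P'\<close> the likelihood ratios form a martingale bounded in \<open>L\<^sup>2\<close>, with
  \<open>E' (Z t m)\<^sup>2 = E (Z t m)\<close>. This replaces an explicit formula for the path density.\<close>

lemma Z_diff_L1:
  assumes t: "0 < t" and mk: "m \<le> k"
  shows "0 \<le> (\<integral>\<omega>. Z t k \<omega> \<partial>P) - (\<integral>\<omega>. Z t m \<omega> \<partial>P)"
    and "0 < q \<Longrightarrow> (\<integral>\<omega>. \<bar>Z t k \<omega> - Z t m \<omega>\<bar> \<partial>P') \<le> q * ((\<integral>\<omega>. Z t k \<omega> \<partial>P) - (\<integral>\<omega>. Z t m \<omega> \<partial>P)) + 1 / q"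
proof -
  let ?d = "\<lambda>\<omega>. (Z t k \<omega> - Z t m \<omega>)\<^sup>2"
  note mm = Z_mult[OF t order_refl, of m] and kk = Z_mult[OF t order_refl, of k] and km = Z_mult[OF t mk]
  have eq: "?d \<omega> = Z t k \<omega> * Z t k \<omega> - 2 * (Z t k \<omega> * Z t m \<omega>) + Z t m \<omega> * Z t m \<omega>" for \<omega>
    by (simp add: power2_eq_square algebra_simps)
  have di: "integrable P' ?d" unfolding eq
    by (rule Bochner_Integration.integrable_add[OF Bochner_Integration.integrable_diff[OF kk(1) integrable_mult_right[OF km(1)]] mm(1)])
  have "(\<integral>\<omega>. ?d \<omega> \<partial>P') = (\<integral>\<omega>. Z t k \<omega> \<partial>P) - 2 * (\<integral>\<omega>. Z t m \<omega> \<partial>P) + (\<integral>\<omega>. Z t m \<omega> \<partial>P)"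
    unfolding eq using mm kk km
    by (simp add: Bochner_Integration.integral_add Bochner_Integration.integral_diff)
  then have dv: "(\<integral>\<omega>. ?d \<omega> \<partial>P') = (\<integral>\<omega>. Z t k \<omega> \<partial>P) - (\<integral>\<omega>. Z t m \<omega> \<partial>P)" by simp
  have "0 \<le> (\<integral>\<omega>. ?d \<omega> \<partial>P')" by (rule Bochner_Integration.integral_nonneg) simp
  then show "0 \<le> (\<integral>\<omega>. Z t k \<omega> \<partial>P) - (\<integral>\<omega>. Z t m \<omega> \<partial>P)" unfolding dv .
  assume q: "0 < q"
  have "(\<integral>\<omega>. \<bar>Z t k \<omega> - Z t m \<omega>\<bar> \<partial>P') \<le> (\<integral>\<omega>. q * ?d \<omega> + 1 / q \<partial>P')"
  proof (rule integral_mono)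
    show "integrable P' (\<lambda>\<omega>. \<bar>Z t k \<omega> - Z t m \<omega>\<bar>)"
      by (intro integrable_abs Bochner_Integration.integrable_diff Z_integrable t)
    show "integrable P' (\<lambda>\<omega>. q * ?d \<omega> + 1 / q)" by (rule Bochner_Integration.integrable_add[OF integrable_mult_right[OF di]]) simp
    fix \<omega>
    let ?x = "Z t k \<omega> - Z t m \<omega>"
    \<comment> \<open>\<open>\<bar>v\<bar> \<le> q * v\<^sup>2 + 1 / q\<close> plays the role of the
      Cauchy-Schwarz inequality; the free \<open>q\<close> will be \<open>2 ^ j\<close>.\<close>
    have "0 \<le> (q * \<bar>?x\<bar> - 1)\<^sup>2 + q * \<bar>?x\<bar>" using q by (intro add_nonneg_nonneg) auto
    then have "q * \<bar>?x\<bar> \<le> q * (q * ?x\<^sup>2 + 1 / q)" using q by (simp add: power2_eq_square algebra_simps)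
    then show "\<bar>?x\<bar> \<le> q * ?d \<omega> + 1 / q" using q by (simp only: mult_le_cancel_left_pos)
  qed
  also have "\<dots> = q * (\<integral>\<omega>. ?d \<omega> \<partial>P') + 1 / q"
    using di by (subst Bochner_Integration.integral_add) (auto simp: Y.prob_space[simplified])
  finally show "(\<integral>\<omega>. \<bar>Z t k \<omega> - Z t m \<omega>\<bar> \<partial>P') \<le> q * ((\<integral>\<omega>. Z t k \<omega> \<partial>P) - (\<integral>\<omega>. Z t m \<omega> \<partial>P)) + 1 / q"
    unfolding dv .
qed

lemma Z_measurable_filtration:
  assumes t: "0 < t"
  shows "Z t m \<in> borel_measurable (path_filtration t)"
proof -
  let ?h = "t / 2 ^ m"
  have h: "0 < ?h" using t by simp
  have le: "real i * ?h \<le> t" if "i \<le> 2 ^ m" for i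
  proof -
    have "real i \<le> 2 ^ m" using that by (metis of_nat_le_iff of_nat_numeral of_nat_power)
    then have "real i * ?h \<le> 2 ^ m * ?h" using h by (intro mult_right_mono) auto
    then show ?thesis by simp
  qed
  have "(\<lambda>\<omega>. (\<lambda>x y. pmf \<mu> x / pmf \<mu>' x) (\<omega> (real 0 * ?h)) (\<omega> 0)) \<in> borel_measurable (path_filtration t)"
    by (rule measurable_pair_eval[of "real 0 * ?h" t 0 "\<lambda>x y. pmf \<mu> x / pmf \<mu>' x"]) (use t in auto)
  moreover have "(\<lambda>\<omega>. (\<lambda>x y. X.tp ?h x y / Y.tp ?h x y) (\<omega> (real i * ?h)) (\<omega> (real (Suc i) * ?h))) \<in> borel_measurable (path_filtration t)" if "i < 2 ^ m" for i
    by (rule measurable_pair_eval[of "real i * ?h" t "real (Suc i) * ?h" "\<lambda>x y. X.tp ?h x y / Y.tp ?h x y"])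
      (use t le[of i] le[of "Suc i"] that in \<open>auto simp del: of_nat_Suc intro!: divide_nonneg_nonneg mult_nonneg_nonneg\<close>)
  ultimately show ?thesis
    unfolding Z_def[abs_def] lr_def by (intro borel_measurable_times borel_measurable_prod) auto
qed

text \<open>The second moments \<open>a m\<close> increase to a limit \<open>L\<close>. Along levels
  where \<open>L - a\<close> is at most \<open>(1/4) ^ j\<close>, successive differences have mean
  absolute value at most \<open>2 * (1/2) ^ j\<close> under \<open>P'\<close>. Their series
  converges absolutely almost surely, which gives both the limit and a dominating function.\<close>

lemma Z_limit:
  assumes t: "0 < t"
  obtains r :: "nat \<Rightarrow> nat" and Zi D where
    "\<And>j. j \<le> r j" "Zi \<in> borel_measurable (path_filtration t)" "\<And>\<omega>. 0 \<le> Zi \<omega>" "integrable P' D"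
    "AE \<omega> in P'. (\<lambda>j. Z t (r j) \<omega>) \<longlonglongrightarrow> Zi \<omega>" "AE \<omega> in P'. \<forall>j. Z t (r j) \<omega> \<le> D \<omega>"
proof -
  define a where "a m = (\<integral>\<omega>. Z t m \<omega> \<partial>P)" for m
  have inc: "incseq a" unfolding incseq_def a_def using Z_diff_L1(1)[OF t] by simp
  obtain C m0 where C: "\<And>m. m \<ge> m0 \<Longrightarrow> a m \<le> C" using Z_bounded[OF t] unfolding a_def by blast
  have "a m \<le> C" for m
    using incseqD[OF inc, of m "max m m0"] C[of "max m m0"] by simp
  then obtain L where L: "a \<longlonglongrightarrow> L" "\<And>m. a m \<le> L" using incseq_convergent[OF inc] by blast
  have "\<exists>m\<ge>j. L - a m \<le> (1/4) ^ j" for j :: nat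
  proof -
    have "\<forall>\<^sub>F m in sequentially. L - (1/4) ^ j < a m" using L(1) by (intro order_tendstoD) auto
    then have "\<forall>\<^sub>F m in sequentially. L - (1/4) ^ j < a m \<and> j \<le> m" using eventually_ge_at_top by (rule eventually_conj)
    then obtain m where "L - (1/4) ^ j < a m \<and> j \<le> m" using eventually_happens'[OF sequentially_bot] by blast
    then show ?thesis by (intro exI[of _ m]) auto
  qed
  then obtain f where f: "\<And>j. j \<le> f j" "\<And>j. L - a (f j) \<le> (1/4) ^ j" by metis
  \<comment> \<open>Partial sums turn the chosen levels into a nondecreasing sequence that is still
    at least \<open>f j\<close>.\<close>
  define r where "r j = (\<Sum>i\<le>j. f i)" for j
  have fr: "f j \<le> r j" for j unfolding r_def by (rule member_le_sum) auto
  have rS: "r j \<le> r (Suc j)" for j by (simp add: r_def)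
  have rj: "j \<le> r j" for j using f(1)[of j] fr[of j] by simp
  have ar: "L - a (r j) \<le> (1/4) ^ j" for j using f(2)[of j] incseqD[OF inc fr[of j]] by linarith
  define d where "d j \<omega> = Z t (r (Suc j)) \<omega> - Z t (r j) \<omega>" for j \<omega>
  have di: "integrable P' (d j)" for j unfolding d_def[abs_def] by (intro Bochner_Integration.integrable_diff Z_integrable t)
  have dle: "(\<integral>\<omega>. \<bar>d j \<omega>\<bar> \<partial>P') \<le> 2 * (1/2) ^ j" for j
  proof -
    \<comment> \<open>\<open>q = 2 ^ j\<close> balances the two terms of \<open>Z_diff_L1\<close>,
      \<open>2 ^ j * (1/4) ^ j\<close> and \<open>1 / 2 ^ j\<close>.\<close>
    have "(\<integral>\<omega>. \<bar>d j \<omega>\<bar> \<partial>P') \<le> 2 ^ j * (a (r (Suc j)) - a (r j)) + 1 / 2 ^ j"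
      unfolding d_def a_def by (rule Z_diff_L1(2)[OF t rS]) simp
    also have "\<dots> \<le> 2 ^ j * (1/4) ^ j + 1 / 2 ^ j"
      using ar[of j] L(2)[of "r (Suc j)"] by (intro add_right_mono mult_left_mono) auto
    also have "(2::real) ^ j * (1/4) ^ j = (1/2) ^ j" by (simp flip: power_mult_distrib)
    finally show ?thesis by (simp add: power_one_over)
  qed
  have sd: "summable (\<lambda>j. \<integral>\<omega>. \<bar>d j \<omega>\<bar> \<partial>P')"
  proof (rule summable_comparison_test)
    show "\<exists>N. \<forall>n\<ge>N. norm (\<integral>\<omega>. \<bar>d n \<omega>\<bar> \<partial>P') \<le> 2 * (1/2) ^ n"
      using dle by (auto simp: Bochner_Integration.integral_nonneg)
    show "summable (\<lambda>n. 2 * (1/2::real) ^ n)" by (intro summable_mult summable_geometric) auto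
  qed
  note AEs = AE_summable_of_integrals[OF di sd]
  define D where "D \<omega> = Z t (r 0) \<omega> + (\<Sum>j. \<bar>d j \<omega>\<bar>)" for \<omega>
  have Zr: "Z t (r j) \<omega> = Z t (r 0) \<omega> + (\<Sum>i<j. d i \<omega>)" for j \<omega>
    by (induction j) (auto simp: d_def)
  \<comment> \<open>Defined at every path, also where there is no limit, so that \<open>Zi\<close>
    is measurable for \<open>path_filtration t\<close> itself and nonnegative everywhere.\<close>
  define Zi where "Zi \<omega> = max 0 (lim (\<lambda>j. Z t (r j) \<omega>))" for \<omega>
  show thesis
  proof
    show "j \<le> r j" for j by (rule rj)
    show "Zi \<in> borel_measurable (path_filtration t)"
      unfolding Zi_def[abs_def] by (intro borel_measurable_max borel_measurable_const borel_measurable_lim_metric Z_measurable_filtration t)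
    show "0 \<le> Zi \<omega>" for \<omega> by (simp add: Zi_def)
    show "integrable P' D"
      unfolding D_def[abs_def]
    proof (intro Bochner_Integration.integrable_add Z_integrable t integrable_suminf)
      show "integrable P' (\<lambda>\<omega>. \<bar>d j \<omega>\<bar>)" for j using di by (rule integrable_abs)
      show "AE \<omega> in P'. summable (\<lambda>i. norm \<bar>d i \<omega>\<bar>)" using AEs by simp
      show "summable (\<lambda>i. \<integral>\<omega>. norm \<bar>d i \<omega>\<bar> \<partial>P')" using sd by simp
    qed
    show "AE \<omega> in P'. (\<lambda>j. Z t (r j) \<omega>) \<longlonglongrightarrow> Zi \<omega>"
      using AEs
    proof eventually_elim
      case (elim \<omega>)
      then have "summable (\<lambda>j. d j \<omega>)" by (rule summable_rabs_cancel)
      then have "(\<lambda>j. Z t (r 0) \<omega> + (\<Sum>i<j. d i \<omega>)) \<longlonglongrightarrow> Z t (r 0) \<omega> + (\<Sum>i. d i \<omega>)"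
        by (intro tendsto_add tendsto_const summable_LIMSEQ)
      then have l: "(\<lambda>j. Z t (r j) \<omega>) \<longlonglongrightarrow> Z t (r 0) \<omega> + (\<Sum>i. d i \<omega>)" unfolding Zr[symmetric] .
      have "0 \<le> Z t (r 0) \<omega> + (\<Sum>i. d i \<omega>)"
        by (rule LIMSEQ_le_const[OF l]) (auto intro: less_imp_le Z_pos[OF t])
      then show ?case using l limI[OF l] by (simp add: Zi_def)
    qed
    show "AE \<omega> in P'. \<forall>j. Z t (r j) \<omega> \<le> D \<omega>"
      using AEs
    proof eventually_elim
      case (elim \<omega>)
      show ?case
      proof
        fix j
        have "(\<Sum>i<j. d i \<omega>) \<le> (\<Sum>i<j. \<bar>d i \<omega>\<bar>)" by (intro sum_mono) auto
        also have "\<dots> \<le> (\<Sum>i. \<bar>d i \<omega>\<bar>)" by (rule sum_le_suminf[OF elim]) auto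
        finally show "Z t (r j) \<omega> \<le> D \<omega>" unfolding Zr[of j] D_def by simp
      qed
    qed
  qed
qed

text \<open>By stationarity each of the \<open>2 ^ m\<close> steps has the same expected log ratio;
  the initial laws contribute once.\<close>

lemma Z_log_integral:
  assumes t: "0 < t"
  shows "(\<integral>\<omega>. ln (Z t m \<omega>) \<partial>P) = (\<Sum>x\<in>UNIV. pmf \<mu> x * ln (pmf \<mu> x / pmf \<mu>' x)) + 2 ^ m * skel_KL (pmf \<mu>) (t / 2 ^ m)"
proof -
  let ?h = "t / 2 ^ m"
  have h: "0 < ?h" using t by simp
  \<comment> \<open>The dummy second argument of \<open>?g\<close> brings the initial term under
    \<open>pair_integral\<close> as well.\<close>
  let ?f = "\<lambda>x y. ln (X.tp ?h x y / Y.tp ?h x y)" and ?g = "\<lambda>x y. ln (pmf \<mu> x / pmf \<mu>' x) :: real"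
  have pos: "0 < X.tp ?h x y / Y.tp ?h x y" "0 < pmf \<mu> x / pmf \<mu>' x" for x y
    using X.tp_pos[OF h] Y.tp_pos[OF h] X.mu_pos Y.mu_pos by auto
  have lnZ: "ln (Z t m \<omega>) = ?g (\<omega> (real 0 * ?h)) (\<omega> (real (Suc 0) * ?h)) + (\<Sum>i<2 ^ m. ?f (\<omega> (real i * ?h)) (\<omega> (real (Suc i) * ?h)))" for \<omega>
  proof -
    let ?q = "\<lambda>i. X.tp ?h (\<omega> (real i * ?h)) (\<omega> (real (Suc i) * ?h)) / Y.tp ?h (\<omega> (real i * ?h)) (\<omega> (real (Suc i) * ?h))"
    have "0 < (\<Prod>i<2 ^ m. ?q i)" by (intro prod_pos pos(1))
    moreover have "ln (\<Prod>i<2 ^ m. ?q i) = (\<Sum>i<2 ^ m. ln (?q i))" by (rule ln_prod) (rule finite_lessThan, rule less_imp_neq[OF pos(1), THEN not_sym])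
    ultimately show ?thesis unfolding Z_def lr_def by (simp only: ln_mult_pos[OF pos(2)])
  qed
  have "(\<integral>\<omega>. ln (Z t m \<omega>) \<partial>P) = (\<integral>\<omega>. ?g (\<omega> (real 0 * ?h)) (\<omega> (real (Suc 0) * ?h)) \<partial>P) + (\<Sum>i<2 ^ m. \<integral>\<omega>. ?f (\<omega> (real i * ?h)) (\<omega> (real (Suc i) * ?h)) \<partial>P)"
    unfolding lnZ using X.pair_integral(1)[OF h, of ?g 0] X.pair_integral(1)[OF h, of ?f]
    by (subst Bochner_Integration.integral_add) (auto intro!: integrable_sum Bochner_Integration.integral_sum simp del: of_nat_Suc of_nat_0)
  also have "(\<integral>\<omega>. ?g (\<omega> (real 0 * ?h)) (\<omega> (real (Suc 0) * ?h)) \<partial>P) = (\<Sum>x\<in>UNIV. \<Sum>y\<in>UNIV. pmf \<mu> x * X.tp ?h x y * ?g x y)"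
    by (rule X.pair_integral(2)[OF h])
  also have "\<dots> = (\<Sum>x\<in>UNIV. pmf \<mu> x * ln (pmf \<mu> x / pmf \<mu>' x))"
  proof (intro sum.cong refl)
    fix x
    have "(\<Sum>y\<in>UNIV. pmf \<mu> x * X.tp ?h x y * ?g x y) = (\<Sum>y\<in>UNIV. X.tp ?h x y) * (pmf \<mu> x * ?g x x)"
      by (subst sum_distrib_right) (simp only: mult_ac)
    then show "(\<Sum>y\<in>UNIV. pmf \<mu> x * X.tp ?h x y * ?g x y) = pmf \<mu> x * ln (pmf \<mu> x / pmf \<mu>' x)"
      using X.tp_row_sum[of ?h x] h by simp
  qed
  also have "(\<Sum>i<2 ^ m. \<integral>\<omega>. ?f (\<omega> (real i * ?h)) (\<omega> (real (Suc i) * ?h)) \<partial>P) = (\<Sum>i<(2::nat) ^ m. skel_KL (pmf \<mu>) ?h)"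
    unfolding X.pair_integral(2)[OF h, of ?f] skel_KL_def ..
  finally show ?thesis by simp
qed

text \<open>The tangent at \<open>y\<close> lies below the convex function \<open>z * ln z\<close>.
  At \<open>z = 0\<close> the product has its continuous value 0.\<close>

lemma xlnx_tangent:
  fixes y z :: real
  assumes "0 < y" "0 \<le> z"
  shows "y * ln y + (1 + ln y) * (z - y) \<le> z * ln z"
proof (cases "z = 0")
  case False
  then have z: "0 < z" using assms by simp
  have "ln (y / z) \<le> y / z - 1" using assms z by (intro ln_le_minus_one) auto
  then have "z * ln (y / z) \<le> z * (y / z - 1)" using z by (intro mult_left_mono) auto
  then have "z * (ln y - ln z) \<le> y - z" using assms z by (simp add: ln_div right_diff_distrib)
  then show ?thesis by (simp add: algebra_simps)
qed (use assms in \<open>simp add: algebra_simps\<close>)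

lemma xlnx_lower: "0 \<le> z \<Longrightarrow> - 1 \<le> z * ln (z::real)"
  using xlnx_tangent[of 1 z] by simp

text \<open>A quantitative form of the continuity of \<open>z * ln z\<close> at 0, from
  \<open>ln v \<le> v - 1\<close> at \<open>v = 1 / sqrt z\<close>.\<close>

lemma xlnx_le_sqrt:
  fixes z :: real
  assumes "0 < z" "z \<le> 1"
  shows "\<bar>z * ln z\<bar> \<le> 2 * sqrt z"
proof -
  have "ln (1 / sqrt z) \<le> 1 / sqrt z - 1" using assms by (intro ln_le_minus_one) auto
  then have "- ln z \<le> 2 * (1 / sqrt z)" using assms by (simp add: ln_div ln_sqrt)
  then have "z * (- ln z) \<le> z * (2 * (1 / sqrt z))" using assms by (intro mult_left_mono) auto
  also have "\<dots> = 2 * (z / sqrt z)" by simp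
  also have "z / sqrt z = sqrt z" using assms by (simp add: real_div_sqrt)
  finally have "- (z * ln z) \<le> 2 * sqrt z" by simp
  moreover have "z * ln z \<le> 0" using assms by (intro mult_nonneg_nonpos) auto
  ultimately show ?thesis by linarith
qed

text \<open>With \<open>\<phi> z = z ln z\<close>, Fatou's lemma bounds \<open>E' \<phi>(Zi)\<close> above by the limit of the skeleton
  entropies \<open>E' \<phi>(Z t m)\<close>; convexity of \<open>\<phi>\<close> and the martingale property bound it below.\<close>

lemma KL_path:
  assumes t: "0 < t" and s: "((\<lambda>h. skel_KL (pmf \<mu>) h / h) \<longlongrightarrow> s) (at_right 0)"
  shows "KL_divergence (exp 1) (restr_to_subalg P' (path_filtration t)) (restr_to_subalg P (path_filtration t)) =
    (\<Sum>x\<in>UNIV. pmf \<mu> x * ln (pmf \<mu> x / pmf \<mu>' x)) + t * s"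
proof -
  define K0 where "K0 = (\<Sum>x\<in>UNIV. pmf \<mu> x * ln (pmf \<mu> x / pmf \<mu>' x))"
  obtain r :: "nat \<Rightarrow> nat" and Zi D where
    rj: "\<And>j. j \<le> r j" and ZiF: "Zi \<in> borel_measurable (path_filtration t)" and Zi0: "\<And>\<omega>. 0 \<le> Zi \<omega>" and D: "integrable P' D"
    and lim: "AE \<omega> in P'. (\<lambda>j. Z t (r j) \<omega>) \<longlonglongrightarrow> Zi \<omega>" and dom: "AE \<omega> in P'. \<forall>j. Z t (r j) \<omega> \<le> D \<omega>"
    using Z_limit[OF t] by blast
  have Zi_meas [measurable]: "Zi \<in> borel_measurable P'" by (rule measurable_from_subalg[OF Y.subalgebra_P ZiF])
  have Z_meas [measurable]: "Z t m \<in> borel_measurable P'" for m by (rule borel_measurable_integrable[OF Z_integrable[OF t]])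
  have ZiD: "AE \<omega> in P'. Zi \<omega> \<le> D \<omega>"
    using lim dom by eventually_elim (auto intro: LIMSEQ_le_const2)
  have Zi_int: "integrable P' Zi"
    by (rule Bochner_Integration.integrable_bound[OF D Zi_meas]) (use ZiD in eventually_elim, use Zi0 in auto)
  \<comment> \<open>The limit density integrates every function of a dyadic skeleton correctly: once
    \<open>r j \<ge> m\<close>, the integrals with \<open>Z t (r j)\<close> no longer depend on
    \<open>j\<close>, and \<open>D\<close> justifies the passage to the limit.\<close>
  have change: "integrable P' (\<lambda>\<omega>. Zi \<omega> * g (\<lambda>i. \<omega> (real i * (t / 2 ^ m))))"
      "(\<integral>\<omega>. Zi \<omega> * g (\<lambda>i. \<omega> (real i * (t / 2 ^ m))) \<partial>P') = (\<integral>\<omega>. g (\<lambda>i. \<omega> (real i * (t / 2 ^ m))) \<partial>P)"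
    if g: "depends_upto (2 ^ m) g" for m g
  proof -
    let ?g = "\<lambda>\<omega>. g (\<lambda>i. \<omega> (real i * (t / 2 ^ m)))"
    define B where "B = (\<Sum>w\<in>words (2 ^ m). \<bar>g w\<bar>)"
    have gB: "\<bar>g w\<bar> \<le> B" for w
    proof -
      have "g w = g (restrict w {..2 ^ m})" using g by (auto simp: depends_upto_def)
      moreover have rw: "restrict w {..2 ^ m} \<in> words (2 ^ m)" by (auto simp: words_def)
      have "\<bar>g (restrict w {..2 ^ m})\<bar> \<le> B" unfolding B_def by (rule member_le_sum[OF rw]) auto
      ultimately show ?thesis by simp
    qed
    have gm [measurable]: "?g \<in> borel_measurable P'" by (rule borel_measurable_integrable[OF change_measure(2)[OF t order_refl g]])
    have bd: "norm (z * ?g \<omega>) \<le> D \<omega> * B" if "0 \<le> z" "z \<le> D \<omega>" for z \<omega>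
      using that gB[of "\<lambda>i. \<omega> (real i * (t / 2 ^ m))"] by (auto simp: abs_mult intro!: mult_mono)
    have DB: "integrable P' (\<lambda>\<omega>. D \<omega> * B)" using D by (rule integrable_mult_left)
    show "integrable P' (\<lambda>\<omega>. Zi \<omega> * ?g \<omega>)"
    proof (rule Bochner_Integration.integrable_bound[OF DB])
      show "AE \<omega> in P'. norm (Zi \<omega> * ?g \<omega>) \<le> norm (D \<omega> * B)"
        using ZiD by eventually_elim (use bd Zi0 in \<open>auto intro: order_trans[OF _ abs_ge_self]\<close>)
    qed measurable
    have "(\<lambda>j. \<integral>\<omega>. Z t (r j) \<omega> * ?g \<omega> \<partial>P') \<longlonglongrightarrow> (\<integral>\<omega>. Zi \<omega> * ?g \<omega> \<partial>P')"
    proof (rule integral_dominated_convergence[OF _ _ DB])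
      show "AE \<omega> in P'. (\<lambda>j. Z t (r j) \<omega> * ?g \<omega>) \<longlonglongrightarrow> Zi \<omega> * ?g \<omega>"
        using lim by eventually_elim (intro tendsto_mult tendsto_const)
      show "AE \<omega> in P'. norm (Z t (r j) \<omega> * ?g \<omega>) \<le> D \<omega> * B" for j
        using dom by eventually_elim (rule bd[OF less_imp_le[OF Z_pos[OF t]]], erule spec)
    qed measurable
    moreover have "\<forall>\<^sub>F j in sequentially. (\<integral>\<omega>. Z t (r j) \<omega> * ?g \<omega> \<partial>P') = (\<integral>\<omega>. ?g \<omega> \<partial>P)"
      using eventually_ge_at_top[of m] by eventually_elim (rule change_measure(4)[OF t order_trans[OF _ rj] g])
    then have "(\<lambda>j. \<integral>\<omega>. Z t (r j) \<omega> * ?g \<omega> \<partial>P') \<longlonglongrightarrow> (\<integral>\<omega>. ?g \<omega> \<partial>P)" by (rule tendsto_eventually)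
    ultimately show "(\<integral>\<omega>. Zi \<omega> * ?g \<omega> \<partial>P') = (\<integral>\<omega>. ?g \<omega> \<partial>P)" by (rule LIMSEQ_unique)
  qed
  \<comment> \<open>Arbitrary times in \<open>I\<close> are approximated by dyadic ones from the
    right; \<open>Zi\<close> itself dominates the integrands.\<close>
  have cyl_change: "(\<integral>\<omega>. Zi \<omega> * indicator (cyl I a) \<omega> \<partial>P') = X.prob (cyl I a)" if I: "finite I" "I \<subseteq> {0..t}" for I a
  proof -
    let ?\<kappa> = "\<lambda>k s. nat \<lceil>s * 2 ^ k / t\<rceil>"
    define G where "G k w = (if \<forall>s\<in>I. w (?\<kappa> k s) = a s then 1 else 0 :: real)" for k and w :: "nat \<Rightarrow> 'a"
    let ?G = "\<lambda>k \<omega>. G k (\<lambda>i. \<omega> (real i * (t / 2 ^ k)))"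
    have dep: "depends_upto (2 ^ k) (G k)" for k
    proof -
      have "?\<kappa> k s \<le> 2 ^ k" if "s \<in> I" for s
      proof -
        have "s * 2 ^ k / t \<le> 2 ^ k" using that I(2) t by (auto simp: field_simps)
        then have "\<lceil>s * 2 ^ k / t\<rceil> \<le> 2 ^ k" by (simp add: ceiling_le_iff)
        then show ?thesis by (simp add: nat_le_iff)
      qed
      then show ?thesis unfolding depends_upto_def G_def by auto
    qed
    have conv: "(\<lambda>k. ?G k \<omega>) \<longlonglongrightarrow> indicator (cyl I a) \<omega>" if "\<omega> \<in> space path_space" for \<omega>
      unfolding G_def by (rule skeleton_cylinder_tendsto[OF that I t])
    have cylm: "cyl I a \<in> sets path_space" by (rule path_filtration_sub[OF cyl_in_filtration[OF I]])
    have Gm [measurable]: "?G k \<in> borel_measurable P'" "?G k \<in> borel_measurable P" for k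
      using change_measure(1,2)[OF t order_refl dep[of k]] by (auto dest: borel_measurable_integrable)
    have "(\<lambda>k. \<integral>\<omega>. Zi \<omega> * ?G k \<omega> \<partial>P') \<longlonglongrightarrow> (\<integral>\<omega>. Zi \<omega> * indicator (cyl I a) \<omega> \<partial>P')"
    proof (rule integral_dominated_convergence[OF _ _ Zi_int])
      show "AE \<omega> in P'. (\<lambda>k. Zi \<omega> * ?G k \<omega>) \<longlonglongrightarrow> Zi \<omega> * indicator (cyl I a) \<omega>"
        using conv by (intro AE_I2 tendsto_mult tendsto_const) auto
      show "AE \<omega> in P'. norm (Zi \<omega> * ?G k \<omega>) \<le> Zi \<omega>" for k
        using Zi0 by (intro AE_I2) (auto simp: G_def)
    qed (use cylm in measurable)
    moreover have "(\<lambda>k. \<integral>\<omega>. ?G k \<omega> \<partial>P) \<longlonglongrightarrow> (\<integral>\<omega>. indicator (cyl I a) \<omega> \<partial>P)"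
    proof (rule integral_dominated_convergence[where w="\<lambda>_. 1"])
      show "AE \<omega> in P. (\<lambda>k. ?G k \<omega>) \<longlonglongrightarrow> indicator (cyl I a) \<omega>"
        using conv by (intro AE_I2) auto
      show "AE \<omega> in P. norm (?G k \<omega>) \<le> 1" for k by (intro AE_I2) (auto simp: G_def)
      show "indicator (cyl I a) \<in> borel_measurable P" using cylm by simp
      show "?G k \<in> borel_measurable P" for k by (rule Gm(2))
    qed simp
    ultimately have "(\<integral>\<omega>. Zi \<omega> * indicator (cyl I a) \<omega> \<partial>P') = (\<integral>\<omega>. indicator (cyl I a) \<omega> \<partial>P)"
      unfolding change(2)[OF dep] by (rule LIMSEQ_unique)
    also have "\<dots> = X.prob (cyl I a)"
      using X.integral_scaled_indicator[of "cyl I a" 1] cylm by simp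
    finally show ?thesis .
  qed
  let ?Q = "restr_to_subalg P (path_filtration t)" and ?Q' = "restr_to_subalg P' (path_filtration t)"
  have sQ: "sets ?Q = sets (path_filtration t)" "sets ?Q' = sets (path_filtration t)"
    by (rule sets_restr_to_subalg[OF X.subalgebra_P] sets_restr_to_subalg[OF Y.subalgebra_P])+
  have ZiQ: "Zi \<in> borel_measurable ?Q'" by (rule measurable_in_subalg[OF Y.subalgebra_P ZiF])
  have dens: "density ?Q' (\<lambda>\<omega>. ennreal (Zi \<omega>)) = ?Q"
  proof (rule measure_eqI_generator_eq_countable[OF Int_stable_cyls[of t]])
    show "cyls t \<subseteq> Pow (space path_space :: (real \<Rightarrow> 'a) set)" by (auto simp: cyls_def cyl_def)
    show "sets (density ?Q' (\<lambda>\<omega>. ennreal (Zi \<omega>))) = sigma_sets (space path_space) (cyls t)"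
      "sets ?Q = sigma_sets (space path_space) (cyls t)"
      using sets_path_filtration_cyls[of t] t sQ by auto
    fix A :: "(real \<Rightarrow> 'a) set" assume A: "A \<in> cyls t"
    show "emeasure (density ?Q' (\<lambda>\<omega>. ennreal (Zi \<omega>))) A = emeasure ?Q A"
    proof (cases "A = {}")
      case False
      then obtain I a where I: "A = cyl I a" "finite I" "I \<subseteq> {0..t}" using A by (auto simp: cyls_def)
      have AF: "A \<in> sets (path_filtration t)" unfolding I(1) by (rule cyl_in_filtration[OF I(2,3)])
      have "emeasure (density ?Q' (\<lambda>\<omega>. ennreal (Zi \<omega>))) A = (\<integral>\<^sup>+\<omega>. ennreal (Zi \<omega>) * indicator A \<omega> \<partial>?Q')"
        using ZiQ AF sQ by (intro emeasure_density) auto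
      also have "\<dots> = (\<integral>\<^sup>+\<omega>. ennreal (Zi \<omega>) * indicator A \<omega> \<partial>P')"
        using ZiF AF by (intro nn_integral_subalgebra2[OF Y.subalgebra_P]) auto
      also have "\<dots> = (\<integral>\<^sup>+\<omega>. ennreal (Zi \<omega> * indicator A \<omega>) \<partial>P')"
        by (intro nn_integral_cong) (auto simp: indicator_def)
      also have "\<dots> = ennreal (\<integral>\<omega>. Zi \<omega> * indicator A \<omega> \<partial>P')"
        using Zi_int Zi0 Y.filtration_in_P[OF AF] by (intro nn_integral_eq_integral integrable_real_mult_indicator) auto
      also have "\<dots> = ennreal (X.prob A)" unfolding I(1) cyl_change[OF I(2,3)] ..
      also have "\<dots> = emeasure ?Q A" using AF by (simp add: emeasure_restr_to_subalg[OF X.subalgebra_P] X.emeasure_eq_measure)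
      finally show ?thesis .
    qed simp
  next
    \<comment> \<open>\<open>cyls t\<close> need not contain the whole space, which is instead
      covered by the finitely many cylinders that prescribe the values at 0 and
      \<open>t\<close>.\<close>
    let ?c = "\<lambda>z. cyl {0, t} (\<lambda>q. if q = 0 then fst z else snd z) :: (real \<Rightarrow> 'a) set"
    show "range ?c \<subseteq> cyls t"
    proof
      fix A assume "A \<in> range ?c"
      then obtain z where "A = ?c z" by blast
      then show "A \<in> cyls t" unfolding cyls_def using t by (intro insertI2 CollectI exI conjI) auto
    qed
    show "\<Union> (range ?c) = space path_space"
    proof (intro set_eqI iffI)
      fix \<omega> :: "real \<Rightarrow> 'a" assume w: "\<omega> \<in> space path_space"
      have "\<omega> \<in> ?c (\<omega> 0, \<omega> t)" using w t by (auto simp: cyl_def)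
      then show "\<omega> \<in> \<Union> (range ?c)" by blast
    qed (auto simp: cyl_def)
    show "countable (range ?c)" by (intro countable_finite finite_imageI) simp
    fix A assume "A \<in> range ?c"
    then obtain z where A: "A = ?c z" by blast
    have AF: "A \<in> sets (path_filtration t)" unfolding A by (rule cyl_in_filtration) (use t in auto)
    have AS: "A \<subseteq> space ?Q'" using sets.sets_into_space[OF AF] by (simp add: space_restr_to_subalg)
    have "emeasure (density ?Q' (\<lambda>\<omega>. ennreal (Zi \<omega>))) A \<le> emeasure (density ?Q' (\<lambda>\<omega>. ennreal (Zi \<omega>))) (space ?Q')"
      by (rule emeasure_mono[OF AS]) simp
    also have "\<dots> = (\<integral>\<^sup>+\<omega>. ennreal (Zi \<omega>) \<partial>?Q')"
      using ZiQ by (subst emeasure_density) (auto intro!: nn_integral_cong)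
    also have "\<dots> = (\<integral>\<^sup>+\<omega>. ennreal (Zi \<omega>) \<partial>P')"
      using ZiF by (intro nn_integral_subalgebra2[OF Y.subalgebra_P]) auto
    also have "\<dots> = ennreal (\<integral>\<omega>. Zi \<omega> \<partial>P')" using Zi_int Zi0 by (intro nn_integral_eq_integral) auto
    finally show "emeasure (density ?Q' (\<lambda>\<omega>. ennreal (Zi \<omega>))) A \<noteq> \<infinity>" by (auto simp: top_unique)
  qed
  interpret Q': prob_space ?Q' by (rule prob_space_restr_to_subalg[OF Y.subalgebra_P Y.prob_space_axioms])
  let ?\<phi> = "\<lambda>z::real. z * ln z"
  have "KL_divergence (exp 1) ?Q' ?Q = KL_divergence (exp 1) ?Q' (density ?Q' (\<lambda>\<omega>. ennreal (Zi \<omega>)))" by (simp only: dens)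
  also have "\<dots> = (\<integral>\<omega>. Zi \<omega> * log (exp 1) (Zi \<omega>) \<partial>?Q')"
    using ZiQ Zi0 by (intro Q'.KL_density) auto
  also have "\<dots> = (\<integral>\<omega>. ?\<phi> (Zi \<omega>) \<partial>?Q')" by (simp add: log_def)
  also have "\<dots> = (\<integral>\<omega>. ?\<phi> (Zi \<omega>) \<partial>P')"
    by (intro integral_subalgebra2[OF Y.subalgebra_P] borel_measurable_times borel_measurable_ln ZiF)
  finally have KL: "KL_divergence (exp 1) ?Q' ?Q = (\<integral>\<omega>. ?\<phi> (Zi \<omega>) \<partial>P')" .
  define k where "k m = (\<integral>\<omega>. ?\<phi> (Z t m \<omega>) \<partial>P')" for m
  have dln: "depends_upto (2 ^ m) (\<lambda>w. ln (lr (t / 2 ^ m) (2 ^ m) w))" for m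
    using lr_depends[of "2 ^ m" "t / 2 ^ m"] unfolding depends_upto_def by metis
  have Zln: "integrable P' (\<lambda>\<omega>. ?\<phi> (Z t m \<omega>))" "k m = (\<integral>\<omega>. ln (Z t m \<omega>) \<partial>P)" for m
    using change_measure(3,4)[OF t order_refl dln[of m]] unfolding k_def Z_def by simp_all
  have k_lim: "k \<longlonglongrightarrow> K0 + t * s"
  proof -
    have "filterlim (\<lambda>m. t * (1/2) ^ m) (at_right 0) sequentially"
    proof (rule tendsto_imp_filterlim_at_right)
      have "(\<lambda>m. t * (1 / 2) ^ m) \<longlonglongrightarrow> t * 0" by (intro tendsto_mult tendsto_const LIMSEQ_power_zero) simp
      then show "(\<lambda>m. t * (1 / 2) ^ m) \<longlonglongrightarrow> 0" by simp
    qed (use t in auto)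
    then have "(\<lambda>m. skel_KL (pmf \<mu>) (t * (1/2) ^ m) / (t * (1/2) ^ m)) \<longlonglongrightarrow> s"
      by (rule filterlim_compose[OF s])
    then have "(\<lambda>m. K0 + t * (skel_KL (pmf \<mu>) (t * (1/2) ^ m) / (t * (1/2) ^ m))) \<longlonglongrightarrow> K0 + t * s"
      by (intro tendsto_add tendsto_mult tendsto_const)
    moreover have "K0 + t * (skel_KL (pmf \<mu>) (t * (1/2) ^ m) / (t * (1/2) ^ m)) = k m" for m
      unfolding Zln(2) Z_log_integral[OF t] K0_def using t by (simp add: power_one_over field_simps)
    ultimately show ?thesis by simp
  qed
  have \<phi>cont: "(\<lambda>j. ?\<phi> (Z t (r j) \<omega>)) \<longlonglongrightarrow> ?\<phi> (Zi \<omega>)" if l: "(\<lambda>j. Z t (r j) \<omega>) \<longlonglongrightarrow> Zi \<omega>" for \<omega>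
  proof (cases "Zi \<omega> = 0")
    case False
    then show ?thesis by (intro tendsto_mult tendsto_ln l) auto
  next
    case True
    have "\<forall>\<^sub>F j in sequentially. Z t (r j) \<omega> < 1" using l True by (intro order_tendstoD) auto
    then have "\<forall>\<^sub>F j in sequentially. norm (?\<phi> (Z t (r j) \<omega>)) \<le> 2 * sqrt (Z t (r j) \<omega>)"
      by eventually_elim (use xlnx_le_sqrt[OF Z_pos[OF t]] in simp)
    moreover have "(\<lambda>j. 2 * sqrt (Z t (r j) \<omega>)) \<longlonglongrightarrow> 0"
      using tendsto_mult[OF tendsto_const tendsto_real_sqrt[OF l], of 2] True by simp
    ultimately have "(\<lambda>j. ?\<phi> (Z t (r j) \<omega>)) \<longlonglongrightarrow> 0" by (rule Lim_null_comparison)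
    then show ?thesis by (simp add: True)
  qed
  have r_lim: "filterlim r sequentially sequentially" using rj by (intro filterlim_at_top_mono[OF filterlim_ident]) auto
  have kr: "(\<lambda>j. k (r j)) \<longlonglongrightarrow> K0 + t * s" by (rule filterlim_compose[OF k_lim r_lim])
  \<comment> \<open>The constant 1 makes the integrands nonnegative, as Fatou's lemma requires,
    since \<open>z * ln z \<ge> - 1\<close>.\<close>
  have "(\<integral>\<^sup>+\<omega>. ennreal (?\<phi> (Zi \<omega>) + 1) \<partial>P') = (\<integral>\<^sup>+\<omega>. liminf (\<lambda>j. ennreal (?\<phi> (Z t (r j) \<omega>) + 1)) \<partial>P')"
  proof (rule nn_integral_cong_AE)
    show "AE \<omega> in P'. ennreal (?\<phi> (Zi \<omega>) + 1) = liminf (\<lambda>j. ennreal (?\<phi> (Z t (r j) \<omega>) + 1))"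
      using lim
    proof eventually_elim
      case (elim \<omega>)
      have "(\<lambda>j. ennreal (?\<phi> (Z t (r j) \<omega>) + 1)) \<longlonglongrightarrow> ennreal (?\<phi> (Zi \<omega>) + 1)"
        by (intro tendsto_ennrealI tendsto_add tendsto_const \<phi>cont elim)
      from lim_imp_Liminf[OF _ this] show ?case by simp
    qed
  qed
  also have "\<dots> \<le> liminf (\<lambda>j. \<integral>\<^sup>+\<omega>. ennreal (?\<phi> (Z t (r j) \<omega>) + 1) \<partial>P')"
    by (rule nn_integral_liminf) measurable
  also have "\<dots> = liminf (\<lambda>j. ennreal (k (r j) + 1))"
  proof -
    have "(\<integral>\<^sup>+\<omega>. ennreal (?\<phi> (Z t m \<omega>) + 1) \<partial>P') = ennreal (k m + 1)" for m
    proof -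
      have nnm: "0 \<le> ?\<phi> (Z t m \<omega>) + 1" for \<omega>
        using xlnx_lower[OF less_imp_le[OF Z_pos[OF t, of m \<omega>]]] by linarith
      have "(\<integral>\<^sup>+\<omega>. ennreal (?\<phi> (Z t m \<omega>) + 1) \<partial>P') = ennreal (\<integral>\<omega>. ?\<phi> (Z t m \<omega>) + 1 \<partial>P')"
        using Zln(1)[of m] nnm by (intro nn_integral_eq_integral AE_I2) auto
      also have "(\<integral>\<omega>. ?\<phi> (Z t m \<omega>) + 1 \<partial>P') = k m + 1"
        using Zln(1)[of m] Y.prob_space by (subst Bochner_Integration.integral_add) (auto simp: k_def)
      finally show ?thesis .
    qed
    then show ?thesis by simp
  qed
  also have "\<dots> = ennreal (K0 + t * s + 1)"
    by (rule lim_imp_Liminf) (auto intro!: tendsto_ennrealI tendsto_add kr)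
  finally have fatou: "(\<integral>\<^sup>+\<omega>. ennreal (?\<phi> (Zi \<omega>) + 1) \<partial>P') \<le> ennreal (K0 + t * s + 1)" .
  have nnZ: "0 \<le> ?\<phi> (Zi \<omega>) + 1" for \<omega> using xlnx_lower[OF Zi0[of \<omega>]] by linarith
  have int1: "integrable P' (\<lambda>\<omega>. ?\<phi> (Zi \<omega>) + 1)"
  proof (rule integrableI_nonneg)
    show "AE \<omega> in P'. 0 \<le> ?\<phi> (Zi \<omega>) + 1" by (intro AE_I2 nnZ)
    show "(\<integral>\<^sup>+\<omega>. ennreal (?\<phi> (Zi \<omega>) + 1) \<partial>P') < \<infinity>" using fatou by (rule le_less_trans) simp
  qed measurable
  then have int\<phi>: "integrable P' (\<lambda>\<omega>. ?\<phi> (Zi \<omega>))"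
    using Bochner_Integration.integrable_diff[OF int1, of "\<lambda>_. 1"] by simp
  \<comment> \<open>The tangent is taken at \<open>Z t m\<close>. Its linear term integrates to 0,
    because \<open>Zi\<close> and \<open>Z t m\<close> give the same integral to the skeleton
    function \<open>1 + ln (Z t m \<omega>)\<close>.\<close>
  have lower: "k m \<le> (\<integral>\<omega>. ?\<phi> (Zi \<omega>) \<partial>P')" for m
  proof -
    define g where "g w = 1 + ln (lr (t / 2 ^ m) (2 ^ m) w)" for w
    have g: "depends_upto (2 ^ m) g" using dln[of m] unfolding depends_upto_def g_def by metis
    have gZ: "g (\<lambda>i. \<omega> (real i * (t / 2 ^ m))) = 1 + ln (Z t m \<omega>)" for \<omega> by (simp add: g_def Z_def)
    note c1 = change[OF g, unfolded gZ] and c2 = change_measure(3,4)[OF t order_refl g, unfolded gZ]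
    have "k m = (\<integral>\<omega>. ?\<phi> (Z t m \<omega>) + (Zi \<omega> * (1 + ln (Z t m \<omega>)) - Z t m \<omega> * (1 + ln (Z t m \<omega>))) \<partial>P')"
      using Zln(1)[of m] c1 c2
      by (subst Bochner_Integration.integral_add) (auto simp: k_def Bochner_Integration.integral_diff)
    also have "\<dots> \<le> (\<integral>\<omega>. ?\<phi> (Zi \<omega>) \<partial>P')"
    proof (rule integral_mono)
      show "integrable P' (\<lambda>\<omega>. ?\<phi> (Z t m \<omega>) + (Zi \<omega> * (1 + ln (Z t m \<omega>)) - Z t m \<omega> * (1 + ln (Z t m \<omega>))))"
        by (intro Bochner_Integration.integrable_add Bochner_Integration.integrable_diff Zln c1 c2)
      show "integrable P' (\<lambda>\<omega>. ?\<phi> (Zi \<omega>))" by (rule int\<phi>)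
      fix \<omega>
      show "?\<phi> (Z t m \<omega>) + (Zi \<omega> * (1 + ln (Z t m \<omega>)) - Z t m \<omega> * (1 + ln (Z t m \<omega>))) \<le> ?\<phi> (Zi \<omega>)"
        using xlnx_tangent[OF Z_pos[OF t] Zi0, of m \<omega> \<omega>] by (simp only: left_diff_distrib right_diff_distrib mult.commute)
    qed
    finally show ?thesis .
  qed
  have ge: "K0 + t * s \<le> (\<integral>\<omega>. ?\<phi> (Zi \<omega>) \<partial>P')"
    by (rule LIMSEQ_le_const2[OF k_lim]) (use lower in auto)
  have "ennreal (\<integral>\<omega>. ?\<phi> (Zi \<omega>) + 1 \<partial>P') = (\<integral>\<^sup>+\<omega>. ennreal (?\<phi> (Zi \<omega>) + 1) \<partial>P')"
    using int1 by (intro nn_integral_eq_integral[symmetric] AE_I2 nnZ)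
  then have "ennreal (\<integral>\<omega>. ?\<phi> (Zi \<omega>) + 1 \<partial>P') \<le> ennreal (K0 + t * s + 1)" using fatou by simp
  moreover have "(\<integral>\<omega>. ?\<phi> (Zi \<omega>) + 1 \<partial>P') = (\<integral>\<omega>. ?\<phi> (Zi \<omega>) \<partial>P') + 1"
    using int\<phi> Y.prob_space by (subst Bochner_Integration.integral_add) auto
  \<comment> \<open>\<open>ennreal\<close> sends negative numbers to 0, so the comparison can be
    read back in the reals once \<open>K0 + t * s + 1\<close> is known to be nonnegative.\<close>
  moreover have "- 1 \<le> K0 + t * s"
  proof (rule LIMSEQ_le_const[OF kr], intro exI allI impI)
    fix j
    have "(\<integral>\<omega>. - 1 \<partial>P') \<le> k (r j)"
      unfolding k_def using Zln(1) xlnx_lower[OF less_imp_le[OF Z_pos[OF t]]] by (intro integral_mono) auto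
    then show "- 1 \<le> k (r j)" using Y.prob_space by simp
  qed
  ultimately have "(\<integral>\<omega>. ?\<phi> (Zi \<omega>) \<partial>P') + 1 \<le> K0 + t * s + 1" by (simp add: ennreal_le_iff)
  with ge show ?thesis unfolding KL K0_def by linarith
qed

lemma relative_entropy_rate_eq:
  assumes s: "((\<lambda>h. skel_KL (pmf \<mu>) h / h) \<longlongrightarrow> s) (at_right 0)"
  shows "relative_entropy_rate P P' = s"
proof -
  let ?K = "\<Sum>x\<in>UNIV. pmf \<mu> x * ln (pmf \<mu> x / pmf \<mu>' x)"
  have "((\<lambda>t. ?K / t + s) \<longlongrightarrow> 0 + s) at_top"
    by (intro tendsto_add tendsto_const tendsto_divide_0[OF tendsto_const] filterlim_at_top_imp_at_infinity filterlim_ident)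
  moreover have "\<forall>\<^sub>F t in at_top. ?K / t + s = 1 / t * KL_divergence (exp 1) (restr_to_subalg P' (path_filtration t)) (restr_to_subalg P (path_filtration t))"
    using eventually_gt_at_top[of 0]
  proof eventually_elim
    case (elim t)
    then show ?case unfolding KL_path[OF elim s] by (simp add: field_simps)
  qed
  ultimately have "((\<lambda>t. 1 / t * KL_divergence (exp 1) (restr_to_subalg P' (path_filtration t)) (restr_to_subalg P (path_filtration t))) \<longlongrightarrow> s) at_top"
    using Lim_transform_eventually by fastforce
  then show ?thesis unfolding relative_entropy_rate_def by (intro tendsto_Lim) auto
qed

end

section \<open>Waiting times and entropy\<close>

lemma waiting_time_attained:
  assumes "\<exists>k\<ge>1. \<forall>i\<in>{1..n}. X (real i * \<delta>) = Y (real (k + i) * \<delta>)"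
  obtains k where "1 \<le> k" "\<forall>i\<in>{1..n}. X (real i * \<delta>) = Y (real (k + i) * \<delta>)" "waiting_time \<delta> n X Y = enat k"
    "\<And>k'. 1 \<le> k' \<Longrightarrow> \<forall>i\<in>{1..n}. X (real i * \<delta>) = Y (real (k' + i) * \<delta>) \<Longrightarrow> k \<le> k'"
proof -
  let ?S = "{k. 1 \<le> k \<and> (\<forall>i\<in>{1..n}. X (real i * \<delta>) = Y (real (k + i) * \<delta>))}"
  define k where "k = (LEAST k. k \<in> ?S)"
  have ex: "\<exists>k. k \<in> ?S" using assms by blast
  have kS: "k \<in> ?S" unfolding k_def using ex by (rule LeastI_ex)
  have le: "k \<le> k'" if "k' \<in> ?S" for k' unfolding k_def using that by (rule Least_le)
  have "waiting_time \<delta> n X Y = enat k"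
    unfolding waiting_time_def
  proof (rule antisym)
    show "Inf (enat ` ?S) \<le> enat k" by (rule Inf_lower[OF imageI[OF kS]])
    show "enat k \<le> Inf (enat ` ?S)" by (rule Inf_greatest) (use le in auto)
  qed
  with kS le show thesis by (intro that[of k]) auto
qed

lemma log_waiting_ratio_finite:
  assumes "waiting_time \<delta> n X Y = enat k" "waiting_time \<delta> n X X' = enat k'" "1 \<le> k" "1 \<le> k'" "0 < \<delta>" "0 < n"
  shows "1 / ereal (real n * \<delta>) * log_waiting_ratio \<delta> n X Y X' = ereal ((ln (real k) / real n - ln (real k') / real n) / \<delta>)"
proof -
  have k: "0 < real k" "0 < real k'" using assms(3,4) by linarith+
  have ln: "ln_ereal (ereal q) = ereal (ln q)" if "0 < q" for q
    using that by (simp add: ln_ereal_def)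
  have "ereal_of_enat (enat k) / ereal_of_enat (enat k') = ereal (real k / real k')"
    using k by simp
  then have "log_waiting_ratio \<delta> n X Y X' = ereal (ln (real k / real k'))"
    unfolding log_waiting_ratio_def assms(1,2) using ln[OF divide_pos_pos[OF k]] by (simp only:)
  also have "ln (real k / real k') = ln (real k) - ln (real k')" using assms by (simp add: ln_div)
  moreover have "1 / ereal (real n * \<delta>) = ereal (1 / (real n * \<delta>))" using assms by (simp add: one_ereal_def)
  ultimately show ?thesis using assms by (simp add: field_simps)
qed

lemma sum_over_pairs:
  fixes f :: "'a::finite \<Rightarrow> 'a \<Rightarrow> real"
  shows "(\<Sum>i<n. f (\<xi> (real i * u)) (\<xi> (real (Suc i) * u))) = (\<Sum>x\<in>UNIV. \<Sum>y\<in>UNIV. f x y * real (pair_count u n x y \<xi>))"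
proof -
  have pt: "f a b = (\<Sum>x\<in>UNIV. \<Sum>y\<in>UNIV. f x y * (if a = x \<and> b = y then 1 else 0))" for a b
  proof -
    have "(\<Sum>y\<in>UNIV. f x y * (if a = x \<and> b = y then 1 else 0)) = (if a = x then f x b else 0)" for x
      by (cases "a = x") (simp_all add: if_distrib[of "\<lambda>z. _ * z"] cong: if_cong)
    then show ?thesis by simp
  qed
  have "(\<Sum>i<n. f (\<xi> (real i * u)) (\<xi> (real (Suc i) * u))) =
    (\<Sum>i<n. \<Sum>x\<in>UNIV. \<Sum>y\<in>UNIV. f x y * (if \<xi> (real i * u) = x \<and> \<xi> (real (Suc i) * u) = y then 1 else 0))"
    by (intro sum.cong refl pt)
  also have "\<dots> = (\<Sum>x\<in>UNIV. \<Sum>i<n. \<Sum>y\<in>UNIV. f x y * (if \<xi> (real i * u) = x \<and> \<xi> (real (Suc i) * u) = y then 1 else 0))"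
    by (rule sum.swap)
  also have "\<dots> = (\<Sum>x\<in>UNIV. \<Sum>y\<in>UNIV. \<Sum>i<n. f x y * (if \<xi> (real i * u) = x \<and> \<xi> (real (Suc i) * u) = y then 1 else 0))"
    by (intro sum.cong refl sum.swap)
  finally show ?thesis unfolding sum_distrib_left[symmetric] sum_indicator_pairs .
qed

text \<open>Carries a statement about two coordinates to the triple product; \<open>f\<close> will
  be a projection, and \<open>pull\<close> says that null sets pull back to null sets. The null set
  of exceptions is transported, because \<open>R\<close> may be nonmeasurable.\<close>

lemma AE_pair_lift:
  assumes "prob_space M1" "prob_space M2" "prob_space M'" and f: "f \<in> M' \<rightarrow>\<^sub>M M2"
    and pull: "\<And>Q. AE y in M2. Q y \<Longrightarrow> AE z in M'. Q (f z)" and R: "AE z in M1 \<Otimes>\<^sub>M M2. R z"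
  shows "AE w in M1 \<Otimes>\<^sub>M M'. R (fst w, f (snd w))"
proof -
  interpret M1: prob_space M1 by fact
  interpret M2: prob_space M2 by fact
  interpret M': prob_space M' by fact
  interpret A: pair_prob_space M1 M2 by unfold_locales
  interpret B: pair_prob_space M1 M' by unfold_locales
  obtain N where N: "{z \<in> space (M1 \<Otimes>\<^sub>M M2). \<not> R z} \<subseteq> N" "emeasure (M1 \<Otimes>\<^sub>M M2) N = 0" "N \<in> sets (M1 \<Otimes>\<^sub>M M2)"
    using R by (rule AE_E)
  have "N \<in> null_sets (M1 \<Otimes>\<^sub>M M2)" using N by (intro null_setsI)
  from AE_not_in[OF this] have "AE x in M1. AE y in M2. (x, y) \<notin> N" by (rule A.AE_pair)
  then have ae: "AE x in M1. AE z in M'. (x, f z) \<notin> N" by eventually_elim (rule pull)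
  let ?g = "\<lambda>w. (fst w, f (snd w))"
  have g: "?g \<in> M1 \<Otimes>\<^sub>M M' \<rightarrow>\<^sub>M M1 \<Otimes>\<^sub>M M2"
    by (intro measurable_Pair measurable_fst measurable_compose[OF measurable_snd f])
  have "{w \<in> space (M1 \<Otimes>\<^sub>M M'). ?g w \<notin> N} = space (M1 \<Otimes>\<^sub>M M') - (?g -` N \<inter> space (M1 \<Otimes>\<^sub>M M'))" by auto
  also have "\<dots> \<in> sets (M1 \<Otimes>\<^sub>M M')" using measurable_sets[OF g N(3)] by (rule sets.compl_sets)
  finally have "AE w in M1 \<Otimes>\<^sub>M M'. ?g w \<notin> N" by (rule B.AE_pair_measure) (use ae in simp)
  then show ?thesis
    using AE_space
  proof eventually_elim
    case (elim w)
    from measurable_space[OF g elim(2)] elim(1) N(1) show ?case by blast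
  qed
qed

section \<open>Exponential growth rate of one waiting time\<close>

context ctmc
begin

lemma ln_weight_limit:
  assumes \<delta>: "0 < \<delta>" and q: "\<And>x y. (\<lambda>n. real (pair_count \<delta> n x y \<xi>) / real n) \<longlonglongrightarrow> q x y"
  shows "(\<lambda>n. - ln (weight \<delta> n (\<lambda>i. \<xi> (real i * \<delta>))) / real n) \<longlonglongrightarrow> - (\<Sum>x\<in>UNIV. \<Sum>y\<in>UNIV. q x y * ln (tp \<delta> x y))"
proof -
  let ?f = "\<lambda>x y. ln (tp \<delta> x y)"
  \<comment> \<open>Pair counts include the transition from time 0 to time \<open>\<delta>\<close>,
    which \<open>weight\<close> omits. The difference \<open>?b\<close> disappears after division by
    \<open>n\<close>.\<close>
  let ?b = "?f (\<xi> (real 0 * \<delta>)) (\<xi> (real (Suc 0) * \<delta>))"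
  have "(\<lambda>n. - (\<Sum>x\<in>UNIV. \<Sum>y\<in>UNIV. real (pair_count \<delta> n x y \<xi>) / real n * ?f x y) + ?b * (1 / real n)) \<longlonglongrightarrow>
      - (\<Sum>x\<in>UNIV. \<Sum>y\<in>UNIV. q x y * ?f x y) + ?b * 0"
    by (intro tendsto_add tendsto_minus tendsto_sum tendsto_mult tendsto_const q lim_1_over_n)
  moreover have "\<forall>\<^sub>F n in sequentially. - (\<Sum>x\<in>UNIV. \<Sum>y\<in>UNIV. real (pair_count \<delta> n x y \<xi>) / real n * ?f x y) + ?b * (1 / real n) =
      - ln (weight \<delta> n (\<lambda>i. \<xi> (real i * \<delta>))) / real n"
    using eventually_gt_at_top[of 0]
  proof eventually_elim
    case (elim n)
    have "ln (weight \<delta> n (\<lambda>i. \<xi> (real i * \<delta>))) = (\<Sum>i\<in>{1..<n}. ?f (\<xi> (real i * \<delta>)) (\<xi> (real (Suc i) * \<delta>)))"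
      unfolding weight_def by (rule ln_prod) (rule finite_atLeastLessThan, rule less_imp_neq[OF tp_pos[OF \<delta>], THEN not_sym])
    moreover have "(\<Sum>i<n. ?f (\<xi> (real i * \<delta>)) (\<xi> (real (Suc i) * \<delta>))) = ?b + (\<Sum>i\<in>{1..<n}. ?f (\<xi> (real i * \<delta>)) (\<xi> (real (Suc i) * \<delta>)))"
    proof -
      have "{..<n} = insert 0 {1..<n}" using elim by auto
      then show ?thesis by simp
    qed
    ultimately have "ln (weight \<delta> n (\<lambda>i. \<xi> (real i * \<delta>))) = (\<Sum>x\<in>UNIV. \<Sum>y\<in>UNIV. ?f x y * real (pair_count \<delta> n x y \<xi>)) - ?b"
      unfolding sum_over_pairs[of ?f \<xi> \<delta> n] by linarith
    moreover have "(\<Sum>x\<in>UNIV. \<Sum>y\<in>UNIV. real (pair_count \<delta> n x y \<xi>) / real n * ?f x y) = (\<Sum>x\<in>UNIV. \<Sum>y\<in>UNIV. ?f x y * real (pair_count \<delta> n x y \<xi>)) / real n"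
      unfolding sum_divide_distrib by (intro sum.cong refl) simp
    ultimately show ?case by (simp add: diff_divide_distrib)
  qed
  ultimately have "(\<lambda>n. - ln (weight \<delta> n (\<lambda>i. \<xi> (real i * \<delta>))) / real n) \<longlonglongrightarrow> - (\<Sum>x\<in>UNIV. \<Sum>y\<in>UNIV. q x y * ?f x y) + ?b * 0"
    by (rule Lim_transform_eventually)
  then show ?thesis by simp
qed

text \<open>A deterministic statement about one pair of paths: \<open>U\<close> provides a match
  that is not too late, so the waiting time is finite and attained, and \<open>L\<close> says that
  the first match is not too early.\<close>

lemma waiting_limit:
  assumes \<delta>: "0 < \<delta>" and q: "\<And>x y. (\<lambda>n. real (pair_count \<delta> n x y \<xi>) / real n) \<longlonglongrightarrow> q x y"
    and U: "\<And>\<epsilon>. 0 < \<epsilon> \<Longrightarrow> \<forall>\<^sub>F n in sequentially. \<forall>w. \<exists>k\<ge>1. real k \<le> exp (\<epsilon> * real n) / weight \<delta> n w \<and> (\<forall>i\<in>{1..n}. w i = \<omega> (real (k + i) * \<delta>))"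
    and L: "\<And>\<epsilon>. 0 < \<epsilon> \<Longrightarrow> \<forall>\<^sub>F n in sequentially. \<forall>k\<ge>1. (\<forall>i\<in>{1..n}. \<xi> (real i * \<delta>) = \<omega> (real (k + i) * \<delta>)) \<longrightarrow>
        exp (- (2 * \<epsilon> * real n)) / weight \<delta> n (\<lambda>i. \<xi> (real i * \<delta>)) \<le> real k"
  shows "\<exists>W. (\<forall>\<^sub>F n in sequentially. 1 \<le> W n \<and> waiting_time \<delta> n \<xi> \<omega> = enat (W n)) \<and>
    (\<lambda>n. ln (real (W n)) / real n) \<longlonglongrightarrow> - (\<Sum>x\<in>UNIV. \<Sum>y\<in>UNIV. q x y * ln (tp \<delta> x y))"
proof (intro exI conjI)
  let ?w = "\<lambda>n. weight \<delta> n (\<lambda>i. \<xi> (real i * \<delta>))"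
  \<comment> \<open>\<open>the_enat\<close> is unspecified at an infinite waiting time, which under
    \<open>U\<close> happens for finitely many \<open>n\<close> only.\<close>
  define W where "W n = the_enat (waiting_time \<delta> n \<xi> \<omega>)" for n
  have main: "\<forall>\<^sub>F n in sequentially. 1 \<le> W n \<and> waiting_time \<delta> n \<xi> \<omega> = enat (W n) \<and> \<bar>ln (real (W n)) / real n - (- ln (?w n) / real n)\<bar> \<le> 2 * \<epsilon>"
    if \<epsilon>: "0 < \<epsilon>" for \<epsilon>
    using U[OF \<epsilon>] L[OF \<epsilon>] eventually_gt_at_top[of 0]
  proof eventually_elim
    case (elim n)
    obtain k0 where k0: "1 \<le> k0" "real k0 \<le> exp (\<epsilon> * real n) / ?w n" "\<forall>i\<in>{1..n}. \<xi> (real i * \<delta>) = \<omega> (real (k0 + i) * \<delta>)"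
      using elim(1) by blast
    obtain k where k: "1 \<le> k" "\<forall>i\<in>{1..n}. \<xi> (real i * \<delta>) = \<omega> (real (k + i) * \<delta>)" "waiting_time \<delta> n \<xi> \<omega> = enat k"
      "\<And>k'. 1 \<le> k' \<Longrightarrow> \<forall>i\<in>{1..n}. \<xi> (real i * \<delta>) = \<omega> (real (k' + i) * \<delta>) \<Longrightarrow> k \<le> k'"
      using waiting_time_attained[of n \<xi> \<delta> \<omega>] k0(1,3) by blast
    have W: "W n = k" by (simp add: W_def k(3))
    have w: "0 < ?w n" by (rule weight_pos[OF \<delta>])
    have n: "0 < real n" using elim(3) by simp
    have "real k \<le> real k0" using k(4)[OF k0(1,3)] by simp
    with k0(2) have "real k \<le> exp (\<epsilon> * real n) / ?w n" by linarith
    then have "ln (real k) \<le> ln (exp (\<epsilon> * real n) / ?w n)" using k(1) by (intro ln_mono) auto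
    then have 1: "ln (real k) \<le> \<epsilon> * real n - ln (?w n)" using w by (simp add: ln_div)
    have "exp (- (2 * \<epsilon> * real n)) / ?w n \<le> real k" using elim(2) k(1,2) by blast
    then have "ln (exp (- (2 * \<epsilon> * real n)) / ?w n) \<le> ln (real k)" using w by (intro ln_mono) auto
    then have 2: "- (2 * \<epsilon> * real n) - ln (?w n) \<le> ln (real k)" using w by (simp add: ln_div)
    have "ln (real k) / real n - (- ln (?w n) / real n) = (ln (real k) + ln (?w n)) / real n" by (simp add: add_divide_distrib)
    moreover have "(ln (real k) + ln (?w n)) / real n \<le> 2 * \<epsilon>"
    proof -
      have "0 \<le> \<epsilon> * real n" using \<epsilon> by simp
      then have "ln (real k) + ln (?w n) \<le> 2 * \<epsilon> * real n" using 1 by linarith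
      then show ?thesis by (simp only: pos_divide_le_eq[OF n])
    qed
    moreover have "- (2 * \<epsilon>) \<le> (ln (real k) + ln (?w n)) / real n"
      unfolding pos_le_divide_eq[OF n] using 2 by linarith
    ultimately show ?case using k W by (simp add: abs_le_iff)
  qed
  from main[of 1] show "\<forall>\<^sub>F n in sequentially. 1 \<le> W n \<and> waiting_time \<delta> n \<xi> \<omega> = enat (W n)"
    by (auto elim: eventually_mono)
  have "(\<lambda>n. ln (real (W n)) / real n - (- ln (?w n) / real n)) \<longlonglongrightarrow> 0"
  proof (rule tendstoI)
    fix e :: real assume e: "0 < e"
    have "\<forall>\<^sub>F n in sequentially. 1 \<le> W n \<and> waiting_time \<delta> n \<xi> \<omega> = enat (W n) \<and> \<bar>ln (real (W n)) / real n - (- ln (?w n) / real n)\<bar> \<le> 2 * (e / 3)"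
      using e by (intro main) simp
    then show "\<forall>\<^sub>F n in sequentially. dist (ln (real (W n)) / real n - (- ln (?w n) / real n)) 0 < e"
    proof eventually_elim
      case (elim n)
      have "dist (ln (real (W n)) / real n - (- ln (?w n) / real n)) 0 \<le> 2 * (e / 3)"
        using elim by (simp only: dist_real_def diff_zero)
      also have "\<dots> < e" using e by simp
      finally show ?case .
    qed
  qed
  from tendsto_add[OF this ln_weight_limit[OF \<delta> q]]
  show "(\<lambda>n. ln (real (W n)) / real n) \<longlonglongrightarrow> - (\<Sum>x\<in>UNIV. \<Sum>y\<in>UNIV. q x y * ln (tp \<delta> x y))" by simp
qed

text \<open>The bound is monotone in \<open>\<epsilon>\<close>, so the tolerances
  \<open>1 / (m + 1)\<close> suffice; together with countably many intervals of steps this leaves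
  one null set.\<close>

lemma waiting_upper_all:
  "AE \<omega> in P. \<forall>\<delta>>0. \<forall>\<epsilon>>0. \<forall>\<^sub>F n in sequentially. \<forall>w. \<exists>k\<ge>1. real k \<le> exp (\<epsilon> * real n) / weight \<delta> n w \<and>
    (\<forall>i\<in>{1..n}. w i = \<omega> (real (k + i) * \<delta>))"
proof -
  have "AE \<omega> in P. \<forall>j m :: nat. \<forall>\<^sub>F n in sequentially. \<forall>\<delta>\<in>{1 / real (Suc j)..real (Suc j)}. \<forall>w.
    \<exists>k\<ge>1. real k \<le> exp (1 / real (Suc m) * real n) / weight \<delta> n w \<and> (\<forall>i\<in>{1..n}. w i = \<omega> (real (k + i) * \<delta>))"
    unfolding AE_all_countable
  proof (intro allI waiting_upper)
    show "1 / real (Suc j) \<le> real (Suc j)" for j by (rule order_trans[of _ 1]) auto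
  qed auto
  then show ?thesis
  proof eventually_elim
    case (elim \<omega>)
    show ?case
    proof (intro allI impI)
      fix \<delta> \<epsilon> :: real assume \<delta>: "0 < \<delta>" and \<epsilon>: "0 < \<epsilon>"
      obtain j :: nat where j: "max \<delta> (1 / \<delta>) < real j" using reals_Archimedean2 by blast
      then have "\<delta> \<le> real (Suc j)" "1 / \<delta> \<le> real (Suc j)" by auto
      then have d: "\<delta> \<in> {1 / real (Suc j)..real (Suc j)}" using \<delta> by (auto simp: field_simps)
      obtain m where m: "1 / real (Suc m) < \<epsilon>" using nat_approx_posE[OF \<epsilon>] .
      from elim[rule_format, of j m]
      show "\<forall>\<^sub>F n in sequentially. \<forall>w. \<exists>k\<ge>1. real k \<le> exp (\<epsilon> * real n) / weight \<delta> n w \<and> (\<forall>i\<in>{1..n}. w i = \<omega> (real (k + i) * \<delta>))"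
      proof eventually_elim
        case (elim n)
        show ?case
        proof
          fix w
          obtain k where k: "k \<ge> 1" "real k \<le> exp (1 / real (Suc m) * real n) / weight \<delta> n w" "\<forall>i\<in>{1..n}. w i = \<omega> (real (k + i) * \<delta>)"
            using elim d by blast
          have "exp (1 / real (Suc m) * real n) / weight \<delta> n w \<le> exp (\<epsilon> * real n) / weight \<delta> n w"
          proof (rule divide_right_mono)
            have "1 / real (Suc m) * real n \<le> \<epsilon> * real n" by (rule mult_right_mono[OF less_imp_le[OF m]]) simp
            then show "exp (1 / real (Suc m) * real n) \<le> exp (\<epsilon> * real n)" by (simp only: exp_le_cancel_iff)
          qed (rule less_imp_le[OF weight_pos[OF \<delta>]])
          with k(2) have "real k \<le> exp (\<epsilon> * real n) / weight \<delta> n w" by linarith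
          with k(1,3) show "\<exists>k\<ge>1. real k \<le> exp (\<epsilon> * real n) / weight \<delta> n w \<and> (\<forall>i\<in>{1..n}. w i = \<omega> (real (k + i) * \<delta>))" by blast
        qed
      qed
    qed
  qed
qed

end

context ctmc_pair
begin

lemma waiting_lower_all:
  "AE z in P \<Otimes>\<^sub>M P'. \<forall>\<delta>>0. \<forall>\<epsilon>>0. \<forall>\<^sub>F n in sequentially. \<forall>k\<ge>1.
    (\<forall>i\<in>{1..n}. fst z (real i * \<delta>) = snd z (real (k + i) * \<delta>)) \<longrightarrow>
    exp (- (2 * \<epsilon> * real n)) / Y.weight \<delta> n (\<lambda>i. fst z (real i * \<delta>)) \<le> real k"
proof -
  have j: "1 / real (Suc j) \<le> real (Suc j)" for j by (rule order_trans[of _ 1]) auto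
  have "AE z in P \<Otimes>\<^sub>M P'. \<forall>j m :: nat. \<forall>\<^sub>F n in sequentially. \<forall>\<delta>\<in>{1 / real (Suc j)..real (Suc j)}. \<forall>k\<ge>1.
    (\<forall>i\<in>{1..n}. fst z (real i * \<delta>) = snd z (real (k + i) * \<delta>)) \<longrightarrow>
    exp (- (2 * (1 / real (Suc m)) * real n)) / Y.weight \<delta> n (\<lambda>i. fst z (real i * \<delta>)) \<le> real k"
    unfolding AE_all_countable
  proof (intro allI)
    fix j m
    show "AE z in P \<Otimes>\<^sub>M P'. \<forall>\<^sub>F n in sequentially. \<forall>\<delta>\<in>{1 / real (Suc j)..real (Suc j)}. \<forall>k\<ge>1.
      (\<forall>i\<in>{1..n}. fst z (real i * \<delta>) = snd z (real (k + i) * \<delta>)) \<longrightarrow>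
      exp (- (2 * (1 / real (Suc m)) * real n)) / Y.weight \<delta> n (\<lambda>i. fst z (real i * \<delta>)) \<le> real k"
    proof (rule Y.waiting_lower[OF _ j _ X.prob_space_axioms X.sets_P])
      show "0 < X.Lam" using X.Lam_ge_1 by linarith
    qed (use X.AE_bad_windows j in auto)
  qed
  then show ?thesis
  proof eventually_elim
    case (elim z)
    show ?case
    proof (intro allI impI)
      fix \<delta> \<epsilon> :: real assume \<delta>: "0 < \<delta>" and \<epsilon>: "0 < \<epsilon>"
      obtain j :: nat where j: "max \<delta> (1 / \<delta>) < real j" using reals_Archimedean2 by blast
      then have "\<delta> \<le> real (Suc j)" "1 / \<delta> \<le> real (Suc j)" by auto
      then have d: "\<delta> \<in> {1 / real (Suc j)..real (Suc j)}" using \<delta> by (auto simp: field_simps)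
      obtain m where m: "1 / real (Suc m) < \<epsilon>" using nat_approx_posE[OF \<epsilon>] .
      from elim[rule_format, of j m]
      show "\<forall>\<^sub>F n in sequentially. \<forall>k\<ge>1. (\<forall>i\<in>{1..n}. fst z (real i * \<delta>) = snd z (real (k + i) * \<delta>)) \<longrightarrow>
        exp (- (2 * \<epsilon> * real n)) / Y.weight \<delta> n (\<lambda>i. fst z (real i * \<delta>)) \<le> real k"
      proof eventually_elim
        case (elim n)
        show ?case
        proof (intro allI impI)
          fix k :: nat assume k: "1 \<le> k" and mt: "\<forall>i\<in>{1..n}. fst z (real i * \<delta>) = snd z (real (k + i) * \<delta>)"
          have "exp (- (2 * \<epsilon> * real n)) / Y.weight \<delta> n (\<lambda>i. fst z (real i * \<delta>)) \<le>
              exp (- (2 * (1 / real (Suc m)) * real n)) / Y.weight \<delta> n (\<lambda>i. fst z (real i * \<delta>))"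
          proof (rule divide_right_mono)
            have "2 * (1 / real (Suc m)) * real n \<le> 2 * \<epsilon> * real n"
              by (rule mult_right_mono, rule mult_left_mono[OF less_imp_le[OF m]]) simp_all
            then show "exp (- (2 * \<epsilon> * real n)) \<le> exp (- (2 * (1 / real (Suc m)) * real n))" by (simp only: exp_le_cancel_iff neg_le_iff_le)
          qed (rule less_imp_le[OF Y.weight_pos[OF \<delta>]])
          also have "\<dots> \<le> real k" using elim d k mt by blast
          finally show "exp (- (2 * \<epsilon> * real n)) / Y.weight \<delta> n (\<lambda>i. fst z (real i * \<delta>)) \<le> real k" .
        qed
      qed
    qed
  qed
qed

definition cross_entropy :: "real \<Rightarrow> real" where
  "cross_entropy \<delta> = - (\<Sum>x\<in>UNIV. \<Sum>y\<in>UNIV. pmf \<mu> x * X.tp \<delta> x y * ln (Y.tp \<delta> x y))"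

text \<open>The pair frequencies concern the first path alone and the upper bound the second path
  alone; only the lower bound is a joint statement about both.\<close>

theorem waiting_time_rate:
  "AE z in P \<Otimes>\<^sub>M P'. \<forall>\<delta>>0. \<exists>W. (\<forall>\<^sub>F n in sequentially. 1 \<le> W n \<and> waiting_time \<delta> n (fst z) (snd z) = enat (W n)) \<and>
    (\<lambda>n. ln (real (W n)) / real n) \<longlonglongrightarrow> cross_entropy \<delta>"
  using AE_pair_fst[OF Y.prob_space_axioms X.pair_count_LLN] AE_pair_snd[OF Y.prob_space_axioms Y.waiting_upper_all, of P] waiting_lower_all
proof eventually_elim
  case (elim z)
  show ?case
  proof (intro allI impI)
    fix \<delta> :: real assume \<delta>: "0 < \<delta>"
    show "\<exists>W. (\<forall>\<^sub>F n in sequentially. 1 \<le> W n \<and> waiting_time \<delta> n (fst z) (snd z) = enat (W n)) \<and>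
      (\<lambda>n. ln (real (W n)) / real n) \<longlonglongrightarrow> cross_entropy \<delta>"
      unfolding cross_entropy_def
      by (rule Y.waiting_limit[OF \<delta>]) (use elim \<delta> in blast)+
  qed
qed

end

theorem theorem1:
  fixes p :: "'a::finite \<Rightarrow> 'a \<Rightarrow> real"
    and c c' :: "'a \<Rightarrow> real"
    and \<mu> \<mu>' :: "'a pmf"
    and P P' :: "(real \<Rightarrow> 'a) measure"
  assumes "stochastic_matrix p"
    and "irreducible_matrix p"
    and "\<And>x. p x x = 0"
    and "\<And>x. 0 < c x"
    and "\<And>x. 0 < c' x"
    and "stationary (generator c p) \<mu>"
    and "stationary (generator c' p) \<mu>'"
    and "ctmc_law (generator c p) \<mu> P"
    and "ctmc_law (generator c' p) \<mu>' P'"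
  shows "AE (X, Y, X') in P \<Otimes>\<^sub>M (P' \<Otimes>\<^sub>M P).
    \<exists>l :: real \<Rightarrow> ereal.
      (\<forall>\<^sub>F \<delta> in at_right 0.
        (\<lambda>n. 1 / ereal (real n * \<delta>) * log_waiting_ratio \<delta> n X Y X') \<longlonglongrightarrow> l \<delta>) \<and>
      (l \<longlongrightarrow> ereal (relative_entropy_rate P P')) (at_right 0)"
proof -
  interpret A: ctmc_pair p c c' \<mu> \<mu>' P P' by unfold_locales (use assms in auto)
  \<comment> \<open>The waiting time in \<open>X'\<close> is the case of equal rates and equal
    laws.\<close>
  interpret B: ctmc_pair p c c \<mu> \<mu> P P by unfold_locales
  obtain s where s: "((\<lambda>h. A.skel_KL (pmf \<mu>) h / h) \<longlongrightarrow> s) (at_right 0)"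
    using A.skel_KL_rate by blast
  have rate: "relative_entropy_rate P P' = s" by (rule A.relative_entropy_rate_eq[OF s])
  have diff: "A.cross_entropy \<delta> - B.cross_entropy \<delta> = A.skel_KL (pmf \<mu>) \<delta>" if "0 < \<delta>" for \<delta>
  proof -
    have "pmf \<mu> x * A.X.tp \<delta> x y * ln (A.X.tp \<delta> x y / A.Y.tp \<delta> x y) =
        pmf \<mu> x * A.X.tp \<delta> x y * ln (A.X.tp \<delta> x y) - pmf \<mu> x * A.X.tp \<delta> x y * ln (A.Y.tp \<delta> x y)" for x y
      using A.X.tp_pos[OF that, of x y] A.Y.tp_pos[OF that, of x y] by (simp add: ln_div right_diff_distrib)
    then show ?thesis
      unfolding A.cross_entropy_def B.cross_entropy_def A.skel_KL_def by (simp add: sum_subtractf)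
  qed
  have pp: "prob_space (P' \<Otimes>\<^sub>M P)"
  proof -
    interpret pair_prob_space P' P by unfold_locales
    show ?thesis by (rule prob_space_axioms)
  qed
  note PX = A.X.prob_space_axioms and PY = A.Y.prob_space_axioms
  have 1: "AE w in P \<Otimes>\<^sub>M (P' \<Otimes>\<^sub>M P). \<forall>\<delta>>0. \<exists>W. (\<forall>\<^sub>F n in sequentially. 1 \<le> W n \<and> waiting_time \<delta> n (fst w) (fst (snd w)) = enat (W n)) \<and>
      (\<lambda>n. ln (real (W n)) / real n) \<longlonglongrightarrow> A.cross_entropy \<delta>"
    using AE_pair_lift[OF PX PY pp measurable_fst AE_pair_fst[OF PX] A.waiting_time_rate] by simp
  have 2: "AE w in P \<Otimes>\<^sub>M (P' \<Otimes>\<^sub>M P). \<forall>\<delta>>0. \<exists>W. (\<forall>\<^sub>F n in sequentially. 1 \<le> W n \<and> waiting_time \<delta> n (fst w) (snd (snd w)) = enat (W n)) \<and>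
      (\<lambda>n. ln (real (W n)) / real n) \<longlonglongrightarrow> B.cross_entropy \<delta>"
    using AE_pair_lift[OF PX PX pp measurable_snd AE_pair_snd[OF PX] B.waiting_time_rate] by simp
  have "AE w in P \<Otimes>\<^sub>M (P' \<Otimes>\<^sub>M P). \<exists>l :: real \<Rightarrow> ereal.
      (\<forall>\<^sub>F \<delta> in at_right 0.
        (\<lambda>n. 1 / ereal (real n * \<delta>) * log_waiting_ratio \<delta> n (fst w) (fst (snd w)) (snd (snd w))) \<longlonglongrightarrow> l \<delta>) \<and>
      (l \<longlongrightarrow> ereal (relative_entropy_rate P P')) (at_right 0)"
    using 1 2
  proof eventually_elim
    case (elim w)
    \<comment> \<open>The inner limit exists for every \<open>\<delta> > 0\<close> and has this
      value, so the outer limit is the slope of \<open>skel_KL\<close> at 0.\<close>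
    let ?l = "\<lambda>\<delta>. ereal (A.skel_KL (pmf \<mu>) \<delta> / \<delta>)"
    have conv: "(\<lambda>n. 1 / ereal (real n * \<delta>) * log_waiting_ratio \<delta> n (fst w) (fst (snd w)) (snd (snd w))) \<longlonglongrightarrow> ?l \<delta>" if \<delta>: "0 < \<delta>" for \<delta>
    proof -
      obtain V where V: "\<forall>\<^sub>F n in sequentially. 1 \<le> V n \<and> waiting_time \<delta> n (fst w) (fst (snd w)) = enat (V n)"
        "(\<lambda>n. ln (real (V n)) / real n) \<longlonglongrightarrow> A.cross_entropy \<delta>" using elim(1) \<delta> by blast
      obtain V' where V': "\<forall>\<^sub>F n in sequentially. 1 \<le> V' n \<and> waiting_time \<delta> n (fst w) (snd (snd w)) = enat (V' n)"
        "(\<lambda>n. ln (real (V' n)) / real n) \<longlonglongrightarrow> B.cross_entropy \<delta>" using elim(2) \<delta> by blast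
      have "(\<lambda>n. ereal ((ln (real (V n)) / real n - ln (real (V' n)) / real n) / \<delta>)) \<longlonglongrightarrow> ereal ((A.cross_entropy \<delta> - B.cross_entropy \<delta>) / \<delta>)"
        using \<delta> by (intro tendsto_ereal tendsto_divide tendsto_diff V V' tendsto_const) auto
      moreover have "\<forall>\<^sub>F n in sequentially. ereal ((ln (real (V n)) / real n - ln (real (V' n)) / real n) / \<delta>) =
          1 / ereal (real n * \<delta>) * log_waiting_ratio \<delta> n (fst w) (fst (snd w)) (snd (snd w))"
        using V(1) V'(1) eventually_gt_at_top[of 0]
      proof eventually_elim
        case (elim n)
        show ?case by (rule log_waiting_ratio_finite[symmetric]) (use elim \<delta> in auto)
      qed
      ultimately have "(\<lambda>n. 1 / ereal (real n * \<delta>) * log_waiting_ratio \<delta> n (fst w) (fst (snd w)) (snd (snd w))) \<longlonglongrightarrow> ereal ((A.cross_entropy \<delta> - B.cross_entropy \<delta>) / \<delta>)"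
        by (rule Lim_transform_eventually)
      then show ?thesis by (simp only: diff[OF \<delta>])
    qed
    have "\<forall>\<^sub>F \<delta> in at_right 0. (\<lambda>n. 1 / ereal (real n * \<delta>) * log_waiting_ratio \<delta> n (fst w) (fst (snd w)) (snd (snd w))) \<longlonglongrightarrow> ?l \<delta>"
      by (rule eventually_mono[OF eventually_at_right_less conv])
    moreover have "(?l \<longlongrightarrow> ereal (relative_entropy_rate P P')) (at_right 0)"
      unfolding rate by (rule tendsto_ereal[OF s])
    ultimately show ?case by (intro exI[of _ ?l] conjI)
  qed
  then show ?thesis by (simp add: split_beta)
qed

end
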